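(* Let $T_1,T_2\in\mathbb C^{m\times m}$ be arbitrary orthogonal projection matrices, and let $J$, $\{r_k\}_{k=1}^m$ and $\{A_k\}_{k=1}^m$ be defined by $T_1,T_2$ as in the context. Let $\{\rho_{nk}\}_{(n,k)\in J}$ be arbitrary complex numbers satisfying $$\rho_{nk}=n+r_k+\varkappa_{nk},\quad (n,k)\in J,\qquad\{\varkappa_{nk}\}\in l_2.$$ Let $\{B_{nk}\}_{(n,k)\in J}$ be arbitrary matrices from $\mathbb C^{m\times m}$ such that $B_{nk}=B_{nk}^\dagger\ge0$, $(n,k)\in J$, and such that for any group of multiple values $\rho_{n_1k_1}=\rho_{n_2k_2}=\dots=\rho_{n_rk_r}$ maximal by inclusion, $(n_1,k_1)<(n_2,k_2)<\dots<(n_r,k_r)$, we have $B_{n_1k_1}=B_{n_2k_2}=\dots=B_{n_rk_r}$ and $\operatorname{rank}(B_{n_1k_1})=r$. For each such group denote $B'_{n_1k_1}:=B_{n_1k_1}$, $B'_{n_jk_j}:=0$, $j=2,\dots,r$. Suppose that $$B_n^{(k)}:=\sum_{\substack{s=1,\dots,m\\ r_s=r_k}}B'_{ns}=A_k+K_{nk},\qquad\{\|K_{nk}\|\}\in l_2,\quad(n,k)\in J.$$ For each group of multiple values $\rho_{n_1k_1}=\rho_{n_2k_2}=\dots=\rho_{n_rk_r}$ maximal by inclusion, $(n_1,k_1)<(n_2,k_2)<\dots<(n_r,k_r)$, choose an orthonormal basis $\{\mathcal E_{n_jk_j}\}_{j=1}^r$ in $\operatorname{Ran}B_{n_1k_1}$,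 and define $\mathcal Y:=\{Y_{nk}\}_{(n,k)\in J}$ by $$Y_{nk}(x):=\begin{cases}(\cos(\rho_{nk}x)T_1+\sin(\rho_{nk}x)T_1^\perp)\mathcal E_{nk},&\rho_{nk}\ne0,\\(T_1+xT_1^\perp)\mathcal E_{nk},&\rho_{nk}=0.\end{cases}$$ If the sequence $\mathcal Y$ is complete in $L_2((0,\pi);\mathbb C^m)$, then it is a Riesz basis in $L_2((0,\pi);\mathbb C^m)$.
   Context: $m\ge1$; $\dagger$ denotes conjugate transpose; $I$ is the unit $(m\times m)$-matrix; an orthogonal projection matrix $T$ satisfies $T=T^\dagger=T^2$; $T_j^\perp:=I-T_j$; $\|A\|$ is the maximal singular value of the matrix $A$; $\mathbb N=\{1,2,\dots\}$. Put $$W^0(\rho):=(T_2T_1+T_2^\perp T_1^\perp)\sin\rho\pi+(T_2^\perp T_1-T_2T_1^\perp)\cos\rho\pi,$$ $$U^0(\rho):=(T_2T_1+T_2^\perp T_1^\perp)\cos\rho\pi+(T_2T_1^\perp-T_2^\perp T_1)\sin\rho\pi,\qquad E^0(\rho):=(W^0(\rho))^{-1}U^0(\rho).$$ $r_1\le\dots\le r_m$ are the zeros of $\det W^0(\rho)$ on $[0,1)$, counted with multiplicities (there are exactly $m$). $A_k:=\pi\operatorname{Res}_{\rho=r_k}E^0(\rho)$, $k=1,\dots,m$; these are orthogonal projection matrices. $p^\perp:=\dim(\operatorname{Ker}T_1\cap\operatorname{Ker}T_2)$ and $$J:=\{(n,k)\colon n\in\mathbb N,\ k=1,\dots,m\}\cup\{(0,k)\colon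 k=p^\perp+1,\dots,m\},$$ ordered lexicographically. Sums over $s$ involve only pairs $(n,s)\in J$. *)

theory Defs
  imports "HOL-Complex_Analysis.Complex_Analysis" "HOL-Library.Multiset"
begin

section \<open>Complex matrices\<close>

definition mscale :: "complex \<Rightarrow> complex ^ 'n ^ 'm \<Rightarrow> complex ^ 'n ^ 'm"  (infixr "*m" 75)
  where "c *m A = (\<chi> i j. c * A $ i $ j)"

definition ctransp :: "complex ^ 'n ^ 'm \<Rightarrow> complex ^ 'm ^ 'n"
  where "ctransp A = (\<chi> i j. cnj (A $ j $ i))"

text \<open>The inner product \<open>u\<^sup>\<dagger> v\<close>, conjugate-linear in the first argument. The library's
  \<open>\<bullet>\<close> on \<open>complex ^ 'n\<close> is its real part.\<close>

definition cinner :: "complex ^ 'n \<Rightarrow> complex ^ 'n \<Rightarrow> complex"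
  where "cinner u v = (\<Sum>i\<in>UNIV. cnj (u $ i) * v $ i)"

definition orth_proj :: "complex ^ 'm ^ 'm \<Rightarrow> bool"
  where "orth_proj T \<longleftrightarrow> T = ctransp T \<and> T = T ** T"

definition perp :: "complex ^ 'm ^ 'm \<Rightarrow> complex ^ 'm ^ 'm"
  where "perp T = mat 1 - T"

definition psd :: "complex ^ 'm ^ 'm \<Rightarrow> bool"
  where "psd B \<longleftrightarrow> B = ctransp B \<and> (\<forall>v. Im (cinner v (B *v v)) = 0 \<and> 0 \<le> Re (cinner v (B *v v)))"

definition singular_values :: "complex ^ 'm ^ 'm \<Rightarrow> real set"
  where "singular_values A =
    {s. 0 \<le> s \<and> (\<exists>v. v \<noteq> 0 \<and> (ctransp A ** A) *v v = complex_of_real (s\<^sup>2) *s v)}"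

definition mnorm :: "complex ^ 'm ^ 'm \<Rightarrow> real"
  where "mnorm A = Max (singular_values A)"


section \<open>Quantities determined by the two projections\<close>

definition W0 :: "complex ^ 'm ^ 'm \<Rightarrow> complex ^ 'm ^ 'm \<Rightarrow> complex \<Rightarrow> complex ^ 'm ^ 'm"
  where "W0 T1 T2 \<rho> =
    sin (\<rho> * of_real pi) *m (T2 ** T1 + perp T2 ** perp T1)
    + cos (\<rho> * of_real pi) *m (perp T2 ** T1 - T2 ** perp T1)"

definition U0 :: "complex ^ 'm ^ 'm \<Rightarrow> complex ^ 'm ^ 'm \<Rightarrow> complex \<Rightarrow> complex ^ 'm ^ 'm"
  where "U0 T1 T2 \<rho> =
    cos (\<rho> * of_real pi) *m (T2 ** T1 + perp T2 ** perp T1)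
    + sin (\<rho> * of_real pi) *m (T2 ** perp T1 - perp T2 ** T1)"

definition E0 :: "complex ^ 'm ^ 'm \<Rightarrow> complex ^ 'm ^ 'm \<Rightarrow> complex \<Rightarrow> complex ^ 'm ^ 'm"
  where "E0 T1 T2 \<rho> = matrix_inv (W0 T1 T2 \<rho>) ** U0 T1 T2 \<rho>"

text \<open>The zeros of \<open>det W\<^sup>0\<close> on the real interval \<open>[0,1)\<close>, each repeated according to its
  multiplicity; \<open>zero_r T1 T2 k\<close> is the \<open>k\<close>-th smallest, counting from \<open>k = 1\<close>. There are exactly
  \<open>m = CARD('m)\<close> of them, so \<open>zero_r\<close> is meaningful for \<open>k = 1, \<dots>, m\<close> (other \<open>k\<close> are not used).\<close>

definition zeros_mset :: "complex ^ 'm ^ 'm \<Rightarrow> complex ^ 'm ^ 'm \<Rightarrow> real multiset"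
  where "zeros_mset T1 T2 =
    (\<Sum>x \<in> {x. 0 \<le> x \<and> x < 1 \<and> det (W0 T1 T2 (of_real x)) = 0}.
       replicate_mset (nat (zorder (\<lambda>\<rho>. det (W0 T1 T2 \<rho>)) (of_real x))) x)"

definition zero_r :: "complex ^ 'm ^ 'm \<Rightarrow> complex ^ 'm ^ 'm \<Rightarrow> nat \<Rightarrow> real"
  where "zero_r T1 T2 k = sorted_list_of_multiset (zeros_mset T1 T2) ! (k - 1)"

definition resA :: "complex ^ 'm ^ 'm \<Rightarrow> complex ^ 'm ^ 'm \<Rightarrow> nat \<Rightarrow> complex ^ 'm ^ 'm"
  where "resA T1 T2 k =
    of_real pi *m (\<chi> i j. residue (\<lambda>\<rho>. E0 T1 T2 \<rho> $ i $ j) (of_real (zero_r T1 T2 k)))"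

definition p_perp :: "complex ^ 'm ^ 'm \<Rightarrow> complex ^ 'm ^ 'm \<Rightarrow> nat"
  where "p_perp T1 T2 = vec.dim ({v. T1 *v v = 0} \<inter> {v. T2 *v v = 0})"

definition J_set :: "complex ^ 'm ^ 'm \<Rightarrow> complex ^ 'm ^ 'm \<Rightarrow> (nat \<times> nat) set"
  where "J_set T1 T2 = {(n, k). 1 \<le> n \<and> 1 \<le> k \<and> k \<le> CARD('m)}
    \<union> {(0, k) | k. p_perp T1 T2 + 1 \<le> k \<and> k \<le> CARD('m)}"


section \<open>Groups of multiple values\<close>

text \<open>The maximal group of equal values containing \<open>\<rho>\<^sub>p\<close>; a simple value forms a group of size one.\<close>

definition val_group :: "'i set \<Rightarrow> ('i \<Rightarrow> complex) \<Rightarrow> 'i \<Rightarrow> 'i set"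
  where "val_group J \<rho> p = {q \<in> J. \<rho> q = \<rho> p}"

text \<open>The matrices \<open>B'\<close>: only the lexicographically first member of a group keeps its matrix. The
  order is spelled out because the ambient library orders pairs componentwise.\<close>

definition B_first :: "(nat \<times> nat) set \<Rightarrow> (nat \<times> nat \<Rightarrow> complex)
    \<Rightarrow> (nat \<times> nat \<Rightarrow> complex ^ 'm ^ 'm) \<Rightarrow> nat \<times> nat \<Rightarrow> complex ^ 'm ^ 'm"
  where "B_first J \<rho> B p =
    (if \<forall>q \<in> val_group J \<rho> p. (q, p) \<notin> less_than <*lex*> less_than then B p else 0)"

definition B_sum :: "complex ^ 'm ^ 'm \<Rightarrow> complex ^ 'm ^ 'm \<Rightarrow> (nat \<times> nat \<Rightarrow> complex)
    \<Rightarrow> (nat \<times> nat \<Rightarrow> complex ^ 'm ^ 'm) \<Rightarrow> nat \<Rightarrow> nat \<Rightarrow> complex ^ 'm ^ 'm"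
  where "B_sum T1 T2 \<rho> B n k =
    (\<Sum>s \<in> {s \<in> {1..CARD('m)}. (n, s) \<in> J_set T1 T2 \<and> zero_r T1 T2 s = zero_r T1 T2 k}.
       B_first (J_set T1 T2) \<rho> B (n, s))"

definition orthonormal_basis_fam :: "'i set \<Rightarrow> ('i \<Rightarrow> complex ^ 'm) \<Rightarrow> (complex ^ 'm) set \<Rightarrow> bool"
  where "orthonormal_basis_fam G e S \<longleftrightarrow>
    (\<forall>p \<in> G. \<forall>q \<in> G. cinner (e p) (e q) = (if p = q then 1 else 0)) \<and> vec.span (e ` G) = S"

definition Yfun :: "complex ^ 'm ^ 'm \<Rightarrow> complex \<Rightarrow> complex ^ 'm \<Rightarrow> real \<Rightarrow> complex ^ 'm"
  where "Yfun T1 \<rho> e x =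
    (if \<rho> \<noteq> 0
     then (cos (\<rho> * of_real x) *m T1 + sin (\<rho> * of_real x) *m perp T1) *v e
     else (T1 + of_real x *m perp T1) *v e)"


section \<open>The space of square integrable vector functions\<close>

text \<open>Elements are represented by functions; equality in the Hilbert space is equality almost
  everywhere on \<open>(0,\<pi>)\<close>.\<close>

abbreviation Ipi :: "real measure"
  where "Ipi \<equiv> lebesgue_on {0<..<pi}"

definition L2 :: "(real \<Rightarrow> complex ^ 'm) set"
  where "L2 = {f. f \<in> borel_measurable Ipi \<and> integrable Ipi (\<lambda>x. (norm (f x))\<^sup>2)}"

definition L2_eq :: "(real \<Rightarrow> complex ^ 'm) \<Rightarrow> (real \<Rightarrow> complex ^ 'm) \<Rightarrow> bool"
  where "L2_eq f g \<longleftrightarrow> (AE x in Ipi. f x = g x)"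

definition L2_inner :: "(real \<Rightarrow> complex ^ 'm) \<Rightarrow> (real \<Rightarrow> complex ^ 'm) \<Rightarrow> complex"
  where "L2_inner f g = (LINT x|Ipi. cinner (f x) (g x))"

definition L2_nrm :: "(real \<Rightarrow> complex ^ 'm) \<Rightarrow> real"
  where "L2_nrm f = sqrt (LINT x|Ipi. (norm (f x))\<^sup>2)"

text \<open>Completeness of a family: finite linear combinations are dense.\<close>

definition L2_complete :: "'i set \<Rightarrow> ('i \<Rightarrow> real \<Rightarrow> complex ^ 'm) \<Rightarrow> bool"
  where "L2_complete J Y \<longleftrightarrow> (\<forall>p \<in> J. Y p \<in> L2) \<and>
    (\<forall>f \<in> L2. \<forall>\<epsilon> > 0. \<exists>F c. finite F \<and> F \<subseteq> J \<and>
       L2_nrm (\<lambda>x. f x - (\<Sum>p \<in> F. c p *s Y p x)) < \<epsilon>)"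

definition L2_orthonormal_basis :: "'i set \<Rightarrow> ('i \<Rightarrow> real \<Rightarrow> complex ^ 'm) \<Rightarrow> bool"
  where "L2_orthonormal_basis J e \<longleftrightarrow>
    (\<forall>p \<in> J. \<forall>q \<in> J. L2_inner (e p) (e q) = (if p = q then 1 else 0)) \<and> L2_complete J e"

text \<open>Boundedness and linearity make such a map respect equality almost everywhere, so it is the
  same thing as a bounded linear operator on the Hilbert space.\<close>

definition L2_bounded_linear :: "((real \<Rightarrow> complex ^ 'm) \<Rightarrow> (real \<Rightarrow> complex ^ 'm)) \<Rightarrow> bool"
  where "L2_bounded_linear T \<longleftrightarrow>
    (\<forall>f \<in> L2. T f \<in> L2) \<and>
    (\<forall>f \<in> L2. \<forall>g \<in> L2. L2_eq (T (\<lambda>x. f x + g x)) (\<lambda>x. T f x + T g x)) \<and>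
    (\<forall>c. \<forall>f \<in> L2. L2_eq (T (\<lambda>x. c *s f x)) (\<lambda>x. c *s T f x)) \<and>
    (\<exists>C. \<forall>f \<in> L2. L2_nrm (T f) \<le> C * L2_nrm f)"

text \<open>A Riesz basis is the image of an orthonormal basis under a bounded linear operator with a
  bounded inverse.\<close>

definition L2_riesz_basis :: "'i set \<Rightarrow> ('i \<Rightarrow> real \<Rightarrow> complex ^ 'm) \<Rightarrow> bool"
  where "L2_riesz_basis J Y \<longleftrightarrow> (\<forall>p \<in> J. Y p \<in> L2) \<and>
    (\<exists>e T S. L2_orthonormal_basis J e \<and> L2_bounded_linear T \<and> L2_bounded_linear S \<and>
       (\<forall>f \<in> L2. L2_eq (S (T f)) f \<and> L2_eq (T (S f)) f) \<and>
       (\<forall>p \<in> J. L2_eq (T (e p)) (Y p)))"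

end

theory Submission
  imports Defs "HOL-Computational_Algebra.Fundamental_Theorem_Algebra" "HOL-Combinatorics.List_Permutation"
begin

text \<open>With \<open>z = exp (\<i>\<pi>\<rho>)\<close> one has \<open>W\<^sup>0(\<rho>) = L (z - z\<inverse>\<Omega>)\<close> and \<open>U\<^sup>0(\<rho>) = \<i> L (z + z\<inverse>\<Omega>)\<close> for an
  invertible matrix \<open>L\<close> and a unitary matrix \<open>\<Omega>\<close>. Hence the eigenvalues of \<open>\<Omega>\<close> are the numbers
  \<open>exp (2\<pi>\<i>r\<^sub>k)\<close>, and \<open>E\<^sup>0\<close> is the sum of \<open>cot (\<pi>(\<rho> - r\<^sub>k))\<close> times the spectral projections of \<open>\<Omega>\<close>, which
  are therefore the matrices \<open>A\<^sub>k\<close>. For eigenvectors \<open>W\<close> of \<open>\<Omega>\<close> the functions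
  \<open>(cos ((n + r\<^sub>k)x) T\<^sub>1 + sin ((n + r\<^sub>k)x) T\<^sub>1\<^sup>\<bottom>) W\<close> are orthogonal. The hypothesis on the matrices
  \<open>B\<close> makes the vectors \<open>\<E>\<^sub>n\<^sub>k\<close> of one block, for large \<open>n\<close>, square-summably close to an orthonormal
  family of such eigenvectors, so that \<open>\<Y>\<close> is quadratically close to an orthogonal system \<open>e\<close>. The
  operator that is the identity on the orthogonal complement of \<open>e\<close> and maps \<open>e\<close> to \<open>\<Y>\<close> is the
  identity plus a Hilbert-Schmidt operator, and its range is dense as \<open>\<Y>\<close> is complete; it is thus
  invertible. That \<open>e\<close> is complete need not be shown in advance: it follows by applying the
  inverse operator to \<open>\<Y>\<close>.\<close>

unbundle no fps_syntax

section \<open>Quadratically close systems in a real Hilbert space\<close>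

text \<open>Identity plus Hilbert-Schmidt with dense range is inverted by hand. The perturbation is
  split into a tail of norm at most 1/2, inverted through a fixed point, and a finite head. Dividing
  by the tail leaves the identity plus finite rank, where dense range becomes surjectivity in finite
  dimension, and surjectivity becomes injectivity by counting. All this runs over the real scalars;
  complex linearity is recovered at the end, because the operator commutes with multiplication by
  \<i> on a set with dense span. The main obstacle is that one block may split into several groups
  of equal values: only the sum of their matrices is controlled, and nothing is assumed about the
  angles between vectors of different groups. A second obstacle is the value 0, where the orthogonal
  mode is the constant \<open>T1 *v W\<close> and vanishes on the kernel of \<open>T1\<close>. The
  indices left out of \<open>J\<close> are as many as the dimension of the intersection of the two
  kernels, and the zero modes that remain are built from vectors fixed by both projections.
  Closeness is wanted only in the sense of a convergent sum, so finitely many indices may be paired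
  arbitrarily, and blocks are analysed for large \<open>n\<close> only.\<close>

lemma bessel_finite:
  fixes e :: "'i \<Rightarrow> 'h::real_inner"
  assumes on: "\<And>p q. p \<in> F \<Longrightarrow> q \<in> F \<Longrightarrow> e p \<bullet> e q = (if p = q then 1 else 0)" and "finite F"
  shows "(\<Sum>p\<in>F. (e p \<bullet> x)\<^sup>2) \<le> (norm x)\<^sup>2"
proof -
  let ?y = "\<Sum>p\<in>F. (e p \<bullet> x) *\<^sub>R e p"
  have 1: "?y \<bullet> x = (\<Sum>p\<in>F. (e p \<bullet> x)\<^sup>2)"
    by (simp add: inner_sum_left power2_eq_square)
  have "?y \<bullet> ?y = (\<Sum>p\<in>F. \<Sum>q\<in>F. (e p \<bullet> x) * ((e q \<bullet> x) * (e p \<bullet> e q)))"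
    by (simp add: inner_sum_left inner_sum_right sum_distrib_left inner_commute mult.left_commute mult.assoc)
  also have "\<dots> = (\<Sum>p\<in>F. \<Sum>q\<in>F. if q = p then (e p \<bullet> x)\<^sup>2 else 0)"
    by (intro sum.cong refl) (auto simp: on power2_eq_square)
  also have "\<dots> = (\<Sum>p\<in>F. (e p \<bullet> x)\<^sup>2)" using \<open>finite F\<close> by simp
  finally have 2: "?y \<bullet> ?y = (\<Sum>p\<in>F. (e p \<bullet> x)\<^sup>2)" .
  have "0 \<le> (x - ?y) \<bullet> (x - ?y)" by simp
  also have "\<dots> = x \<bullet> x - 2 * (?y \<bullet> x) + ?y \<bullet> ?y"
    by (simp add: inner_diff_left inner_diff_right inner_commute)
  finally show ?thesis using 1 2 by (simp add: power2_norm_eq_inner)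
qed

text \<open>Over finite index sets the Cauchy-Schwarz inequality and \<open>bessel_finite\<close>
  bound the sum of the norms uniformly; this gives absolute convergence and dominates the operator
  norm by the Hilbert-Schmidt norm.\<close>

lemma orthonormal_synthesis:
  fixes e :: "'i \<Rightarrow> 'h::real_inner" and D :: "'i \<Rightarrow> 'b::banach"
  assumes on: "\<And>p q. p \<in> J \<Longrightarrow> q \<in> J \<Longrightarrow> e p \<bullet> e q = (if p = q then 1 else 0)"
    and sm: "(\<lambda>p. (norm (D p))\<^sup>2) summable_on J"
  shows "(\<lambda>p. (e p \<bullet> x) *\<^sub>R D p) summable_on J"
    and "norm (\<Sum>\<^sub>\<infinity>p\<in>J. (e p \<bullet> x) *\<^sub>R D p) \<le> norm x * sqrt (\<Sum>\<^sub>\<infinity>p\<in>J. (norm (D p))\<^sup>2)"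
proof -
  let ?S = "\<Sum>\<^sub>\<infinity>p\<in>J. (norm (D p))\<^sup>2"
  have fin: "(\<Sum>p\<in>F. norm ((e p \<bullet> x) *\<^sub>R D p)) \<le> norm x * sqrt ?S" if F: "finite F" "F \<subseteq> J" for F
  proof -
    have "(\<Sum>p\<in>F. norm ((e p \<bullet> x) *\<^sub>R D p)) = (\<Sum>p\<in>F. \<bar>e p \<bullet> x\<bar> * \<bar>norm (D p)\<bar>)" by simp
    also have "\<dots> \<le> L2_set (\<lambda>p. e p \<bullet> x) F * L2_set (\<lambda>p. norm (D p)) F"
      by (rule L2_set_mult_ineq)
    also have "\<dots> \<le> norm x * sqrt ?S"
    proof (rule mult_mono)
      have "(\<Sum>p\<in>F. (e p \<bullet> x)\<^sup>2) \<le> (norm x)\<^sup>2"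
        by (intro bessel_finite on F(1)) (use F(2) in auto)
      then show "L2_set (\<lambda>p. e p \<bullet> x) F \<le> norm x"
        unfolding L2_set_def by (simp add: real_le_lsqrt)
      have "(\<Sum>p\<in>F. (norm (D p))\<^sup>2) \<le> ?S"
        by (rule finite_sum_le_infsum[OF sm]) (use F in auto)
      then show "L2_set (\<lambda>p. norm (D p)) F \<le> sqrt ?S"
        unfolding L2_set_def by simp
    qed (auto simp: L2_set_nonneg)
    finally show ?thesis .
  qed
  have abs: "(\<lambda>p. norm ((e p \<bullet> x) *\<^sub>R D p)) summable_on J"
    by (intro nonneg_bdd_above_summable_on bdd_aboveI2[where M = "norm x * sqrt ?S"] norm_ge_zero)
      (use fin in auto)
  then show "(\<lambda>p. (e p \<bullet> x) *\<^sub>R D p) summable_on J" by (rule abs_summable_summable)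
  have "norm (\<Sum>\<^sub>\<infinity>p\<in>J. (e p \<bullet> x) *\<^sub>R D p) \<le> (\<Sum>\<^sub>\<infinity>p\<in>J. norm ((e p \<bullet> x) *\<^sub>R D p))"
    by (rule norm_infsum_bound[OF abs])
  also have "\<dots> \<le> norm x * sqrt ?S"
    by (rule infsum_le_finite_sums[OF abs]) (use fin in auto)
  finally show "norm (\<Sum>\<^sub>\<infinity>p\<in>J. (e p \<bullet> x) *\<^sub>R D p) \<le> norm x * sqrt ?S" .
qed

lemma bounded_linear_orthonormal_synthesis:
  fixes e :: "'i \<Rightarrow> 'h::real_inner" and D :: "'i \<Rightarrow> 'b::banach"
  assumes on: "\<And>p q. p \<in> J \<Longrightarrow> q \<in> J \<Longrightarrow> e p \<bullet> e q = (if p = q then 1 else 0)"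
    and sm: "(\<lambda>p. (norm (D p))\<^sup>2) summable_on J"
  shows "bounded_linear (\<lambda>x. \<Sum>\<^sub>\<infinity>p\<in>J. (e p \<bullet> x) *\<^sub>R D p)"
proof (rule bounded_linear_intro)
  note s = orthonormal_synthesis(1)[OF on sm]
  show "(\<Sum>\<^sub>\<infinity>p\<in>J. (e p \<bullet> (x + y)) *\<^sub>R D p) =
      (\<Sum>\<^sub>\<infinity>p\<in>J. (e p \<bullet> x) *\<^sub>R D p) + (\<Sum>\<^sub>\<infinity>p\<in>J. (e p \<bullet> y) *\<^sub>R D p)" for x y
    by (simp add: inner_add_right scaleR_add_left infsum_add s)
  show "(\<Sum>\<^sub>\<infinity>p\<in>J. (e p \<bullet> (r *\<^sub>R x)) *\<^sub>R D p) = r *\<^sub>R (\<Sum>\<^sub>\<infinity>p\<in>J. (e p \<bullet> x) *\<^sub>R D p)" for r x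
    by (simp flip: scaleR_scaleR add: infsum_scaleR_right)
  show "norm (\<Sum>\<^sub>\<infinity>p\<in>J. (e p \<bullet> x) *\<^sub>R D p) \<le> norm x * sqrt (\<Sum>\<^sub>\<infinity>p\<in>J. (norm (D p))\<^sup>2)" for x
    by (rule orthonormal_synthesis(2)[OF on sm])
qed

text \<open>The equation \<open>x + K x = y\<close> is solved by the fixed point of the contraction
  \<open>x \<mapsto> y - K x\<close>; linearity and boundedness of the solution operator follow from
  uniqueness and from the fixed point equation.\<close>

lemma invertible_near_identity:
  fixes K :: "'h::banach \<Rightarrow> 'h"
  assumes K: "bounded_linear K" and c: "c < 1" and le: "\<And>x. norm (K x) \<le> c * norm x"
  shows "\<exists>S. bounded_linear S \<and> (\<forall>x. S (x + K x) = x) \<and> (\<forall>x. S x + K (S x) = x)"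
proof -
  interpret K: bounded_linear K by fact
  \<comment> \<open>The fixed point theorem asks for a nonnegative contraction constant, while
    \<open>c\<close> may be negative.\<close>
  define c' where "c' = max c 0"
  have c': "0 \<le> c'" "c' < 1" and le': "norm (K x) \<le> c' * norm x" for x
    using c order_trans[OF le mult_right_mono[of c c' "norm x"]] by (auto simp: c'_def)
  have ex: "\<exists>!x. y - K x = x" for y
    proof (rule banach_fix_type[OF c'], intro allI)
    fix u v show "dist (y - K u) (y - K v) \<le> c' * dist u v"
      using le'[of "v - u"] by (simp add: dist_norm K.diff norm_minus_commute)
  qed
  define S where "S y = (THE x. y - K x = x)" for y
  have S: "y - K (S y) = S y" for y
    unfolding S_def by (rule theI'[OF ex])
  have uniq: "y - K x = x \<Longrightarrow> S y = x" for x y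
    using ex[of y] S[of y] by auto
  have inv1: "S (x + K x) = x" for x by (rule uniq) simp
  have inv2: "S x + K (S x) = x" for x using S[of x] by (metis diff_add_cancel)
  have bl: "bounded_linear S"
  proof (rule bounded_linear_intro)
    show "S (x + y) = S x + S y" for x y
      by (rule uniq) (use S[of x] S[of y] in \<open>simp add: K.add algebra_simps\<close>)
    show "S (r *\<^sub>R x) = r *\<^sub>R S x" for r x
      by (rule uniq) (metis S K.scaleR scaleR_right_diff_distrib)
    show "norm (S x) \<le> norm x * (1 / (1 - c'))" for x
    proof -
      have "norm (S x) = norm (x - K (S x))" by (simp add: S)
      also have "\<dots> \<le> norm x + c' * norm (S x)"
        using norm_triangle_ineq4[of x "K (S x)"] le'[of "S x"] by linarith
      finally show ?thesis using c' by (simp add: field_simps)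
    qed
  qed
  show ?thesis by (intro exI[of _ S] conjI allI bl inv1 inv2)
qed

lemma bounded_linear_finite_synthesis:
  fixes e :: "'i \<Rightarrow> 'h::real_inner" and d :: "'i \<Rightarrow> 'b::real_normed_vector"
  shows "bounded_linear (\<lambda>x. \<Sum>p\<in>F. (e p \<bullet> x) *\<^sub>R d p)"
  by (rule bounded_linear_sum) (rule bounded_linear_scaleR_const[OF bounded_linear_inner_right])

text \<open>One Gram-Schmidt step: subtract from \<open>z\<close> its projection, computed in an
  orthogonal spanning set of \<open>span A\<close>.\<close>

lemma orthogonal_in_span_exists:
  fixes A :: "'h::real_inner set"
  assumes "finite A" "z \<notin> span A"
  shows "\<exists>w. w \<noteq> 0 \<and> w \<in> span (insert z A) \<and> (\<forall>a\<in>span A. w \<bullet> a = 0)"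
proof -
  obtain C where C: "finite C" "span C = span A" "pairwise orthogonal C"
    using basis_orthogonal[OF \<open>finite A\<close>] by auto
  define w where "w = z - (\<Sum>b\<in>C. (b \<bullet> z / (b \<bullet> b)) *\<^sub>R b)"
  have s: "(\<Sum>b\<in>C. (b \<bullet> z / (b \<bullet> b)) *\<^sub>R b) \<in> span A"
    unfolding C(2)[symmetric] by (intro span_sum span_scale span_base)
  have "w \<noteq> 0" using s assms(2) by (auto simp: w_def)
  moreover have "w \<in> span (insert z A)"
    unfolding w_def by (intro span_diff span_base insertI1 subsetD[OF span_mono s] subset_insertI)
  moreover have wc: "w \<bullet> c = 0" if "c \<in> C" for c
  proof -
    have "(\<Sum>b\<in>C. (b \<bullet> z / (b \<bullet> b)) *\<^sub>R b) \<bullet> c = (\<Sum>b\<in>C. if b = c then c \<bullet> z else 0)"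
      unfolding inner_sum_left
      by (intro sum.cong) (use C(3) that in \<open>auto simp: pairwise_def orthogonal_def\<close>)
    then show ?thesis using C(1) that by (simp add: w_def inner_diff_left inner_commute[of z])
  qed
  moreover have "w \<bullet> a = 0" if "a \<in> span A" for a
    using that unfolding C(2)[symmetric]
    by (induction rule: span_induct_alt) (auto simp: inner_right_distrib wc)
  ultimately show ?thesis by blast
qed

text \<open>The operator \<open>G\<close> is the identity up to finite rank, so that the question of invertibility
  reduces to its compression to the finite-dimensional space spanned by \<open>e ` F\<close>.\<close>

lemma invertible_finite_rank_perturbation:
  fixes e :: "'i \<Rightarrow> 'h::real_inner" and d :: "'i \<Rightarrow> 'h"
  assumes F: "finite F"
    and on: "\<And>p q. p \<in> F \<Longrightarrow> q \<in> F \<Longrightarrow> e p \<bullet> e q = (if p = q then 1 else 0)"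
    and G: "\<And>x. G x = x + (\<Sum>p\<in>F. (e p \<bullet> x) *\<^sub>R d p)"
    and dense: "closure (range G) = UNIV"
  shows "\<exists>S. bounded_linear S \<and> (\<forall>x. S (G x) = x) \<and> (\<forall>x. G (S x) = x)"
proof -
  have "G = (\<lambda>x. x + (\<Sum>p\<in>F. (e p \<bullet> x) *\<^sub>R d p))" by (rule ext) (rule G)
  then have blG: "bounded_linear G"
    by (simp only: bounded_linear_add bounded_linear_ident bounded_linear_finite_synthesis)
  interpret G: bounded_linear G by (rule blG)
  \<comment> \<open>The orthogonal projection onto the span of the finitely many \<open>e p\<close>.
    The correction term of \<open>G\<close> depends on \<open>P x\<close> alone.\<close>
  define P where "P = (\<lambda>x. \<Sum>p\<in>F. (e p \<bullet> x) *\<^sub>R e p)"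
  have blP: "bounded_linear P" unfolding P_def by (rule bounded_linear_finite_synthesis)
  interpret P: bounded_linear P by (rule blP)
  define V where "V = span (e ` F)"
  have PV: "P x \<in> V" for x unfolding P_def V_def by (intro span_sum span_scale span_base imageI)
  have eP: "e p \<bullet> P x = e p \<bullet> x" if "p \<in> F" for p x
  proof -
    have "e p \<bullet> P x = (\<Sum>q\<in>F. if p = q then e q \<bullet> x else 0)"
      unfolding P_def inner_sum_right by (intro sum.cong) (auto simp: on that)
    then show ?thesis using F that by simp
  qed
  have P0: "x \<in> V \<Longrightarrow> (\<And>p. p \<in> F \<Longrightarrow> e p \<bullet> x = 0) \<Longrightarrow> x = 0" for x
  proof -
    assume x: "x \<in> V" and z: "\<And>p. p \<in> F \<Longrightarrow> e p \<bullet> x = 0"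
    have "x \<bullet> y = 0" if "y \<in> V" for y
      using that unfolding V_def
      by (induction rule: span_induct_alt) (auto simp: inner_right_distrib inner_commute[of x] z)
    then show "x = 0" using x by fastforce
  qed
  have PP: "P x = x" if "x \<in> V" for x
  proof -
    have "P x - x = 0" by (rule P0) (auto simp: V_def span_diff PV[unfolded V_def] that[unfolded V_def] inner_diff_right eP)
    then show ?thesis by simp
  qed
  have Gfix: "G x = x" if "P x = 0" for x
  proof -
    have "e p \<bullet> x = 0" if "p \<in> F" for p using eP[OF that, of x] \<open>P x = 0\<close> by simp
    then show ?thesis by (simp add: G)
  qed
  have GP: "G x = G (P x) + (x - P x)" for x
  proof -
    have "G (x - P x) = x - P x" by (rule Gfix) (simp add: P.diff PP PV)
    then show ?thesis by (simp add: G.diff algebra_simps)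
  qed
  have PGP: "P (G x) = P (G (P x))" for x
    by (subst GP) (simp add: P.add P.diff PP PV)
  let ?A = "(\<lambda>p. P (G (e p))) ` F"
  have sub: "P (G x) \<in> span ?A" for x
  proof -
    have "P (G (P x)) = (\<Sum>p\<in>F. (e p \<bullet> x) *\<^sub>R P (G (e p)))"
      by (subst (2) P_def) (simp add: G.sum P.sum G.scaleR P.scaleR)
    then show ?thesis by (subst PGP) (simp only:, intro span_sum span_scale span_base imageI)
  qed
  \<comment> \<open>If the compression of \<open>G\<close> missed a vector of \<open>V\<close>, some
    nonzero \<open>w\<close> in \<open>V\<close> would be orthogonal to its image. Being in
    \<open>V\<close>, \<open>w\<close> cannot tell \<open>G x\<close> from \<open>P (G x)\<close>,
    so it would be orthogonal to the dense range of \<open>G\<close>.\<close>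
  have surj: "V \<subseteq> span ?A"
  proof
    fix z assume z: "z \<in> V"
    show "z \<in> span ?A"
    proof (rule ccontr)
      assume "z \<notin> span ?A"
      then obtain w where w: "w \<noteq> 0" "w \<in> span (insert z ?A)" "\<And>a. a \<in> span ?A \<Longrightarrow> w \<bullet> a = 0"
        using orthogonal_in_span_exists[of ?A z] F by auto
      have "insert z ?A \<subseteq> V" using z PV by auto
      then have wV: "w \<in> V" using w(2) unfolding V_def by (metis span_minimal subspace_span subsetD)
      have "w \<bullet> G x = 0" for x
      proof -
        have "w \<bullet> (G x - P (G x)) = 0"
        proof -
          have "y \<bullet> (G x - P (G x)) = 0" if "y \<in> V" for y
            using that unfolding V_def
            by (induction rule: span_induct_alt)
              (auto simp: inner_left_distrib inner_diff_right eP)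
          then show ?thesis using wV by blast
        qed
        moreover have "w \<bullet> P (G x) = 0" by (rule w(3)[OF sub])
        ultimately show ?thesis by (simp add: inner_diff_right)
      qed
      then have "range G \<subseteq> {x. w \<bullet> x = 0}" by auto
      then have "closure (range G) \<subseteq> {x. w \<bullet> x = 0}"
        by (rule closure_minimal) (rule closed_hyperplane)
      then have "w \<in> {x. w \<bullet> x = 0}" unfolding dense by blast
      then show False using w(1) by simp
    qed
  qed
  have "\<exists>v. v \<in> V \<and> P (G v) = y" if "y \<in> V" for y
  proof -
    have "y \<in> span ?A" using surj that by auto
    then show ?thesis
    proof (induction rule: span_induct_alt)
      case base
      show ?case by (intro exI[of _ 0]) (simp add: V_def span_zero G.zero P.zero)
    next
      case (step c x y)
      then obtain v p where v: "v \<in> V" "P (G v) = y" "p \<in> F" "x = P (G (e p))" by auto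
      show ?case
        by (rule exI[of _ "c *\<^sub>R e p + v"])
          (use v in \<open>auto simp: V_def G.add P.add G.scaleR P.scaleR intro: span_add span_scale span_base\<close>)
    qed
  qed
  then have "\<forall>p\<in>F. \<exists>v. v \<in> V \<and> P (G v) = e p" unfolding V_def by (simp add: span_base)
  then obtain v where v: "\<And>p. p \<in> F \<Longrightarrow> v p \<in> V" "\<And>p. p \<in> F \<Longrightarrow> P (G (v p)) = e p"
    by metis
  define L where "L = (\<lambda>y. \<Sum>p\<in>F. (e p \<bullet> y) *\<^sub>R v p)"
  have blL: "bounded_linear L" unfolding L_def by (rule bounded_linear_finite_synthesis)
  interpret L: bounded_linear L by (rule blL)
  have PGL: "P (G (L y)) = P y" for y
    unfolding L_def by (simp add: G.sum P.sum G.scaleR P.scaleR v) (simp add: P_def)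
  \<comment> \<open>\<open>L\<close> solves the equation after projection by \<open>P\<close>; the
    remainder \<open>y - G (L y)\<close> has zero projection and is therefore fixed by
    \<open>G\<close>.\<close>
  define S where "S = (\<lambda>y. L y + (y - G (L y)))"
  have blS: "bounded_linear S" unfolding S_def
    by (intro bounded_linear_add bounded_linear_sub bounded_linear_ident bounded_linear_compose[OF blG blL] blL)
  have GS: "G (S y) = y" for y
  proof -
    have "G (y - G (L y)) = y - G (L y)" by (rule Gfix) (simp add: P.diff PGL)
    then show ?thesis by (simp add: S_def G.add)
  qed
  have inj: "inj_on v F"
  proof (rule inj_onI)
    fix p q assume pq: "p \<in> F" "q \<in> F" "v p = v q"
    then have "e p = e q" using v(2)[of p] v(2)[of q] by simp
    then show "p = q" using on[of p q] on[of p p] pq(1,2) by (simp split: if_splits)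
  qed
  \<comment> \<open>Counting turns surjectivity into injectivity: the independent vectors
    \<open>v p\<close> lie in \<open>V\<close> and are as many as the vectors \<open>e p\<close>
    that span it, so they span \<open>V\<close> too.\<close>
  have vspan: "V \<subseteq> span (v ` F)"
  proof
    fix x assume x: "x \<in> V"
    have ind: "independent (v ` F)"
      unfolding independent_explicit_module
    proof (intro allI impI)
      fix T u w assume T: "finite T" "T \<subseteq> v ` F" "(\<Sum>w\<in>T. u w *\<^sub>R w) = 0" "w \<in> T"
      obtain I where I: "I \<subseteq> F" "T = v ` I" using T(2) by (elim subset_imageE)
      have "0 = P (G (\<Sum>w\<in>T. u w *\<^sub>R w))" using T(3) by (simp add: G.zero P.zero)
      also have "\<dots> = (\<Sum>p\<in>I. u (v p) *\<^sub>R P (G (v p)))"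
        unfolding I(2) sum.reindex[OF inj_on_subset[OF inj I(1)]]
        by (simp add: G.sum P.sum G.scaleR P.scaleR)
      also have "\<dots> = (\<Sum>p\<in>I. u (v p) *\<^sub>R e p)" by (intro sum.cong) (use I v in auto)
      finally have z: "(\<Sum>p\<in>I. u (v p) *\<^sub>R e p) = 0" by simp
      obtain q where q: "q \<in> I" "w = v q" using T(4) I by auto
      have fI: "finite I" using I F finite_subset by blast
      have "0 = e q \<bullet> (\<Sum>p\<in>I. u (v p) *\<^sub>R e p)" using z by simp
      also have "\<dots> = (\<Sum>p\<in>I. if p = q then u (v p) else 0)"
        unfolding inner_sum_right
      proof (intro sum.cong refl)
        fix p assume "p \<in> I"
        then have "e q \<bullet> e p = (if q = p then 1 else 0)" using I(1) q(1) by (intro on) auto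
        then show "e q \<bullet> u (v p) *\<^sub>R e p = (if p = q then u (v p) else 0)" by simp
      qed
      also have "\<dots> = u w" using q fI by simp
      finally show "u w = 0" by simp
    qed
    show "x \<in> span (v ` F)"
    proof (rule ccontr)
      assume nx: "x \<notin> span (v ` F)"
      then have "independent (insert x (v ` F))" using ind by (simp add: independent_insert)
      moreover have "insert x (v ` F) \<subseteq> span (e ` F)" using x v(1) unfolding V_def by auto
      ultimately have "card (insert x (v ` F)) \<le> card (e ` F)"
        using independent_span_bound[of "e ` F" "insert x (v ` F)"] F by auto
      moreover have "x \<notin> v ` F" using nx span_base[of x "v ` F"] by blast
      moreover have "card (v ` F) = card F" using inj by (rule card_image)
      moreover have "card (insert x (v ` F)) = Suc (card (v ` F))"
        using F calculation(2) by (intro card_insert_disjoint) auto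
      ultimately show False using card_image_le[OF F, of e] by linarith
    qed
  qed
  have inj0: "x = 0" if x: "G x = 0" for x
  proof -
    have "P x \<in> span (v ` F)" using PV vspan by auto
    then obtain u where u: "P x = (\<Sum>p\<in>v ` F. u p *\<^sub>R p)"
      using F by (auto simp: span_finite)
    have ux: "P x = (\<Sum>p\<in>F. u (v p) *\<^sub>R v p)" unfolding u using inj by (simp add: sum.reindex)
    have "0 = P (G (P x))" unfolding PGP[of x, symmetric] x by (simp add: P.zero)
    also have "\<dots> = (\<Sum>p\<in>F. u (v p) *\<^sub>R e p)"
      unfolding ux by (simp add: G.sum P.sum G.scaleR P.scaleR v)
    finally have z: "(\<Sum>p\<in>F. u (v p) *\<^sub>R e p) = 0" by simp
    have "u (v q) = 0" if q: "q \<in> F" for q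
    proof -
      have "0 = e q \<bullet> (\<Sum>p\<in>F. u (v p) *\<^sub>R e p)" using z by simp
      also have "\<dots> = (\<Sum>p\<in>F. if p = q then u (v p) else 0)"
        unfolding inner_sum_right by (intro sum.cong) (use q in \<open>auto simp: on\<close>)
      also have "\<dots> = u (v q)" using q F by simp
      finally show ?thesis by simp
    qed
    then have "P x = 0" unfolding ux by simp
    then show ?thesis using Gfix[of x] x by simp
  qed
  have SG: "S (G x) = x" for x
  proof -
    have "G (S (G x) - x) = 0" by (simp add: G.diff GS)
    then have "S (G x) - x = 0" by (rule inj0)
    then show ?thesis by simp
  qed
  show ?thesis by (intro exI[of _ S] conjI allI blS SG GS)
qed

text \<open>Outside a finite set \<open>F\<close> the squared defects sum to at most 1/4, so the
  tail operator \<open>K\<close> has norm at most 1/2; the defects in \<open>F\<close> contribute a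
  finite-rank term.\<close>

theorem quadratically_close_complete_imp_image:
  fixes e Y :: "'i \<Rightarrow> 'h::{real_inner, banach}"
  assumes on: "\<And>p q. p \<in> J \<Longrightarrow> q \<in> J \<Longrightarrow> e p \<bullet> e q = (if p = q then 1 else 0)"
    and sm: "(\<lambda>p. (norm (Y p - e p))\<^sup>2) summable_on J"
    and dense: "closure (span (Y ` J)) = UNIV"
  shows "\<exists>T S. bounded_linear T \<and> bounded_linear S \<and> (\<forall>x. S (T x) = x) \<and> (\<forall>x. T (S x) = x) \<and>
    (\<forall>p\<in>J. T (e p) = Y p)"
proof -
  define D where "D p = Y p - e p" for p
  note sm = sm[folded D_def]
  obtain F where F: "finite F" "F \<subseteq> J" and
    F': "dist (\<Sum>p\<in>F. (norm (D p))\<^sup>2) (\<Sum>\<^sub>\<infinity>p\<in>J. (norm (D p))\<^sup>2) \<le> 1/4"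
    using infsum_finite_approximation[OF sm, of "1/4"] by auto
  let ?J = "J - F"
  have smF: "(\<lambda>p. (norm (D p))\<^sup>2) summable_on ?J"
    by (rule summable_on_subset_banach[OF sm]) auto
  have "(\<Sum>\<^sub>\<infinity>p\<in>?J. (norm (D p))\<^sup>2) = (\<Sum>\<^sub>\<infinity>p\<in>J. (norm (D p))\<^sup>2) - (\<Sum>p\<in>F. (norm (D p))\<^sup>2)"
    by (subst infsum_Diff[OF sm]) (use F in auto)
  also have "\<dots> \<le> 1/4" using F' unfolding dist_real_def by linarith
  finally have small: "sqrt (\<Sum>\<^sub>\<infinity>p\<in>?J. (norm (D p))\<^sup>2) \<le> 1/2"
    by (intro real_le_lsqrt) (auto simp: power2_eq_square)
  have onF: "e p \<bullet> e q = (if p = q then 1 else 0)" if "p \<in> ?J" "q \<in> ?J" for p q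
    using that by (intro on) auto
  define K where "K = (\<lambda>x. \<Sum>\<^sub>\<infinity>p\<in>?J. (e p \<bullet> x) *\<^sub>R D p)"
  have blK: "bounded_linear K" unfolding K_def
    by (rule bounded_linear_orthonormal_synthesis[OF onF smF])
  have Kle: "norm (K x) \<le> 1/2 * norm x" for x
  proof -
    have "norm (K x) \<le> norm x * sqrt (\<Sum>\<^sub>\<infinity>p\<in>?J. (norm (D p))\<^sup>2)"
      unfolding K_def by (rule orthonormal_synthesis(2)[OF onF smF])
    also have "\<dots> \<le> norm x * (1/2)" by (intro mult_left_mono small) simp
    finally show ?thesis by simp
  qed
  obtain S1 where S1: "bounded_linear S1" "\<And>x. S1 (x + K x) = x" "\<And>x. S1 x + K (S1 x) = x"
    using invertible_near_identity[OF blK _ Kle] by auto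
  interpret S1: bounded_linear S1 by (rule S1(1))
  define T1 where "T1 = (\<lambda>x. x + K x)"
  have blT1: "bounded_linear T1" unfolding T1_def by (intro bounded_linear_add bounded_linear_ident blK)
  define T where "T = (\<lambda>x. T1 x + (\<Sum>p\<in>F. (e p \<bullet> x) *\<^sub>R D p))"
  have blT: "bounded_linear T" unfolding T_def
    by (intro bounded_linear_add blT1 bounded_linear_finite_synthesis)
  interpret T: bounded_linear T by (rule blT)
  have TE: "T (e p) = Y p" if p: "p \<in> J" for p
  proof -
    have "K (e p) = (\<Sum>\<^sub>\<infinity>q\<in>?J. if q = p then D q else 0)"
      unfolding K_def by (intro infsum_cong) (use p in \<open>auto simp: on\<close>)
    also have "\<dots> = (\<Sum>\<^sub>\<infinity>q\<in>?J \<inter> {p}. D q)"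
      by (rule infsum_cong_neutral) auto
    also have "\<dots> = (if p \<in> F then 0 else D p)" using p by (auto simp: Int_insert_right)
    finally have 1: "K (e p) = (if p \<in> F then 0 else D p)" .
    have "(\<Sum>q\<in>F. (e q \<bullet> e p) *\<^sub>R D q) = (\<Sum>q\<in>F. if q = p then D q else 0)"
      by (intro sum.cong refl) (use p F in \<open>auto simp: on subset_iff\<close>)
    also have "\<dots> = (if p \<in> F then D p else 0)" using F(1) by simp
    finally show ?thesis using 1 by (simp add: T_def T1_def D_def)
  qed
  \<comment> \<open>Composition with the inverse of the tail operator turns \<open>T\<close> into
    the identity plus finite rank. The range stays dense because \<open>S1\<close> is continuous and
    onto.\<close>
  define G where "G = (\<lambda>x. S1 (T x))"
  have Geq: "G x = x + (\<Sum>p\<in>F. (e p \<bullet> x) *\<^sub>R S1 (D p))" for x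
    unfolding G_def T_def T1_def by (simp add: S1.add[of "x + K x"] S1(2) S1.sum S1.scaleR)
  have rT: "closure (range T) = UNIV"
  proof -
    have "Y ` J \<subseteq> range T" using TE by (metis image_subsetI rangeI)
    moreover have "subspace (range T)"
      by (rule linear_subspace_image) (auto simp: T.linear_axioms)
    ultimately have "span (Y ` J) \<subseteq> range T" by (rule span_minimal)
    then show ?thesis using dense closure_mono by blast
  qed
  have "closure (range G) = UNIV"
  proof -
    have "S1 ` closure (range T) \<subseteq> closure (S1 ` range T)"
      by (rule image_closure_subset[OF _ closed_closure closure_subset])
        (intro linear_continuous_on S1(1))
    moreover have "S1 ` range T = range G" by (auto simp: G_def)
    moreover have "y \<in> range S1" for y using S1(2)[of y] by (metis rangeI)
    ultimately show ?thesis using rT by auto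
  qed
  moreover have onF': "e p \<bullet> e q = (if p = q then 1 else 0)" if "p \<in> F" "q \<in> F" for p q
    using that F by (intro on) auto
  ultimately obtain S2 where S2: "bounded_linear S2" "\<And>x. S2 (G x) = x" "\<And>x. G (S2 x) = x"
    using invertible_finite_rank_perturbation[OF F(1) onF' Geq] by auto
  define S where "S = (\<lambda>x. S2 (S1 x))"
  have blS: "bounded_linear S" unfolding S_def by (rule bounded_linear_compose[OF S2(1) S1(1)])
  have ST: "S (T x) = x" for x using S2(2)[of x] by (simp add: S_def G_def)
  have TS: "T (S x) = x" for x
  proof -
    have "S1 (T (S x)) = S1 x" using S2(3)[of "S1 x"] by (simp add: S_def G_def)
    then show ?thesis using S1(3) by metis
  qed
  show ?thesis by (intro exI[of _ T] exI[of _ S] conjI allI ballI blT blS ST TS TE)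
qed

section \<open>The Hilbert space of square integrable vector functions\<close>

lemma L2_I: "f \<in> borel_measurable Ipi \<Longrightarrow> integrable Ipi (\<lambda>x. (norm (f x))\<^sup>2) \<Longrightarrow> f \<in> L2"
  by (simp add: L2_def)

lemma L2_measurable: "f \<in> L2 \<Longrightarrow> f \<in> borel_measurable Ipi"
  and L2_integrable: "f \<in> L2 \<Longrightarrow> integrable Ipi (\<lambda>x. (norm (f x))\<^sup>2)"
  by (auto simp: L2_def)

lemma L2_zero: "(\<lambda>x. 0) \<in> L2"
  by (simp add: L2_def)

lemma L2_add:
  assumes "f \<in> L2" "g \<in> L2" shows "(\<lambda>x. f x + g x) \<in> L2"
proof (rule L2_I)
  note [measurable] = assms[THEN L2_measurable]
  show "(\<lambda>x. f x + g x) \<in> borel_measurable Ipi" by measurable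
  show "integrable Ipi (\<lambda>x. (norm (f x + g x))\<^sup>2)"
  proof (rule Bochner_Integration.integrable_bound)
    show "integrable Ipi (\<lambda>x. 2 * (norm (f x))\<^sup>2 + 2 * (norm (g x))\<^sup>2)"
      using assms[THEN L2_integrable] by auto
    have "(norm (a + b))\<^sup>2 \<le> 2 * (norm a)\<^sup>2 + 2 * (norm b)\<^sup>2" for a b :: "complex^'a"
    proof -
      have "(norm (a + b))\<^sup>2 \<le> (norm a + norm b)\<^sup>2" by (intro power_mono norm_triangle_ineq) simp
      also have "\<dots> \<le> 2 * (norm a)\<^sup>2 + 2 * (norm b)\<^sup>2"
        using zero_le_power2[of "norm a - norm b"] by (simp add: power2_eq_square algebra_simps)
      finally show ?thesis .
    qed
    then show "AE x in Ipi. norm ((norm (f x + g x))\<^sup>2) \<le> norm (2 * (norm (f x))\<^sup>2 + 2 * (norm (g x))\<^sup>2)"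
      by simp
  qed measurable
qed

lemma norm_vector_scalar_mult: "norm (c *s v) = cmod c * norm v" for v :: "complex^'n"
  by (simp add: norm_vec_def norm_mult L2_set_right_distrib)

lemma L2_cscale:
  assumes "f \<in> L2" shows "(\<lambda>x. c *s f x) \<in> L2"
proof (rule L2_I)
  note [measurable] = assms[THEN L2_measurable]
  have "continuous_on UNIV (\<lambda>v::complex^'a. c *s v)"
    unfolding vector_scalar_mult_def by (intro continuous_intros)
  then have [measurable]: "(\<lambda>v::complex^'a. c *s v) \<in> borel_measurable borel"
    by (rule borel_measurable_continuous_onI)
  show "(\<lambda>x. c *s f x) \<in> borel_measurable Ipi" by measurable
  show "integrable Ipi (\<lambda>x. (norm (c *s f x))\<^sup>2)"
    using L2_integrable[OF assms] by (simp add: norm_vector_scalar_mult power_mult_distrib)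
qed

lemma of_real_vector_scalar_mult: "complex_of_real r *s v = r *\<^sub>R v"
  by (simp add: vec_eq_iff scaleR_conv_of_real[where 'a = complex])

lemma L2_scaleR: "f \<in> L2 \<Longrightarrow> (\<lambda>x. r *\<^sub>R f x) \<in> L2"
  using L2_cscale[of f "of_real r"] by (simp add: of_real_vector_scalar_mult)

lemma L2_uminus: "f \<in> L2 \<Longrightarrow> (\<lambda>x. - f x) \<in> L2"
  using L2_scaleR[of f "-1"] by simp

lemma L2_diff: "f \<in> L2 \<Longrightarrow> g \<in> L2 \<Longrightarrow> (\<lambda>x. f x - g x) \<in> L2"
  using L2_add[OF _ L2_uminus, of f g] by simp

lemma L2_sum: "(\<And>p. p \<in> F \<Longrightarrow> f p \<in> L2) \<Longrightarrow> (\<lambda>x. \<Sum>p\<in>F. f p x) \<in> L2"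
  by (induction F rule: infinite_finite_induct) (auto intro: L2_zero L2_add)

lemma L2_continuous:
  assumes "continuous_on UNIV f" shows "f \<in> L2"
proof (rule L2_I)
  show "f \<in> borel_measurable Ipi"
    by (intro measurable_restrict_space1 measurable_completion)
      (use assms in \<open>simp add: borel_measurable_continuous_onI\<close>)
  have "(\<lambda>x. (norm (f x))\<^sup>2) absolutely_integrable_on {0..pi}"
    by (intro absolutely_integrable_continuous_real continuous_intros continuous_on_subset[OF assms]) simp
  then have "(\<lambda>x. (norm (f x))\<^sup>2) absolutely_integrable_on {0<..<pi}"
    by (rule set_integrable_subset) auto
  then show "integrable Ipi (\<lambda>x. (norm (f x))\<^sup>2)"
    by (rule absolutely_integrable_imp_integrable) auto
qed

lemma inner_eq_Re_cinner: "u \<bullet> v = Re (cinner u v)"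
  by (simp add: inner_vec_def cinner_def inner_complex_def)

lemma L2_integrable_inner:
  assumes "f \<in> L2" "g \<in> L2" shows "integrable Ipi (\<lambda>x. f x \<bullet> g x)"
proof (rule Bochner_Integration.integrable_bound)
  note [measurable] = assms[THEN L2_measurable]
  show "integrable Ipi (\<lambda>x. (norm (f x))\<^sup>2 + (norm (g x))\<^sup>2)"
    using assms[THEN L2_integrable] by auto
  show "(\<lambda>x. f x \<bullet> g x) \<in> borel_measurable Ipi" by measurable
  have "\<bar>a \<bullet> b\<bar> \<le> (norm a)\<^sup>2 + (norm b)\<^sup>2" for a b :: "complex^'a"
  proof -
    have "\<bar>a \<bullet> b\<bar> \<le> norm a * norm b" by (rule Cauchy_Schwarz_ineq2)
    also have "2 * \<dots> \<le> (norm a)\<^sup>2 + (norm b)\<^sup>2"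
      using zero_le_power2[of "norm a - norm b"] by (simp add: power2_eq_square algebra_simps)
    finally show ?thesis by (smt (verit) zero_le_power2)
  qed
  then show "AE x in Ipi. norm (f x \<bullet> g x) \<le> norm ((norm (f x))\<^sup>2 + (norm (g x))\<^sup>2)"
    by simp
qed

section \<open>The quotient by equality almost everywhere\<close>

definition L2_rel :: "(real \<Rightarrow> complex ^ 'm) \<Rightarrow> (real \<Rightarrow> complex ^ 'm) \<Rightarrow> bool"
  where "L2_rel f g \<longleftrightarrow> f \<in> L2 \<and> g \<in> L2 \<and> L2_eq f g"

\<comment> \<open>A function outside \<open>L2\<close> is not related even to itself, so the partial
  quotient consists exactly of the classes of square integrable functions.\<close>
quotient_type 'm hilbert_L2 = "real \<Rightarrow> complex ^ 'm" / partial: L2_rel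
proof (rule part_equivpI)
  show "\<exists>f. L2_rel f f" by (intro exI[of _ "\<lambda>x. 0"]) (simp add: L2_rel_def L2_eq_def L2_zero)
  show "symp L2_rel" by (auto simp: symp_def L2_rel_def L2_eq_def)
  show "transp L2_rel" by (auto simp: transp_def L2_rel_def L2_eq_def elim: AE_mp)
qed

lemma L2_rel_integral_inner:
  assumes "L2_rel f f'" "L2_rel g g'"
  shows "(LINT x|Ipi. f x \<bullet> g x) = (LINT x|Ipi. f' x \<bullet> g' x)"
proof -
  have [measurable]: "f \<in> borel_measurable Ipi" "f' \<in> borel_measurable Ipi"
    "g \<in> borel_measurable Ipi" "g' \<in> borel_measurable Ipi"
    using assms by (auto simp: L2_rel_def L2_measurable)
  have "AE x in Ipi. f x = f' x" "AE x in Ipi. g x = g' x"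
    using assms by (auto simp: L2_rel_def L2_eq_def)
  then show ?thesis by (intro integral_cong_AE) auto
qed

instantiation hilbert_L2 :: (finite) real_inner
begin

lift_definition zero_hilbert_L2 :: "'a hilbert_L2" is "\<lambda>x. 0"
  by (simp add: L2_rel_def L2_eq_def L2_zero)

lift_definition plus_hilbert_L2 :: "'a hilbert_L2 \<Rightarrow> 'a hilbert_L2 \<Rightarrow> 'a hilbert_L2"
  is "\<lambda>f g x. f x + g x"
  by (auto simp: L2_rel_def L2_eq_def L2_add)

lift_definition uminus_hilbert_L2 :: "'a hilbert_L2 \<Rightarrow> 'a hilbert_L2"
  is "\<lambda>f x. - f x"
  by (auto simp: L2_rel_def L2_eq_def L2_uminus)

lift_definition minus_hilbert_L2 :: "'a hilbert_L2 \<Rightarrow> 'a hilbert_L2 \<Rightarrow> 'a hilbert_L2"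
  is "\<lambda>f g x. f x - g x"
  by (auto simp: L2_rel_def L2_eq_def L2_diff)

lift_definition scaleR_hilbert_L2 :: "real \<Rightarrow> 'a hilbert_L2 \<Rightarrow> 'a hilbert_L2"
  is "\<lambda>r f x. r *\<^sub>R f x"
  by (auto simp: L2_rel_def L2_eq_def L2_scaleR)

lift_definition inner_hilbert_L2 :: "'a hilbert_L2 \<Rightarrow> 'a hilbert_L2 \<Rightarrow> real"
  is "\<lambda>f g. LINT x|Ipi. f x \<bullet> g x"
  by (rule L2_rel_integral_inner)

definition "norm_hilbert_L2 (f :: 'a hilbert_L2) = sqrt (f \<bullet> f)"
definition "dist_hilbert_L2 (f :: 'a hilbert_L2) g = norm (f - g)"
definition "sgn_hilbert_L2 (f :: 'a hilbert_L2) = inverse (norm f) *\<^sub>R f"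
definition [code del]: "(uniformity :: ('a hilbert_L2 \<times> 'a hilbert_L2) filter) =
  (INF e\<in>{0 <..}. principal {(x, y). dist x y < e})"
definition [code del]: "open (U :: 'a hilbert_L2 set) \<longleftrightarrow>
  (\<forall>x\<in>U. eventually (\<lambda>(x', y). x' = x \<longrightarrow> y \<in> U) uniformity)"

instance
proof
  fix a b c :: "'a hilbert_L2" and r s :: real and U :: "'a hilbert_L2 set"
  show "a + b + c = a + (b + c)" by transfer (auto simp: L2_rel_def L2_eq_def add.assoc intro!: L2_add)
  show "a + b = b + a" by transfer (auto simp: L2_rel_def L2_eq_def add.commute intro!: L2_add)
  show "0 + a = a" by transfer (auto simp: L2_rel_def L2_eq_def intro!: L2_add)
  show "- a + a = 0" by transfer (auto simp: L2_rel_def L2_eq_def L2_zero intro!: L2_add)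
  show "a - b = a + - b" by transfer (auto simp: L2_rel_def L2_eq_def intro!: L2_add L2_uminus L2_diff)
  show "r *\<^sub>R (a + b) = r *\<^sub>R a + r *\<^sub>R b"
    by transfer (auto simp: L2_rel_def L2_eq_def scaleR_add_right intro!: L2_add L2_scaleR)
  show "(r + s) *\<^sub>R a = r *\<^sub>R a + s *\<^sub>R a"
    by transfer (auto simp: L2_rel_def L2_eq_def scaleR_add_left intro!: L2_add L2_scaleR)
  show "r *\<^sub>R s *\<^sub>R a = (r * s) *\<^sub>R a"
    by transfer (auto simp: L2_rel_def L2_eq_def intro!: L2_scaleR)
  show "1 *\<^sub>R a = a" by transfer (auto simp: L2_rel_def L2_eq_def)
  show "dist a b = norm (a - b)" by (rule dist_hilbert_L2_def)
  show "sgn a = inverse (norm a) *\<^sub>R a" by (rule sgn_hilbert_L2_def)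
  show "(uniformity :: ('a hilbert_L2 \<times> 'a hilbert_L2) filter) =
    (INF e\<in>{0 <..}. principal {(x, y). dist x y < e})"
    by (rule uniformity_hilbert_L2_def)
  show "open U \<longleftrightarrow> (\<forall>x\<in>U. eventually (\<lambda>(x', y). x' = x \<longrightarrow> y \<in> U) uniformity)"
    by (rule open_hilbert_L2_def)
  show "a \<bullet> b = b \<bullet> a" by transfer (simp add: inner_commute)
  show "(a + b) \<bullet> c = a \<bullet> c + b \<bullet> c"
    by transfer (simp add: L2_rel_def inner_add_left L2_integrable_inner)
  show "(r *\<^sub>R a) \<bullet> b = r * (a \<bullet> b)" by transfer simp
  show "0 \<le> a \<bullet> a" by transfer simp
  show "a \<bullet> a = 0 \<longleftrightarrow> a = 0"
  proof transfer
    fix f :: "real \<Rightarrow> complex^'a" assume f: "L2_rel f f"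
    then have i: "integrable Ipi (\<lambda>x. f x \<bullet> f x)" by (simp add: L2_rel_def L2_integrable_inner)
    show "(LINT x|Ipi. f x \<bullet> f x) = 0 \<longleftrightarrow> L2_rel f (\<lambda>x. 0)"
      using integral_nonneg_eq_0_iff_AE[OF i] f by (simp add: L2_rel_def L2_zero L2_eq_def)
  qed
  show "norm a = sqrt (a \<bullet> a)" by (rule norm_hilbert_L2_def)
qed

end

text \<open>The type is an inner product space over the reals; complex scalars act through this
  separate operation.\<close>

lift_definition cscale :: "complex \<Rightarrow> 'm::finite hilbert_L2 \<Rightarrow> 'm hilbert_L2"
  is "\<lambda>c f x. c *s f x"
  by (auto simp: L2_rel_def L2_eq_def L2_cscale)

abbreviation "cls \<equiv> abs_hilbert_L2"
abbreviation "repr \<equiv> rep_hilbert_L2"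

lemma cls_eq_iff: "f \<in> L2 \<Longrightarrow> g \<in> L2 \<Longrightarrow> cls f = cls g \<longleftrightarrow> L2_eq f g"
  using Quotient3_rel[OF Quotient3_hilbert_L2, of f g] by (auto simp: L2_rel_def L2_eq_def)

lemma repr_L2: "repr h \<in> L2"
  using Quotient3_rep_reflp[OF Quotient3_hilbert_L2, of h] by (simp add: L2_rel_def)

lemma cls_repr [simp]: "cls (repr h) = h"
  by (rule Quotient3_abs_rep[OF Quotient3_hilbert_L2])

lemma L2_rel_refl: "f \<in> L2 \<Longrightarrow> L2_rel f f"
  by (simp add: L2_rel_def L2_eq_def)

lemma cls_add: "f \<in> L2 \<Longrightarrow> g \<in> L2 \<Longrightarrow> cls (\<lambda>x. f x + g x) = cls f + cls g"
  by (simp add: plus_hilbert_L2.abs_eq L2_rel_refl)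

lemma cls_diff: "f \<in> L2 \<Longrightarrow> g \<in> L2 \<Longrightarrow> cls (\<lambda>x. f x - g x) = cls f - cls g"
  by (simp add: minus_hilbert_L2.abs_eq L2_rel_refl)

lemma cls_scaleR: "f \<in> L2 \<Longrightarrow> cls (\<lambda>x. r *\<^sub>R f x) = r *\<^sub>R cls f"
  by (simp add: scaleR_hilbert_L2.abs_eq L2_rel_refl)

lemma cls_cscale: "f \<in> L2 \<Longrightarrow> cls (\<lambda>x. c *s f x) = cscale c (cls f)"
  by (simp add: cscale.abs_eq L2_rel_refl)

lemma cls_zero: "cls (\<lambda>x. 0) = 0"
  by (simp add: zero_hilbert_L2_def)

lemma cls_sum: "(\<And>p. p \<in> F \<Longrightarrow> f p \<in> L2) \<Longrightarrow> cls (\<lambda>x. \<Sum>p\<in>F. f p x) = (\<Sum>p\<in>F. cls (f p))"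
  by (induction F rule: infinite_finite_induct) (auto simp: cls_zero cls_add L2_sum)

lemma cls_inner: "f \<in> L2 \<Longrightarrow> g \<in> L2 \<Longrightarrow> cls f \<bullet> cls g = (LINT x|Ipi. f x \<bullet> g x)"
  by (simp add: inner_hilbert_L2.abs_eq L2_rel_refl)

lemma norm_cls: "f \<in> L2 \<Longrightarrow> norm (cls f) = L2_nrm f"
  by (simp add: norm_eq_sqrt_inner cls_inner L2_nrm_def power2_norm_eq_inner)

lemma cscale_add_right: "cscale c (g + h) = cscale c g + cscale c h"
  by transfer (auto simp: L2_rel_def L2_eq_def vector_add_ldistrib intro!: L2_add L2_cscale)

lemma cscale_add_left: "cscale (c + d) h = cscale c h + cscale d h"
  by transfer (auto simp: L2_rel_def L2_eq_def vector_sadd_rdistrib intro!: L2_add L2_cscale)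

lemma cscale_cscale: "cscale c (cscale d h) = cscale (c * d) h"
  by transfer (auto simp: L2_rel_def L2_eq_def vector_smult_assoc intro!: L2_cscale)

lemma cscale_of_real: "cscale (of_real r) h = r *\<^sub>R h"
  by transfer (auto simp: L2_rel_def L2_eq_def of_real_vector_scalar_mult intro!: L2_scaleR)

lemma cscale_Re_Im: "cscale c h = Re c *\<^sub>R h + Im c *\<^sub>R cscale \<i> h"
proof -
  have "cscale c h = cscale (of_real (Re c) + of_real (Im c) * \<i>) h"
    by (subst complex_eq[of c]) (simp add: mult.commute)
  then show ?thesis by (simp add: cscale_add_left cscale_of_real flip: cscale_cscale)
qed

lemma norm_cscale: "norm (cscale c h) = cmod c * norm h"
proof -
  have "norm (cscale c (cls (repr h))) = cmod c * norm (cls (repr h))"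
    by (simp del: cls_repr add: cls_cscale[symmetric] norm_cls L2_cscale repr_L2)
      (simp add: L2_nrm_def norm_vector_scalar_mult power_mult_distrib real_sqrt_mult)
  then show ?thesis by simp
qed

lemma bounded_linear_cscale: "bounded_linear (cscale c)"
proof (rule bounded_linear_intro)
  show "cscale c (r *\<^sub>R h) = r *\<^sub>R cscale c h" for r and h :: "'a hilbert_L2"
    by (simp add: cscale_cscale mult.commute flip: cscale_of_real)
  show "norm (cscale c h) \<le> norm h * cmod c" for h :: "'a hilbert_L2"
    by (simp add: norm_cscale mult.commute)
qed (rule cscale_add_right)

text \<open>Passage from the extended nonnegative integrals of Fatou's lemma to membership in
  \<open>L2\<close>.\<close>

lemma ennreal_sq_integral_le:
  assumes "f \<in> borel_measurable Ipi" "(\<integral>\<^sup>+x. ennreal ((norm (f x))\<^sup>2) \<partial>Ipi) \<le> ennreal C" "0 \<le> C"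
  shows "f \<in> L2" "(LINT x|Ipi. (norm (f x))\<^sup>2) \<le> C"
proof -
  have [measurable]: "f \<in> borel_measurable Ipi" by fact
  have i: "integrable Ipi (\<lambda>x. (norm (f x))\<^sup>2)"
    by (rule integrableI_bounded) (use assms(2) in \<open>auto simp: le_less_trans[OF _ ennreal_less_top]\<close>)
  then show "f \<in> L2" using assms(1) by (simp add: L2_def)
  have "ennreal (LINT x|Ipi. (norm (f x))\<^sup>2) \<le> ennreal C"
    using nn_integral_eq_integral[OF i] assms(2) by simp
  then show "(LINT x|Ipi. (norm (f x))\<^sup>2) \<le> C" using assms(3) by (simp add: ennreal_le_iff)
qed

lemma nn_integral_sq_norm_cls:
  assumes "f \<in> L2" shows "(\<integral>\<^sup>+x. ennreal ((norm (f x))\<^sup>2) \<partial>Ipi) = ennreal ((norm (cls f))\<^sup>2)"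
  using nn_integral_eq_integral[OF L2_integrable[OF assms]]
  by (simp add: norm_cls assms L2_nrm_def)

text \<open>A sequence with geometrically decreasing increments converges almost everywhere, and Fatou's
  lemma identifies the pointwise limit as the limit in the mean.\<close>

lemma hilbert_L2_fast_Cauchy_convergent:
  fixes X :: "nat \<Rightarrow> 'm::finite hilbert_L2"
  assumes fast: "\<And>j k. k \<le> j \<Longrightarrow> norm (X j - X k) \<le> (1/2)^k"
  shows "convergent X"
proof -
  define h where "h k = repr (X k)" for k
  have hL2: "h k \<in> L2" for k by (simp add: h_def repr_L2)
  have clsh: "cls (h k) = X k" for k by (simp add: h_def)
  have [measurable]: "h k \<in> borel_measurable Ipi" for k by (rule L2_measurable[OF hL2])
  have nn: "(\<integral>\<^sup>+x. ennreal ((norm (h j x - h k x))\<^sup>2) \<partial>Ipi) \<le> ennreal (((1/2)^k)\<^sup>2)" if "k \<le> j" for j k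
    using fast[OF that] nn_integral_sq_norm_cls[OF L2_diff[OF hL2 hL2], of j k]
    by (simp add: cls_diff[OF hL2 hL2] clsh ennreal_leI power_mono)
  \<comment> \<open>On an interval of length pi a mean square bound controls the integral of the
    norm: integrate \<open>a \<le> t + a\<^sup>2 / t\<close> with
    \<open>t = (1/2)^k\<close>.\<close>
  have inc: "(\<integral>\<^sup>+x. ennreal (norm (h (Suc k) x - h k x)) \<partial>Ipi) \<le> ennreal ((pi + 1) * (1/2)^k)" for k
  proof -
    define t :: real where "t = (1/2)^k"
    have t: "t > 0" by (simp add: t_def)
    have ineq: "a \<le> t + a\<^sup>2 / t" if "a \<ge> 0" for a
    proof -
      have "0 \<le> (a - t)\<^sup>2 + a * t" using that t by simp
      then have "a * t \<le> t * t + a\<^sup>2" by (simp add: power2_eq_square algebra_simps)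
      then show ?thesis using t by (simp add: field_simps power2_eq_square)
    qed
    have "(\<integral>\<^sup>+x. ennreal (norm (h (Suc k) x - h k x)) \<partial>Ipi)
        \<le> (\<integral>\<^sup>+x. ennreal t + ennreal (1/t) * ennreal ((norm (h (Suc k) x - h k x))\<^sup>2) \<partial>Ipi)"
      by (intro nn_integral_mono)
        (use t ineq in \<open>simp add: ennreal_leI flip: ennreal_mult' ennreal_plus\<close>)
    also have "\<dots> = ennreal t * ennreal pi +
        ennreal (1/t) * (\<integral>\<^sup>+x. ennreal ((norm (h (Suc k) x - h k x))\<^sup>2) \<partial>Ipi)"
      by (subst nn_integral_add) (auto simp: nn_integral_cmult emeasure_restrict_space)
    also have "\<dots> \<le> ennreal t * ennreal pi + ennreal (1/t) * ennreal (t\<^sup>2)"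
      using nn[of k "Suc k"] by (intro add_mono mult_left_mono) (auto simp: t_def)
    also have "\<dots> = ennreal ((pi + 1) * t)"
      using t by (simp flip: ennreal_mult' ennreal_plus add: power2_eq_square algebra_simps)
    finally show ?thesis by (simp add: t_def)
  qed
  have "(\<integral>\<^sup>+x. (\<Sum>k. ennreal (norm (h (Suc k) x - h k x))) \<partial>Ipi)
      = (\<Sum>k. \<integral>\<^sup>+x. ennreal (norm (h (Suc k) x - h k x)) \<partial>Ipi)"
    by (rule nn_integral_suminf) measurable
  also have "\<dots> \<le> (\<Sum>k. ennreal ((pi + 1) * (1/2)^k))"
    by (intro suminf_le inc) auto
  also have "\<dots> = ennreal (\<Sum>k. (pi + 1) * (1/2)^k)"
    by (rule suminf_ennreal2) (auto intro!: summable_mult summable_geometric)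
  also have "\<dots> < \<infinity>" by simp
  finally have "AE x in Ipi. (\<Sum>k. ennreal (norm (h (Suc k) x - h k x))) \<noteq> \<infinity>"
    by (intro nn_integral_PInf_AE) auto
  then have conv: "AE x in Ipi. (\<lambda>k. h k x) \<longlonglongrightarrow> lim (\<lambda>k. h k x)"
  proof eventually_elim
    case (elim x)
    then have "summable (\<lambda>k. norm (h (Suc k) x - h k x))"
      by (intro summable_suminf_not_top) auto
    then have "summable (\<lambda>k. h (Suc k) x - h k x)" by (rule summable_norm_cancel)
    then have "convergent (\<lambda>n. \<Sum>k<n. h (Suc k) x - h k x)" by (simp add: summable_iff_convergent)
    then have "convergent (\<lambda>n. h n x - h 0 x)" by (simp add: sum_lessThan_telescope[of "\<lambda>n. h n x"])
    then have "convergent (\<lambda>n. (h n x - h 0 x) + h 0 x)"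
      by (intro convergent_add convergent_const)
    then show ?case by (simp add: convergent_LIMSEQ_iff)
  qed
  define f where "f x = lim (\<lambda>k. h k x)" for x
  have [measurable]: "f \<in> borel_measurable Ipi"
    unfolding f_def by (rule borel_measurable_lim_metric) measurable
  have bound: "(\<integral>\<^sup>+x. ennreal ((norm (f x - h k x))\<^sup>2) \<partial>Ipi) \<le> ennreal (((1/2)^k)\<^sup>2)" for k
  proof -
    have "(\<integral>\<^sup>+x. ennreal ((norm (f x - h k x))\<^sup>2) \<partial>Ipi) =
        (\<integral>\<^sup>+x. liminf (\<lambda>j. ennreal ((norm (h j x - h k x))\<^sup>2)) \<partial>Ipi)"
    proof (rule nn_integral_cong_AE, use conv in eventually_elim)
      case (elim x)
      then have "(\<lambda>j. ennreal ((norm (h j x - h k x))\<^sup>2)) \<longlonglongrightarrow> ennreal ((norm (f x - h k x))\<^sup>2)"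
        unfolding f_def by (intro tendsto_intros)
      then show ?case by (intro lim_imp_Liminf[symmetric]) auto
    qed
    also have "\<dots> \<le> liminf (\<lambda>j. \<integral>\<^sup>+x. ennreal ((norm (h j x - h k x))\<^sup>2) \<partial>Ipi)"
      by (rule nn_integral_liminf) measurable
    also have "\<dots> \<le> limsup (\<lambda>j. \<integral>\<^sup>+x. ennreal ((norm (h j x - h k x))\<^sup>2) \<partial>Ipi)"
      by (rule Liminf_le_Limsup) simp
    also have "\<dots> \<le> ennreal (((1/2)^k)\<^sup>2)"
      by (rule Limsup_bounded) (use nn[of k] in \<open>auto simp: eventually_sequentially\<close>)
    finally show ?thesis .
  qed
  have fh: "(\<lambda>x. f x - h k x) \<in> L2" "(LINT x|Ipi. (norm (f x - h k x))\<^sup>2) \<le> ((1/2)^k)\<^sup>2" for k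
    using ennreal_sq_integral_le[OF _ bound[of k]] by auto
  have fL2: "f \<in> L2" using L2_add[OF fh(1)[of 0] hL2[of 0]] by simp
  have "norm (X k - cls f) \<le> (1/2)^k" for k
  proof -
    have "norm (X k - cls f) = norm (cls (\<lambda>x. f x - h k x))"
      by (simp add: cls_diff fL2 hL2 clsh norm_minus_commute)
    also have "\<dots> = sqrt (LINT x|Ipi. (norm (f x - h k x))\<^sup>2)" by (simp add: norm_cls fh L2_nrm_def)
    also have "\<dots> \<le> (1/2)^k" by (rule real_le_lsqrt) (use fh in auto)
    finally show ?thesis .
  qed
  then have "\<forall>\<^sub>F k in sequentially. norm (X k - cls f) \<le> (1/2)^k" by simp
  moreover have "(\<lambda>k. (1/2::real)^k) \<longlonglongrightarrow> 0" by (rule LIMSEQ_realpow_zero) auto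
  ultimately have "(\<lambda>k. X k - cls f) \<longlonglongrightarrow> 0" by (rule Lim_null_comparison)
  then have "X \<longlonglongrightarrow> cls f" by (rule LIM_zero_cancel)
  then show ?thesis by (rule convergentI)
qed

instance hilbert_L2 :: (finite) banach
proof
  fix X :: "nat \<Rightarrow> 'a hilbert_L2"
  assume X: "Cauchy X"
  have "\<forall>k. \<exists>N. \<forall>m\<ge>N. \<forall>n\<ge>N. norm (X m - X n) < (1/2)^k"
    using X by (auto simp: Cauchy_def dist_norm)
  then obtain N where N: "\<And>k m n. m \<ge> N k \<Longrightarrow> n \<ge> N k \<Longrightarrow> norm (X m - X n) < (1/2)^k" by metis
  \<comment> \<open>The summand \<open>k\<close> makes \<open>r\<close> strictly increasing, and the
    sum keeps \<open>r k\<close> above \<open>N k\<close>.\<close>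
  define r where "r k = k + (\<Sum>j\<le>k. N j)" for k
  have rN: "r k \<ge> N k" for k
    using member_le_sum[of k "{..k}" N] by (simp add: r_def)
  have smr: "strict_mono r" by (simp add: strict_mono_Suc_iff r_def)
  have "convergent (X \<circ> r)"
  proof (rule hilbert_L2_fast_Cauchy_convergent)
    fix j k :: nat assume "k \<le> j"
    then have "r j \<ge> N k" using rN[of k] strict_mono_less_eq[OF smr, of k j] by linarith
    then show "norm ((X \<circ> r) j - (X \<circ> r) k) \<le> (1/2)^k"
      using N[of k "r j" "r k"] rN[of k] by simp
  qed
  then obtain l where "(X \<circ> r) \<longlonglongrightarrow> l" by (auto simp: convergent_def)
  then have "X \<longlonglongrightarrow> l" using Cauchy_converges_subseq[OF X smr] by blast
  then show "convergent X" by (rule convergentI)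
qed

section \<open>From the real to the complex Hilbert space\<close>

text \<open>A complex family regarded as a family over the real scalars; the real index records the
  multiplication by the imaginary unit.\<close>

definition real_family :: "('i \<Rightarrow> 'm::finite hilbert_L2) \<Rightarrow> 'i \<times> bool \<Rightarrow> 'm hilbert_L2"
  where "real_family f q = (if snd q then cscale \<i> (f (fst q)) else f (fst q))"

lemma real_family_simps [simp]:
  "real_family f (p, False) = f p" "real_family f (p, True) = cscale \<i> (f p)"
  by (simp_all add: real_family_def)

lemma cscale_in_span_real_family:
  assumes "p \<in> J" shows "cscale c (f p) \<in> span (real_family f ` (J \<times> UNIV))"
proof -
  have "real_family f (p, b) \<in> span (real_family f ` (J \<times> UNIV))" for b
    using assms by (intro span_base imageI) auto
  from this[of False] this[of True] show ?thesis
    by (subst cscale_Re_Im) (auto intro!: span_add span_scale)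
qed

lemma span_real_family_obtain:
  assumes "h \<in> span (real_family f ` (J \<times> UNIV))"
  shows "\<exists>F c. finite F \<and> F \<subseteq> J \<and> h = (\<Sum>p\<in>F. cscale (c p) (f p))"
  using assms
proof (induction rule: span_induct_alt)
  case base
  show ?case by (intro exI[of _ "{}"]) auto
next
  case (step r x y)
  then obtain p b F c where p: "p \<in> J" "x = real_family f (p, b)"
    and F: "finite F" "F \<subseteq> J" "y = (\<Sum>p\<in>F. cscale (c p) (f p))" by auto
  define d :: complex where "d = (if b then of_real r * \<i> else of_real r)"
  have x: "r *\<^sub>R x = cscale d (f p)"
    by (cases b) (simp_all add: p d_def cscale_of_real flip: cscale_cscale)
  \<comment> \<open>\<open>p\<close> may already occur in \<open>F\<close>, so its new coefficient
    is added to the old one.\<close>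
  define c' where "c' q = (if q \<in> F then c q else 0) + (if q = p then d else 0)" for q
  have c0: "cscale 0 g = 0" for g :: "'a hilbert_L2"
    using cscale_of_real[of 0 g] by simp
  have "(\<Sum>q\<in>insert p F. cscale (c' q) (f q)) =
      (\<Sum>q\<in>insert p F. if q \<in> F then cscale (c q) (f q) else 0) +
      (\<Sum>q\<in>insert p F. if q = p then cscale d (f q) else 0)"
    unfolding sum.distrib[symmetric]
    by (intro sum.cong refl) (auto simp: c'_def cscale_add_left c0)
  also have "(\<Sum>q\<in>insert p F. if q = p then cscale d (f q) else 0) = cscale d (f p)"
    using F(1) by simp
  also have "(\<Sum>q\<in>insert p F. if q \<in> F then cscale (c q) (f q) else 0) = y"
    unfolding F(3) using F(1) by (intro sum.mono_neutral_cong_right) auto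
  finally have "r *\<^sub>R x + y = (\<Sum>q\<in>insert p F. cscale (c' q) (f q))" by (simp add: x add.commute)
  then show ?case using F p(1) by (intro exI[of _ "insert p F"] exI[of _ c']) auto
qed

text \<open>Real combinations of a family and of its multiples by \<i> are the complex combinations
  of the family, so completeness is density of a real span.\<close>

lemma L2_complete_iff_dense:
  assumes Y: "\<And>p. p \<in> J \<Longrightarrow> Y p \<in> L2"
  shows "L2_complete J Y \<longleftrightarrow> closure (span (real_family (\<lambda>p. cls (Y p)) ` (J \<times> UNIV))) = UNIV"
proof -
  let ?S = "span (real_family (\<lambda>p. cls (Y p)) ` (J \<times> UNIV))"
  have comb: "L2_nrm (\<lambda>x. f x - (\<Sum>p\<in>F. c p *s Y p x)) = dist (\<Sum>p\<in>F. cscale (c p) (cls (Y p))) (cls f)"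
    if "f \<in> L2" "F \<subseteq> J" for f F c
  proof -
    have s: "(\<lambda>x. \<Sum>p\<in>F. c p *s Y p x) \<in> L2"
      using that Y by (intro L2_sum L2_cscale) auto
    have "L2_nrm (\<lambda>x. f x - (\<Sum>p\<in>F. c p *s Y p x)) = norm (cls f - cls (\<lambda>x. \<Sum>p\<in>F. c p *s Y p x))"
      using that s by (simp add: norm_cls L2_diff flip: cls_diff)
    also have "cls (\<lambda>x. \<Sum>p\<in>F. c p *s Y p x) = (\<Sum>p\<in>F. cscale (c p) (cls (Y p)))"
      using that Y by (subst cls_sum) (auto intro!: sum.cong cls_cscale L2_cscale)
    finally show ?thesis by (simp add: dist_norm norm_minus_commute)
  qed
  show ?thesis
  proof
    assume c: "L2_complete J Y"
    have "h \<in> closure ?S" for h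
      unfolding closure_approachable
    proof (intro allI impI)
      fix \<epsilon> :: real assume "\<epsilon> > 0"
      then obtain F c where F: "finite F" "F \<subseteq> J" "L2_nrm (\<lambda>x. repr h x - (\<Sum>p\<in>F. c p *s Y p x)) < \<epsilon>"
        using c repr_L2[of h] unfolding L2_complete_def by blast
      then show "\<exists>y\<in>?S. dist y h < \<epsilon>"
        by (intro bexI[of _ "\<Sum>p\<in>F. cscale (c p) (cls (Y p))"])
          (auto simp: comb repr_L2 intro!: span_sum cscale_in_span_real_family[where f = "\<lambda>p. cls (Y p)"])
    qed
    then show "closure ?S = UNIV" by auto
  next
    assume c: "closure ?S = UNIV"
    show "L2_complete J Y"
      unfolding L2_complete_def
    proof (intro conjI ballI allI impI Y)
      fix f :: "real \<Rightarrow> complex^'b" and \<epsilon> :: real assume f: "f \<in> L2" "\<epsilon> > 0"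
      have "cls f \<in> closure ?S" using c by simp
      then obtain y where y: "y \<in> ?S" "dist y (cls f) < \<epsilon>"
        using f(2) unfolding closure_approachable by blast
      obtain F c where F: "finite F" "F \<subseteq> J" "y = (\<Sum>p\<in>F. cscale (c p) (cls (Y p)))"
        using span_real_family_obtain[OF y(1)] by blast
      show "\<exists>F c. finite F \<and> F \<subseteq> J \<and> L2_nrm (\<lambda>x. f x - (\<Sum>p\<in>F. c p *s Y p x)) < \<epsilon>"
        using F y(2) f(1) by (intro exI[of _ F] exI[of _ c]) (simp add: comb)
    qed
  qed
qed

lemma cinner_scale_right: "cinner u (c *s v) = c * cinner u v"
  and cinner_scale_left: "cinner (c *s u) v = cnj c * cinner u v"
  by (simp_all add: cinner_def sum_distrib_left mult_ac)

text \<open>The form is conjugate-linear in its first argument, so a factor \<i> there moves the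
  imaginary part into the real part. The real inner product thus carries the whole complex
  one.\<close>

lemma cls_inner_L2_inner:
  assumes "f \<in> L2" "g \<in> L2" shows "cls f \<bullet> cls g = Re (L2_inner f g)"
    and "cscale \<i> (cls f) \<bullet> cls g = Im (L2_inner f g)"
proof -
  have i: "integrable Ipi (\<lambda>x. cinner (f x) (g x))"
  proof -
    have "integrable Ipi (\<lambda>x. complex_of_real (f x \<bullet> g x) + of_real ((\<i> *s f x) \<bullet> g x) * \<i>)"
      by (intro Bochner_Integration.integrable_add integrable_mult_left integrable_of_real
          L2_integrable_inner L2_cscale assms)
    then show ?thesis
      by (rule Bochner_Integration.integrable_cong[THEN iffD1, rotated 2])
        (auto simp: inner_eq_Re_cinner cinner_scale_left complex_eq_iff)
  qed
  show "cls f \<bullet> cls g = Re (L2_inner f g)"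
    using i by (simp add: cls_inner assms L2_inner_def inner_eq_Re_cinner)
  show "cscale \<i> (cls f) \<bullet> cls g = Im (L2_inner f g)"
    using i by (simp add: cls_inner cls_cscale[symmetric] L2_cscale assms L2_inner_def
        inner_eq_Re_cinner cinner_scale_left)
qed

text \<open>Multiplication by \<i> preserves norms, hence by polarisation the real inner
  product.\<close>

lemma cscale_i_inner: "cscale \<i> g \<bullet> cscale \<i> h = g \<bullet> h" for g h :: "'m::finite hilbert_L2"
proof -
  have "(norm (g + h))\<^sup>2 = (norm (cscale \<i> g + cscale \<i> h))\<^sup>2"
    by (simp add: norm_cscale flip: cscale_add_right)
  then show ?thesis by (simp add: dot_norm norm_cscale)
qed

text \<open>The doubled families \<open>E\<close> and \<open>Z\<close> reduce the claim to the real
  Hilbert space. The factor \<open>c\<close> reconciles the normalised system \<open>e\<close> with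
  the unnormalised \<open>Y\<close> and is divided out again at the end.\<close>

theorem riesz_basis_of_quadratically_close:
  fixes e Y :: "'i \<Rightarrow> real \<Rightarrow> complex ^ 'm"
  assumes e: "\<And>p. p \<in> J \<Longrightarrow> e p \<in> L2"
    and on: "\<And>p q. p \<in> J \<Longrightarrow> q \<in> J \<Longrightarrow> L2_inner (e p) (e q) = (if p = q then 1 else 0)"
    and c: "0 < c"
    and sm: "(\<lambda>p. (L2_nrm (\<lambda>x. c *\<^sub>R Y p x - e p x))\<^sup>2) summable_on J"
    and compl: "L2_complete J Y"
  shows "L2_riesz_basis J Y"
proof -
  have Y: "Y p \<in> L2" if "p \<in> J" for p using compl that by (simp add: L2_complete_def)
  define E where "E = real_family (\<lambda>p. cls (e p))"
  define Z where "Z = real_family (\<lambda>p. c *\<^sub>R cls (Y p))"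
  let ?J = "J \<times> (UNIV :: bool set)"
  interpret ci: bounded_linear "cscale \<i> :: 'm hilbert_L2 \<Rightarrow> 'm hilbert_L2" by (rule bounded_linear_cscale)
  have onE: "E p \<bullet> E q = (if p = q then 1 else 0)" if "p \<in> ?J" "q \<in> ?J" for p q
    using that
    by (cases p; cases q)
      (auto simp: E_def real_family_def cscale_i_inner cls_inner_L2_inner e on inner_commute[of "cls _" "cscale _ _"])
  have smE: "(\<lambda>q. (norm (Z q - E q))\<^sup>2) summable_on ?J"
  proof -
    have n: "norm (Z (p, b) - E (p, b)) = L2_nrm (\<lambda>x. c *\<^sub>R Y p x - e p x)" if "p \<in> J" for p b
    proof -
      have "norm (Z (p, b) - E (p, b)) = norm (c *\<^sub>R cls (Y p) - cls (e p))"
        by (cases b) (simp_all add: Z_def E_def norm_cscale flip: ci.diff)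
      also have "\<dots> = L2_nrm (\<lambda>x. c *\<^sub>R Y p x - e p x)"
        using that by (simp add: Y e L2_scaleR L2_diff flip: cls_scaleR cls_diff norm_cls)
      finally show ?thesis .
    qed
    have "(\<lambda>q. (norm (Z q - E q))\<^sup>2) summable_on (\<lambda>p. (p, b)) ` J" for b
      by (subst summable_on_reindex)
        (auto simp: inj_on_def o_def n intro: summable_on_cong[THEN iffD1, OF _ sm])
    from this[of True] this[of False]
    have "(\<lambda>q. (norm (Z q - E q))\<^sup>2) summable_on (\<lambda>p. (p, True)) ` J \<union> (\<lambda>p. (p, False)) ` J"
      by (rule summable_on_Un_disjoint) auto
    also have "(\<lambda>p. (p, True)) ` J \<union> (\<lambda>p. (p, False)) ` J = ?J" by (auto simp: image_iff)
    finally show ?thesis .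
  qed
  have denseZ: "closure (span (Z ` ?J)) = UNIV"
  proof -
    have "real_family (\<lambda>p. cls (Y p)) ` ?J \<subseteq> span (Z ` ?J)"
    proof clarify
      fix p b assume "p \<in> J"
      then have "Z (p, b) \<in> span (Z ` ?J)" by (intro span_base imageI) auto
      then have "(1/c) *\<^sub>R Z (p, b) \<in> span (Z ` ?J)" by (rule span_scale)
      moreover have "(1/c) *\<^sub>R Z (p, b) = real_family (\<lambda>p. cls (Y p)) (p, b)"
        using c by (cases b) (simp_all add: Z_def flip: ci.scaleR)
      ultimately show "real_family (\<lambda>p. cls (Y p)) (p, b) \<in> span (Z ` ?J)" by simp
    qed
    then have "span (real_family (\<lambda>p. cls (Y p)) ` ?J) \<subseteq> span (Z ` ?J)"
      by (rule span_minimal) simp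
    moreover have "closure (span (real_family (\<lambda>p. cls (Y p)) ` ?J)) = UNIV"
      using L2_complete_iff_dense[of J Y, OF Y] compl by simp
    ultimately show ?thesis using closure_mono by blast
  qed
  obtain T S where T: "bounded_linear T" and S: "bounded_linear S" and
    ST: "\<And>x. S (T x) = x" and TS: "\<And>x. T (S x) = x" and TE: "\<And>q. q \<in> ?J \<Longrightarrow> T (E q) = Z q"
    using quadratically_close_complete_imp_image[OF onE smE denseZ] by blast
  interpret T: bounded_linear T by (rule T)
  interpret S: bounded_linear S by (rule S)
  have SZ: "S (Z q) = E q" if "q \<in> ?J" for q using ST[of "E q"] TE[OF that] by simp
  have denseE: "closure (span (E ` ?J)) = UNIV"
  proof -
    have "S ` closure (span (Z ` ?J)) \<subseteq> closure (S ` span (Z ` ?J))"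
      by (rule image_closure_subset[OF _ closed_closure closure_subset])
        (intro linear_continuous_on S)
    also have "S ` span (Z ` ?J) = span (S ` Z ` ?J)"
      by (rule linear_span_image[OF S.linear_axioms, symmetric])
    also have "S ` Z ` ?J = E ` ?J" by (auto simp: image_image SZ intro!: image_cong)
    finally have "range S \<subseteq> closure (span (E ` ?J))" by (simp add: denseZ)
    moreover have "y \<in> range S" for y using ST[of y] by (metis rangeI)
    ultimately show ?thesis by auto
  qed
  \<comment> \<open>On the doubled system \<open>T\<close> commutes with multiplication by \<i> by
    construction, and the vectors where it does so form a closed subspace.\<close>
  have icomm: "T (cscale \<i> h) = cscale \<i> (T h)" for h
  proof -
    let ?A = "{h. T (cscale \<i> h) = cscale \<i> (T h)}"
    have ii: "cscale \<i> (cscale \<i> g) = - g" for g :: "'m hilbert_L2"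
      using cscale_of_real[of "-1" g] by (simp add: cscale_cscale)
    have "E ` ?J \<subseteq> ?A"
    proof clarify
      fix p b assume p: "p \<in> J"
      show "T (cscale \<i> (E (p, b))) = cscale \<i> (T (E (p, b)))"
        using TE[of "(p, True)"] TE[of "(p, False)"] p
        by (cases b) (simp_all add: E_def Z_def ii T.neg)
    qed
    moreover have "subspace ?A"
      by (auto simp: subspace_def T.zero ci.zero T.add ci.add T.scaleR ci.scaleR)
    ultimately have "span (E ` ?J) \<subseteq> ?A" by (rule span_minimal)
    moreover have "closed ?A"
      by (intro closed_Collect_eq linear_continuous_on bounded_linear_compose[OF T ci.bounded_linear_axioms]
          bounded_linear_compose[OF ci.bounded_linear_axioms T])
    ultimately have "closure (span (E ` ?J)) \<subseteq> ?A" by (rule closure_minimal)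
    then show ?thesis using denseE by auto
  qed
  have ccommT: "T (cscale a h) = cscale a (T h)" for a h
    by (subst (1 2) cscale_Re_Im) (simp add: T.add T.scaleR icomm)
  have ccommS: "S (cscale a h) = cscale a (S h)" for a h
  proof -
    have "T (cscale a (S h)) = cscale a h" by (simp add: ccommT TS)
    then show ?thesis using ST by metis
  qed
  \<comment> \<open>Operators on classes become operators on functions by choosing representatives;
    linearity then holds up to equality almost everywhere, as \<open>L2_bounded_linear\<close>
    asks.\<close>
  have lift: "L2_bounded_linear (\<lambda>f. repr (d *\<^sub>R A (cls f)))"
    if A: "bounded_linear A" and comm: "\<And>a h. A (cscale a h) = cscale a (A h)"
    for A :: "'m hilbert_L2 \<Rightarrow> 'm hilbert_L2" and d
  proof -
    interpret A: bounded_linear A by (rule A)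
    obtain M where M: "\<And>h. norm (A h) \<le> norm h * M" using A.bounded by blast
    show ?thesis
      unfolding L2_bounded_linear_def
    proof (intro conjI ballI allI exI[of _ "\<bar>d\<bar> * M"])
      fix f g :: "real \<Rightarrow> complex^'m" and a
      assume f: "f \<in> L2"
      show "repr (d *\<^sub>R A (cls f)) \<in> L2" by (rule repr_L2)
      have *: "cls (\<lambda>x. a *s repr (d *\<^sub>R A (cls f)) x) = cscale a (d *\<^sub>R A (cls f))"
        by (simp add: cls_cscale repr_L2)
      show "L2_eq (repr (d *\<^sub>R A (cls (\<lambda>x. a *s f x)))) (\<lambda>x. a *s repr (d *\<^sub>R A (cls f)) x)"
        by (subst cls_eq_iff[symmetric]) (auto simp: * repr_L2 L2_cscale cls_cscale f comm cscale_cscale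
            mult.commute simp flip: cscale_of_real)
      have "L2_nrm (repr (d *\<^sub>R A (cls f))) = \<bar>d\<bar> * norm (A (cls f))"
        by (simp add: repr_L2 flip: norm_cls)
      also have "\<dots> \<le> \<bar>d\<bar> * (norm (cls f) * M)" by (intro mult_left_mono M) simp
      finally show "L2_nrm (repr (d *\<^sub>R A (cls f))) \<le> \<bar>d\<bar> * M * L2_nrm f"
        using f by (simp add: norm_cls mult_ac)
      assume g: "g \<in> L2"
      have *: "cls (\<lambda>x. repr (d *\<^sub>R A (cls f)) x + repr (d *\<^sub>R A (cls g)) x) = d *\<^sub>R A (cls f) + d *\<^sub>R A (cls g)"
        by (simp add: cls_add repr_L2)
      show "L2_eq (repr (d *\<^sub>R A (cls (\<lambda>x. f x + g x)))) (\<lambda>x. repr (d *\<^sub>R A (cls f)) x + repr (d *\<^sub>R A (cls g)) x)"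
        by (subst cls_eq_iff[symmetric]) (auto simp: * repr_L2 L2_add cls_add f g A.add scaleR_add_right)
    qed
  qed
  have "L2_complete J e"
    using L2_complete_iff_dense[of J e, OF e] denseE by (simp add: E_def)
  then have onb: "L2_orthonormal_basis J e" by (simp add: L2_orthonormal_basis_def on)
  \<comment> \<open>\<open>T\<close> sends the class of \<open>e p\<close> to \<open>c\<close> times
    that of \<open>Y p\<close>, hence the factor \<open>1/c\<close> here and \<open>c\<close> in the
    inverse.\<close>
  let ?T = "\<lambda>f. repr ((1/c) *\<^sub>R T (cls f))" and ?S = "\<lambda>f. repr (c *\<^sub>R S (cls f))"
  have lT: "L2_bounded_linear ?T" by (rule lift[OF T ccommT])
  have lS: "L2_bounded_linear ?S" by (rule lift[OF S ccommS])
  have inv: "L2_eq (?S (?T f)) f \<and> L2_eq (?T (?S f)) f" if f: "f \<in> L2" for f :: "real \<Rightarrow> complex^'m"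
  proof
    show "L2_eq (?S (?T f)) f"
      using c by (subst cls_eq_iff[symmetric]) (auto simp: repr_L2 f S.scaleR ST)
    show "L2_eq (?T (?S f)) f"
      using c by (subst cls_eq_iff[symmetric]) (auto simp: repr_L2 f T.scaleR TS)
  qed
  have img: "L2_eq (?T (e p)) (Y p)" if p: "p \<in> J" for p
  proof -
    have "T (cls (e p)) = c *\<^sub>R cls (Y p)" using TE[of "(p, False)"] p by (simp add: E_def Z_def)
    then show ?thesis
      using c by (subst cls_eq_iff[symmetric]) (auto simp: repr_L2 Y p)
  qed
  show ?thesis
    unfolding L2_riesz_basis_def
    by (intro conjI exI[of _ e] exI[of _ ?T] exI[of _ ?S] ballI Y onb lT lS inv img)
qed

section \<open>The spectral theorem for normal matrices\<close>

lemma cinner_add_right: "cinner u (v + w) = cinner u v + cinner u w"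
  and cinner_add_left: "cinner (u + v) w = cinner u w + cinner v w"
  and cinner_diff_right: "cinner u (v - w) = cinner u v - cinner u w"
  and cinner_diff_left: "cinner (u - v) w = cinner u w - cinner v w"
  by (simp_all add: cinner_def sum.distrib sum_subtractf algebra_simps)

lemma cinner_zero [simp]: "cinner u 0 = 0" "cinner 0 u = 0"
  by (simp_all add: cinner_def)

lemma cinner_sum_right: "cinner u (\<Sum>i\<in>I. f i) = (\<Sum>i\<in>I. cinner u (f i))"
  by (induction I rule: infinite_finite_induct) (simp_all add: cinner_add_right)

lemma cinner_sum_left: "cinner (\<Sum>i\<in>I. f i) u = (\<Sum>i\<in>I. cinner (f i) u)"
  by (induction I rule: infinite_finite_induct) (simp_all add: cinner_add_left)

lemma cinner_commute: "cinner u v = cnj (cinner v u)"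
  by (simp add: cinner_def mult.commute)

lemma cinner_self: "cinner v v = of_real ((norm v)\<^sup>2)"
proof -
  have "Im (cinner v v) = 0" using cinner_commute[of v v] by (simp add: complex_eq_iff)
  then show ?thesis
    by (simp add: complex_eq_iff power2_norm_eq_inner inner_eq_Re_cinner)
qed

lemma cinner_self_eq_0_iff [simp]: "cinner v v = 0 \<longleftrightarrow> v = 0"
  by (simp add: cinner_self)

lemma norm_eq_1_iff_cinner: "norm v = 1 \<longleftrightarrow> cinner v v = 1"
  by (simp only: cinner_self of_real_eq_1_iff) (simp add: power2_eq_1_iff, smt (verit) norm_ge_zero)

text \<open>A unimodular factor \<open>c\<close> rotates \<open>u\<close> until the inner product is
  real and nonnegative; the real Cauchy-Schwarz inequality then applies.\<close>

lemma cmod_cinner_le: "cmod (cinner u v) \<le> norm u * norm v"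
proof -
  define w where "w = cinner u v"
  define c where "c = (if w = 0 then 1 else w / cmod w)"
  have c1: "cmod c = 1" by (simp add: c_def norm_divide)
  have "cnj c * w = cmod w"
  proof (cases "w = 0")
    case False
    have "cnj c * w = (w * cnj w) / cmod w" using False by (simp add: c_def)
    also have "\<dots> = of_real (cmod w)"
      using False unfolding complex_norm_square[symmetric] by (simp add: power2_eq_square)
    finally show ?thesis .
  qed simp
  then have "cinner (c *s u) v = cmod (cinner u v)" by (simp add: cinner_scale_left w_def)
  then have "cmod (cinner u v) = (c *s u) \<bullet> v" by (simp add: inner_eq_Re_cinner)
  also have "\<dots> \<le> norm (c *s u) * norm v" by (rule norm_cauchy_schwarz)
  finally show ?thesis by (simp add: norm_vector_scalar_mult c1)
qed

lemma cinner_ctransp: "cinner (ctransp A *v u) v = cinner u (A *v v)"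
proof -
  have "cinner (ctransp A *v u) v = (\<Sum>i\<in>UNIV. \<Sum>j\<in>UNIV. cnj (u $ j) * A $ j $ i * v $ i)"
    by (simp add: cinner_def ctransp_def matrix_vector_mult_def sum_distrib_left sum_distrib_right mult_ac)
  also have "\<dots> = (\<Sum>j\<in>UNIV. \<Sum>i\<in>UNIV. cnj (u $ j) * A $ j $ i * v $ i)" by (rule sum.swap)
  also have "\<dots> = cinner u (A *v v)"
    by (simp add: cinner_def matrix_vector_mult_def sum_distrib_left mult_ac)
  finally show ?thesis .
qed

lemma ctransp_ctransp [simp]: "ctransp (ctransp A) = A"
  by (simp add: ctransp_def vec_eq_iff)

lemma cinner_ctransp': "cinner u (ctransp A *v v) = cinner (A *v u) v"
  using cinner_ctransp[of "ctransp A" u v] by simp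

lemma ctransp_mult: "ctransp (A ** B) = ctransp B ** ctransp A"
  by (simp add: ctransp_def matrix_matrix_mult_def vec_eq_iff mult.commute)

lemma matrix_vector_mult_cscale: "A *v (c *s v) = c *s (A *v v)" for A :: "complex^'n^'m"
  by (simp add: matrix_vector_mult_def vec_eq_iff sum_distrib_left mult_ac)

lemma matrix_vector_mult_sum: "A *v (\<Sum>i\<in>I. f i) = (\<Sum>i\<in>I. A *v f i)" for A :: "complex^'n^'m"
  by (induction I rule: infinite_finite_induct) (simp_all add: matrix_vector_right_distrib)

section \<open>Orthonormal families and expansions\<close>

lemma orthonormal_imp_independent:
  fixes q :: "'i \<Rightarrow> complex^'m"
  assumes I: "finite I"
    and on: "\<And>i j. i \<in> I \<Longrightarrow> j \<in> I \<Longrightarrow> cinner (q i) (q j) = (if i = j then 1 else 0)"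
  shows "inj_on q I" "vec.independent (q ` I)"
proof -
  show inj: "inj_on q I"
  proof (rule inj_onI)
    fix i j assume "i \<in> I" "j \<in> I" "q i = q j"
    then show "i = j" using on[of i j] on[of i i] by (simp split: if_splits)
  qed
  show "vec.independent (q ` I)"
  proof (rule vec.independent_if_scalars_zero)
    fix f x assume z: "(\<Sum>x\<in>q ` I. f x *s x) = 0" and "x \<in> q ` I"
    then obtain j where j: "j \<in> I" "x = q j" by auto
    have "0 = cinner (q j) (\<Sum>x\<in>q ` I. f x *s x)" by (simp add: z)
    also have "\<dots> = (\<Sum>i\<in>I. f (q i) * cinner (q j) (q i))"
      by (simp add: sum.reindex[OF inj] cinner_sum_right cinner_scale_right)
    also have "\<dots> = (\<Sum>i\<in>I. if i = j then f (q i) else 0)"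
      by (intro sum.cong refl) (use on[OF j(1)] in auto)
    also have "\<dots> = f x" using I j by simp
    finally show "f x = 0" by simp
  qed (use I in auto)
qed

lemma orthonormal_expansion_span:
  fixes q :: "'i \<Rightarrow> complex^'m"
  assumes I: "finite I"
    and on: "\<And>i j. i \<in> I \<Longrightarrow> j \<in> I \<Longrightarrow> cinner (q i) (q j) = (if i = j then 1 else 0)"
    and v: "v \<in> vec.span (q ` I)"
  shows "v = (\<Sum>i\<in>I. cinner (q i) v *s q i)"
proof -
  have "\<exists>u. v = (\<Sum>x\<in>q ` I. u x *s x)" using v I by (auto simp: vec.span_finite)
  then obtain u where "v = (\<Sum>x\<in>q ` I. u x *s x)" by blast
  then have u: "v = (\<Sum>i\<in>I. u (q i) *s q i)"
    using sum.reindex[OF orthonormal_imp_independent(1)[OF I on], of "\<lambda>x. u x *s x"] by simp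
  have "cinner (q j) v = u (q j)" if j: "j \<in> I" for j
  proof -
    have "cinner (q j) v = (\<Sum>i\<in>I. u (q i) * cinner (q j) (q i))"
      unfolding u by (simp add: cinner_sum_right cinner_scale_right)
    also have "\<dots> = (\<Sum>i\<in>I. if i = j then u (q i) else 0)"
      by (intro sum.cong refl) (use on[OF j] in auto)
    also have "\<dots> = u (q j)" using I j by simp
    finally show ?thesis .
  qed
  then have "(\<Sum>i\<in>I. cinner (q i) v *s q i) = (\<Sum>i\<in>I. u (q i) *s q i)" by (intro sum.cong) auto
  then show ?thesis using u by simp
qed

lemma orthonormal_expansion:
  fixes q :: "'i \<Rightarrow> complex^'m"
  assumes I: "finite I" "card I = CARD('m)"
    and on: "\<And>i j. i \<in> I \<Longrightarrow> j \<in> I \<Longrightarrow> cinner (q i) (q j) = (if i = j then 1 else 0)"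
  shows "v = (\<Sum>i\<in>I. cinner (q i) v *s q i)"
proof (rule orthonormal_expansion_span[OF I(1) on])
  have "card (q ` I) = CARD('m)"
    using card_image[OF orthonormal_imp_independent(1)[OF I(1) on]] I(2) by simp
  then have "UNIV \<subseteq> vec.span (q ` I)"
    by (intro vec.card_ge_dim_independent orthonormal_imp_independent(2)[OF I(1) on])
      (simp_all only: vec_dim_card subset_UNIV order_refl)
  then show "v \<in> vec.span (q ` I)" by blast
qed auto

lemma norm_orthonormal_sum:
  fixes q :: "'i \<Rightarrow> complex^'m"
  assumes I: "finite I"
    and on: "\<And>i j. i \<in> I \<Longrightarrow> j \<in> I \<Longrightarrow> cinner (q i) (q j) = (if i = j then 1 else 0)"
  shows "(norm (\<Sum>i\<in>I. a i *s q i))\<^sup>2 = (\<Sum>i\<in>I. (cmod (a i))\<^sup>2)"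
proof -
  let ?v = "\<Sum>i\<in>I. a i *s q i"
  have "cinner ?v ?v = (\<Sum>i\<in>I. \<Sum>j\<in>I. a i * (cnj (a j) * cinner (q j) (q i)))"
    by (simp add: cinner_sum_left cinner_sum_right cinner_scale_left cinner_scale_right sum_distrib_left)
  also have "\<dots> = (\<Sum>i\<in>I. \<Sum>j\<in>I. if j = i then a i * cnj (a i) else 0)"
    by (intro sum.cong refl) (auto simp: on)
  also have "\<dots> = (\<Sum>i\<in>I. complex_of_real ((cmod (a i))\<^sup>2))"
    using I by (simp add: complex_norm_square del: of_real_power)
  finally have "complex_of_real ((norm ?v)\<^sup>2) = complex_of_real (\<Sum>i\<in>I. (cmod (a i))\<^sup>2)"
    by (simp add: cinner_self)
  then show ?thesis by (simp only: of_real_eq_iff)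
qed

text \<open>A nonzero polynomial of minimal degree with \<open>p(N) v = 0\<close> splits off a linear factor \<open>N - z\<close>,
  and the cofactor applied to \<open>v\<close> is an eigenvector.\<close>

lemma eigenvector_in_invariant_subspace:
  fixes N :: "complex^'m^'m"
  assumes S: "vec.subspace S" and inv: "\<And>v. v \<in> S \<Longrightarrow> N *v v \<in> S" and v: "v \<in> S" "v \<noteq> 0"
  shows "\<exists>w z. w \<in> S \<and> w \<noteq> 0 \<and> N *v w = z *s w"
proof -
  define P where "P i = (((*v) N) ^^ i) v" for i
  have P0: "P 0 = v" and PS: "P (Suc i) = N *v P i" for i by (simp_all add: P_def)
  have PinS: "P i \<in> S" for i by (induction i) (simp_all add: P0 PS v inv)
  define ap where "ap p = (\<Sum>i\<le>degree p. coeff p i *s P i)" for p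
  have ap_ext: "ap p = (\<Sum>i\<le>n. coeff p i *s P i)" if "degree p \<le> n" for p n
    unfolding ap_def by (rule sum.mono_neutral_left) (use that in \<open>auto simp: coeff_eq_0\<close>)
  have ap_S: "ap p \<in> S" for p
    unfolding ap_def by (intro vec.subspace_sum[OF S] vec.subspace_scale[OF S] PinS)
  \<comment> \<open>There is one iterate more than the dimension. If all are distinct, they are
    linearly dependent. If two coincide, the set of iterates may be too small for that argument, and
    the difference of two monomials serves instead.\<close>
  have "\<exists>p. p \<noteq> 0 \<and> ap p = 0"
  proof (cases "inj_on P {..CARD('m)}")
    case True
    have "vec.dependent (P ` {..CARD('m)})"
      by (intro vec.dependent_biggerset_general)
        (simp add: card_image[OF True] le_less_trans[OF vec.dim_subset_UNIV] vec.dimension_def card_cart_basis)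
    then obtain u w where u: "(\<Sum>x\<in>P ` {..CARD('m)}. u x *s x) = 0" and w: "w \<in> P ` {..CARD('m)}" "u w \<noteq> 0"
      by (auto simp: vec.dependent_finite)
    obtain k where k: "k \<le> CARD('m)" "w = P k" using w(1) by auto
    define p where "p = (\<Sum>i\<le>CARD('m). monom (u (P i)) i)"
    have cp: "coeff p i = (if i \<le> CARD('m) then u (P i) else 0)" for i
      by (simp add: p_def coeff_sum)
    have "degree p \<le> CARD('m)" by (rule degree_le) (simp add: cp)
    then have "ap p = (\<Sum>i\<le>CARD('m). u (P i) *s P i)" by (subst ap_ext) (auto simp: cp)
    also have "\<dots> = 0" using u by (simp add: sum.reindex[OF True])
    finally have "ap p = 0" .
    moreover have "p \<noteq> 0" using cp[of k] k w(2) by auto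
    ultimately show ?thesis by blast
  next
    case False
    then obtain i j where ij: "i \<noteq> j" "P i = P j" by (auto simp: inj_on_def)
    define p where "p = monom (1::complex) i - monom 1 j"
    have dp: "degree p \<le> max i j"
      unfolding p_def by (intro degree_diff_le) (auto intro: order_trans[OF degree_monom_le])
    have "ap p = (\<Sum>l\<le>max i j. (if l = i then P l else 0) - (if l = j then P l else 0))"
      unfolding ap_ext[OF dp]
      by (intro sum.cong refl) (auto simp: p_def)
    also have "\<dots> = 0" using ij(2) by (simp add: sum_subtractf)
    finally have "ap p = 0" .
    moreover have "coeff p i = 1" using ij by (simp add: p_def)
    then have "p \<noteq> 0" by auto
    ultimately show ?thesis by blast
  qed
  \<comment> \<open>Minimality of the degree is what prevents the cofactor from annihilating
    \<open>v\<close>.\<close>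
  then obtain p where p: "p \<noteq> 0" "ap p = 0" and pmin: "\<And>q. q \<noteq> 0 \<Longrightarrow> ap q = 0 \<Longrightarrow> degree p \<le> degree q"
    using exists_least_iff[of "\<lambda>n. \<exists>p. p \<noteq> 0 \<and> ap p = 0 \<and> degree p = n"] by (metis not_le)
  have "degree p \<noteq> 0"
  proof
    assume "degree p = 0"
    then obtain a where a: "p = [:a:]" by (metis degree_eq_zeroE)
    then show False using p v(2) by (simp add: ap_def P0)
  qed
  then obtain z where "poly p z = 0"
    using alg_closed_imp_poly_has_root[of p] by auto
  then obtain q where q: "p = [:-z, 1:] * q" by (auto simp: poly_eq_0_iff_dvd)
  have q0: "q \<noteq> 0" using p(1) q by auto
  have "degree p = Suc (degree q)" unfolding q by (subst degree_mult_eq) (use q0 in auto)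
  then have "ap q \<noteq> 0" using pmin[OF q0] by auto
  moreover have "N *v ap q = z *s ap q"
  proof -
    have "ap p = (\<Sum>i\<le>Suc (degree q). coeff p i *s P i)"
      using \<open>degree p = _\<close> by (simp add: ap_def)
    also have "\<dots> = (\<Sum>i\<le>Suc (degree q). (case i of 0 \<Rightarrow> 0 | Suc j \<Rightarrow> coeff q j *s P i) - z *s (coeff q i *s P i))"
      by (intro sum.cong refl) (auto simp: q coeff_pCons vec.scale_left_diff_distrib split: nat.split)
    also have "\<dots> = (\<Sum>i\<le>Suc (degree q). (case i of 0 \<Rightarrow> 0 | Suc j \<Rightarrow> coeff q j *s P i)) - z *s ap q"
      by (simp only: sum_subtractf vec.scale_sum_right[symmetric] ap_ext[of q "Suc (degree q)"] le_SucI order_refl)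
    also have "(\<Sum>i\<le>Suc (degree q). (case i of 0 \<Rightarrow> 0 | Suc j \<Rightarrow> coeff q j *s P i)) = N *v ap q"
      by (subst sum.atMost_Suc_shift) (simp add: ap_def matrix_vector_mult_sum matrix_vector_mult_cscale PS)
    finally show ?thesis using p(2) by simp
  qed
  ultimately show ?thesis using ap_S by blast
qed

text \<open>By normality \<open>N *v q\<close> and \<open>ctransp N *v q\<close> have equal norms;
  expanding the squared norm of the difference \<open>?d\<close> then gives 0.\<close>

lemma normal_eigenvector_ctransp:
  fixes N :: "complex^'m^'m"
  assumes N: "N ** ctransp N = ctransp N ** N" and q: "N *v q = l *s q"
  shows "ctransp N *v q = cnj l *s q"
proof -
  let ?d = "ctransp N *v q - cnj l *s q"
  have "cinner (ctransp N *v q) (ctransp N *v q) = cinner (N *v q) (N *v q)"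
    by (simp add: cinner_ctransp matrix_vector_mul_assoc N)
      (simp add: cinner_ctransp' flip: matrix_vector_mul_assoc)
  also have "\<dots> = l * cnj l * cinner q q" by (simp add: q cinner_scale_left cinner_scale_right)
  finally have 1: "cinner (ctransp N *v q) (ctransp N *v q) = l * cnj l * cinner q q" .
  have 2: "cinner (ctransp N *v q) q = l * cinner q q" "cinner q (ctransp N *v q) = cnj l * cinner q q"
    by (simp_all only: cinner_ctransp cinner_ctransp' q cinner_scale_left cinner_scale_right)
  have "cinner ?d ?d = 0"
    unfolding cinner_diff_left cinner_diff_right cinner_scale_left cinner_scale_right 1 2 by simp
  then show ?thesis by simp
qed

lemma orthogonal_complement_nonzero:
  fixes q :: "nat \<Rightarrow> complex^'m"
  assumes on: "\<And>i j. i < k \<Longrightarrow> j < k \<Longrightarrow> cinner (q i) (q j) = (if i = j then 1 else 0)"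
    and x: "x \<notin> vec.span (q ` {..<k})"
  shows "x - (\<Sum>i<k. cinner (q i) x *s q i) \<noteq> 0"
    and "\<And>j. j < k \<Longrightarrow> cinner (q j) (x - (\<Sum>i<k. cinner (q i) x *s q i)) = 0"
proof -
  have "(\<Sum>i<k. cinner (q i) x *s q i) \<in> vec.span (q ` {..<k})"
    by (intro vec.span_sum vec.span_scale vec.span_base) auto
  then show "x - (\<Sum>i<k. cinner (q i) x *s q i) \<noteq> 0" using x by auto
  fix j assume j: "j < k"
  have "(\<Sum>i<k. cinner (q i) x * cinner (q j) (q i)) = (\<Sum>i<k. if i = j then cinner (q i) x else 0)"
    by (intro sum.cong refl) (use on[OF j] in auto)
  then show "cinner (q j) (x - (\<Sum>i<k. cinner (q i) x *s q i)) = 0" using j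
    by (simp add: cinner_diff_right cinner_sum_right cinner_scale_right)
qed

text \<open>The eigenvectors found so far are also eigenvectors of \<open>ctransp N\<close>, so
  their orthogonal complement is invariant under \<open>N\<close> and contains the next
  eigenvector.\<close>

theorem normal_matrix_spectral:
  fixes N :: "complex^'m^'m"
  assumes N: "N ** ctransp N = ctransp N ** N"
  shows "\<exists>q l. (\<forall>i<CARD('m). \<forall>j<CARD('m). cinner (q i) (q j) = (if i = (j::nat) then 1 else 0)) \<and>
    (\<forall>i<CARD('m). N *v q i = l i *s q i)"
proof -
  have "\<exists>q l. (\<forall>i<k. \<forall>j<k. cinner (q i) (q j) = (if i = (j::nat) then 1 else 0)) \<and>
    (\<forall>i<k. N *v q i = l i *s q i)" if "k \<le> CARD('m)" for k
    using that
  proof (induction k)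
    case 0
    show ?case by simp
  next
    case (Suc k)
    then obtain q l where on: "\<And>i j. i < k \<Longrightarrow> j < k \<Longrightarrow> cinner (q i) (q j) = (if i = (j::nat) then 1 else 0)"
      and eig: "\<And>i. i < k \<Longrightarrow> N *v q i = l i *s q i" by auto
    define S where "S = {v. \<forall>i<k. cinner (q i) v = 0}"
    have S: "vec.subspace S"
      by (auto simp: S_def vec.subspace_def cinner_add_right cinner_scale_right)
    have inv: "N *v v \<in> S" if "v \<in> S" for v
      using that normal_eigenvector_ctransp[OF N eig]
      by (auto simp: S_def cinner_scale_left simp flip: cinner_ctransp)
    obtain x where x: "x \<notin> vec.span (q ` {..<k})"
    proof (rule ccontr)
      assume "\<not> thesis"
      then have "vec.span (q ` {..<k}) = UNIV" using that by blast
      then have "CARD('m) \<le> card (q ` {..<k})"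
        using vec.dim_le_card[of UNIV "q ` {..<k}"] by (simp add: card_cart_basis)
      also have "\<dots> \<le> k" using card_image_le[of "{..<k}" q] by simp
      finally show False using Suc.prems by simp
    qed
    define v where "v = x - (\<Sum>i<k. cinner (q i) x *s q i)"
    have "v \<noteq> 0" "v \<in> S"
      using orthogonal_complement_nonzero[OF on x] by (simp_all add: v_def S_def)
    then obtain w z where w: "w \<in> S" "w \<noteq> 0" "N *v w = z *s w"
      using eigenvector_in_invariant_subspace[OF S inv] by blast
    define u where "u = complex_of_real (1 / norm w) *s w"
    have nu: "norm u = 1" using w(2) by (simp add: u_def norm_vector_scalar_mult norm_divide)
    have u: "cinner u u = 1" "N *v u = z *s u" "\<And>i. i < k \<Longrightarrow> cinner (q i) u = 0"
      using w nu by (auto simp: u_def cinner_scale_right cinner_self S_def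
          matrix_vector_mult_cscale mult.commute)
    have u': "\<And>i. i < k \<Longrightarrow> cinner u (q i) = 0" using u(3) by (subst cinner_commute) simp
    show ?case
      by (rule exI[of _ "q(k := u)"], rule exI[of _ "l(k := z)"])
        (auto simp: less_Suc_eq on eig u u')
  qed
  then show ?thesis by blast
qed

text \<open>\<open>mnorm\<close> is a maximum over a set that must first be identified. An
  orthonormal eigenbasis \<open>q\<close> of \<open>ctransp A ** A\<close> shows that the singular
  values are the finitely many numbers \<open>norm (A *v q i)\<close>.\<close>

lemma norm_matrix_vector_le_mnorm:
  fixes A :: "complex^'m^'m"
  shows "norm (A *v v) \<le> mnorm A * norm v" and "0 \<le> mnorm A"
proof -
  let ?N = "ctransp A ** A"
  have "?N ** ctransp ?N = ctransp ?N ** ?N" by (simp add: ctransp_mult)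
  then obtain q l where on: "\<And>i j. i < CARD('m) \<Longrightarrow> j < CARD('m) \<Longrightarrow> cinner (q i) (q j) = (if i = (j::nat) then 1 else 0)"
    and eig: "\<And>i. i < CARD('m) \<Longrightarrow> ?N *v q i = l i *s q i"
    using normal_matrix_spectral by blast
  have nn: "cinner (A *v x) (A *v y) = cinner x (?N *v y)" for x y
    by (simp add: cinner_ctransp' flip: matrix_vector_mul_assoc)
  define s where "s i = norm (A *v q i)" for i
  have l: "l i = of_real ((s i)\<^sup>2)" if i: "i < CARD('m)" for i
  proof -
    have "of_real ((s i)\<^sup>2) = cinner (A *v q i) (A *v q i)" by (simp only: s_def cinner_self)
    also have "\<dots> = l i" by (simp only: nn eig[OF i] cinner_scale_right) (simp add: on i)
    finally show ?thesis by simp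
  qed
  have expand: "v = (\<Sum>i<CARD('m). cinner (q i) v *s q i)" for v
    by (rule orthonormal_expansion) (auto simp: on)
  have sv: "singular_values A = s ` {..<CARD('m)}"
  proof (intro equalityI subsetI)
    fix t assume "t \<in> singular_values A"
    then obtain v where t: "0 \<le> t" "v \<noteq> 0" "?N *v v = complex_of_real (t\<^sup>2) *s v"
      by (auto simp: singular_values_def)
    obtain i where i: "i < CARD('m)" "cinner (q i) v \<noteq> 0"
    proof (rule ccontr)
      assume "\<not> thesis"
      then have "\<And>i. i < CARD('m) \<Longrightarrow> cinner (q i) v = 0" using that by blast
      then show False using expand[of v] t(2) by simp
    qed
    have "cnj (l i) * cinner (q i) v = cinner (?N *v q i) v" by (simp only: eig[OF i(1)] cinner_scale_left)
    also have "\<dots> = cinner (q i) (?N *v v)"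
      using cinner_ctransp[of ?N "q i" v] by (simp add: ctransp_mult)
    also have "\<dots> = of_real (t\<^sup>2) * cinner (q i) v" by (simp add: t(3) cinner_scale_right)
    finally have "cnj (l i) = of_real (t\<^sup>2)" using i(2) by simp
    then have "(s i)\<^sup>2 = t\<^sup>2" using i(1) by (simp add: l) (metis of_real_eq_iff of_real_power)
    then have "t = s i" using t(1) by (simp add: s_def)
    then show "t \<in> s ` {..<CARD('m)}" using i by auto
  next
    fix t assume "t \<in> s ` {..<CARD('m)}"
    then obtain i where i: "i < CARD('m)" "t = s i" by auto
    have "q i \<noteq> 0" using on[of i i] i by auto
    then show "t \<in> singular_values A"
      unfolding singular_values_def using eig[OF i(1)] l[OF i(1)] i(2)
      by (auto simp: s_def intro!: exI[of _ "q i"])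
  qed
  have le: "s i \<le> mnorm A" if "i < CARD('m)" for i
    unfolding mnorm_def sv by (rule Max_ge) (use that in auto)
  have "0 \<le> s 0" by (simp add: s_def)
  then show m0: "0 \<le> mnorm A" using le[of 0] by simp
  have "cinner (A *v v) (A *v v) = cinner v (?N *v v)" by (rule nn)
  also have "?N *v v = (\<Sum>i<CARD('m). cinner (q i) v *s (l i *s q i))"
    by (subst expand[of v]) (simp add: matrix_vector_mult_sum matrix_vector_mult_cscale eig)
  also have "cinner v \<dots> = (\<Sum>i<CARD('m). complex_of_real ((s i)\<^sup>2 * (cmod (cinner (q i) v))\<^sup>2))"
    unfolding cinner_sum_right
    by (intro sum.cong refl) (simp add: cinner_scale_right l complex_norm_square cinner_commute[of v] mult_ac del: of_real_power)
  finally have "(norm (A *v v))\<^sup>2 = (\<Sum>i<CARD('m). (s i)\<^sup>2 * (cmod (cinner (q i) v))\<^sup>2)"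
    by (simp only: cinner_self of_real_sum[symmetric] of_real_eq_iff)
  also have "\<dots> \<le> (\<Sum>i<CARD('m). (mnorm A)\<^sup>2 * (cmod (cinner (q i) v))\<^sup>2)"
    by (intro sum_mono mult_right_mono power_mono le) (auto simp: s_def)
  also have "\<dots> = (mnorm A)\<^sup>2 * (norm v)\<^sup>2"
  proof -
    have "(norm v)\<^sup>2 = (\<Sum>i<CARD('m). (cmod (cinner (q i) v))\<^sup>2)"
      by (subst expand[of v], rule norm_orthonormal_sum) (auto simp: on)
    then show ?thesis by (simp add: sum_distrib_left)
  qed
  finally have "(norm (A *v v))\<^sup>2 \<le> (mnorm A * norm v)\<^sup>2" by (simp only: power_mult_distrib)
  then show "norm (A *v v) \<le> mnorm A * norm v" by (rule power2_le_imp_le) (simp add: m0)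
qed

section \<open>The unitary matrix behind the two projections\<close>

lemma mscale_vector_mult: "(c *m A) *v v = c *s (A *v v)"
  by (simp add: mscale_def matrix_vector_mult_def vec_eq_iff sum_distrib_left mult_ac)

lemma perp_vector_mult: "perp T *v v = v - T *v v"
  by (simp add: perp_def matrix_vector_mult_diff_rdistrib)

lemma orth_proj_idem: "orth_proj T \<Longrightarrow> T *v (T *v v) = T *v v"
  by (metis matrix_vector_mul_assoc orth_proj_def)

lemma orth_proj_cinner: "orth_proj T \<Longrightarrow> cinner (T *v u) v = cinner u (T *v v)"
  by (metis cinner_ctransp orth_proj_def)

definition reflection :: "complex ^ 'm ^ 'm \<Rightarrow> complex ^ 'm ^ 'm"
  where "reflection T = T - perp T"

text \<open>A square root of \<open>reflection T\<close>: 1 on the range of \<open>T\<close>, \<i>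
  on its orthogonal complement.\<close>

definition half_refl :: "complex ^ 'm ^ 'm \<Rightarrow> complex ^ 'm ^ 'm"
  where "half_refl T = T + \<i> *m perp T"

abbreviation phase :: "real \<Rightarrow> complex"
  where "phase x \<equiv> exp (2 * of_real pi * \<i> * of_real x)"

text \<open>Unitary. With \<open>z = exp (\<i>\<pi>\<rho>)\<close>, the kernel of \<open>W0 T1 T2 \<rho>\<close> is the eigenspace of this
  matrix for the eigenvalue \<open>z\<^sup>2\<close>.\<close>

definition monodromy :: "complex ^ 'm ^ 'm \<Rightarrow> complex ^ 'm ^ 'm \<Rightarrow> complex ^ 'm ^ 'm"
  where "monodromy T1 T2 = half_refl T1 ** reflection T2 ** half_refl T1"

text \<open>The matrix \<open>L\<close> of the overview: the coefficient of \<open>z\<close> in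
  \<open>W0\<close> once sine and cosine are expressed through \<open>z\<close>. Its right factor is
  the inverse of \<open>half_refl T1\<close>.\<close>

definition W0_factor :: "complex ^ 'm ^ 'm \<Rightarrow> complex ^ 'm ^ 'm \<Rightarrow> complex ^ 'm ^ 'm"
  where "W0_factor T1 T2 = (1/2) *m (perp T2 - \<i> *m T2) ** (T1 - \<i> *m perp T1)"

lemma reflection_mv: "reflection T *v v = 2 *s (T *v v) - v"
  by (simp add: reflection_def matrix_vector_mult_diff_rdistrib perp_vector_mult vec_eq_iff)

lemma half_refl_mv: "half_refl T *v v = T *v v + \<i> *s (v - T *v v)"
  by (simp add: half_refl_def matrix_vector_mult_add_rdistrib mscale_vector_mult perp_vector_mult)

lemma monodromy_mv: "monodromy T1 T2 *v v = half_refl T1 *v (reflection T2 *v (half_refl T1 *v v))"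
  by (simp add: monodromy_def flip: matrix_vector_mul_assoc)

lemmas matrix_vector_simps = matrix_vector_mult_add_rdistrib matrix_vector_mult_diff_rdistrib
  mscale_vector_mult perp_vector_mult matrix_vector_right_distrib matrix_vector_mult_diff_distrib
  matrix_vector_mult_cscale matrix_vector_mul_assoc[symmetric]

lemmas cinner_simps = cinner_add_left cinner_add_right cinner_diff_left cinner_diff_right
  cinner_scale_left cinner_scale_right

lemma reflection_reflection: "orth_proj T \<Longrightarrow> reflection T *v (reflection T *v v) = v"
  by (simp only: reflection_mv matrix_vector_simps orth_proj_idem) (simp add: vec_eq_iff)

lemma half_refl_twice: "orth_proj T \<Longrightarrow> half_refl T *v (half_refl T *v v) = reflection T *v v"
  by (simp only: reflection_mv half_refl_mv matrix_vector_simps orth_proj_idem) (simp add: vec_eq_iff algebra_simps)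

lemma half_refl_reflection: "orth_proj T \<Longrightarrow> half_refl T *v (reflection T *v (half_refl T *v v)) = v"
  by (simp only: reflection_mv half_refl_mv matrix_vector_simps orth_proj_idem) (simp add: vec_eq_iff algebra_simps)

lemma half_refl_inverse:
  "orth_proj T \<Longrightarrow> (T - \<i> *m perp T) *v (half_refl T *v v) = v"
  "orth_proj T \<Longrightarrow> half_refl T *v ((T - \<i> *m perp T) *v v) = v"
  by (simp_all only: half_refl_mv matrix_vector_simps orth_proj_idem) (simp_all add: vec_eq_iff algebra_simps)

lemma cinner_reflection: "orth_proj T \<Longrightarrow> cinner (reflection T *v u) (reflection T *v v) = cinner u v"
  by (simp only: reflection_mv cinner_simps orth_proj_cinner orth_proj_idem) (simp add: algebra_simps)

lemma cinner_half_refl: "orth_proj T \<Longrightarrow> cinner (half_refl T *v u) (half_refl T *v v) = cinner u v"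
  by (simp only: half_refl_mv cinner_simps orth_proj_cinner orth_proj_idem) (simp add: algebra_simps)

context
  fixes T1 T2 :: "complex^'m^'m"
  assumes T1: "orth_proj T1" and T2: "orth_proj T2"
begin

lemma cinner_monodromy: "cinner (monodromy T1 T2 *v u) (monodromy T1 T2 *v v) = cinner u v"
  by (simp add: monodromy_mv cinner_half_refl[OF T1] cinner_reflection[OF T2])

text \<open>\<open>reflection T1\<close> conjugates the monodromy to its inverse, because
  \<open>half_refl T1 ** reflection T1 ** half_refl T1\<close> is the identity. It therefore
  exchanges the eigenspaces of conjugate eigenvalues, which disposes of the terms with
  \<open>a + b\<close> in the inner products of modes.\<close>

lemma monodromy_reflection_monodromy: "monodromy T1 T2 *v (reflection T1 *v (monodromy T1 T2 *v v)) = reflection T1 *v v"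
  by (simp add: monodromy_mv half_refl_reflection[OF T1] reflection_reflection[OF T2] half_refl_twice[OF T1])

lemma monodromy_normal:
  "monodromy T1 T2 ** ctransp (monodromy T1 T2) = ctransp (monodromy T1 T2) ** monodromy T1 T2"
proof -
  have "ctransp (monodromy T1 T2) ** monodromy T1 T2 = mat 1"
  proof (subst matrix_eq, rule allI)
    fix v
    have "cinner u (ctransp (monodromy T1 T2) *v (monodromy T1 T2 *v v) - v) = 0" for u
      by (simp add: cinner_diff_right cinner_ctransp' cinner_monodromy)
    then have "ctransp (monodromy T1 T2) *v (monodromy T1 T2 *v v) - v = 0"
      using cinner_self_eq_0_iff by blast
    then show "(ctransp (monodromy T1 T2) ** monodromy T1 T2) *v v = mat 1 *v v"
      by (simp flip: matrix_vector_mul_assoc)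
  qed
  then show ?thesis using matrix_left_right_inverse[of "ctransp (monodromy T1 T2)" "monodromy T1 T2"] by simp
qed

lemma W0_factor_mv:
  "W0_factor T1 T2 *v v = (1/2) *s ((perp T2 - \<i> *m T2) *v ((T1 - \<i> *m perp T1) *v v))"
  by (simp only: W0_factor_def mscale_vector_mult matrix_vector_mul_assoc[symmetric])

text \<open>The right-hand side is minus the coefficient of \<open>1/z\<close> in \<open>W0\<close>,
  which is how the monodromy enters the factorisation.\<close>

lemma W0_factor_monodromy:
  "W0_factor T1 T2 *v (monodromy T1 T2 *v v) = - (1/2) *s ((perp T2 + \<i> *m T2) *v (half_refl T1 *v v))"
  unfolding W0_factor_mv monodromy_mv half_refl_inverse[OF T1]
  by (simp only: matrix_vector_simps reflection_mv orth_proj_idem[OF T2]) (simp add: vec_eq_iff algebra_simps)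

lemma W0_U0_mv:
  assumes z: "z = exp (\<i> * of_real pi * \<rho>)"
  shows "W0 T1 T2 \<rho> *v v = W0_factor T1 T2 *v (z *s v - (1/z) *s (monodromy T1 T2 *v v))"
    and "U0 T1 T2 \<rho> *v v = W0_factor T1 T2 *v (\<i> *s (z *s v + (1/z) *s (monodromy T1 T2 *v v)))"
proof -
  have s: "sin (\<rho> * of_real pi) = (z - 1/z) / (2 * \<i>)" and c: "cos (\<rho> * of_real pi) = (z + 1/z) / 2"
    by (simp_all add: sin_exp_eq cos_exp_eq z exp_minus field_simps)
  have z0: "z \<noteq> 0" by (simp add: z)
  show "W0 T1 T2 \<rho> *v v = W0_factor T1 T2 *v (z *s v - (1/z) *s (monodromy T1 T2 *v v))"
    unfolding W0_def s c matrix_vector_mult_diff_distrib matrix_vector_mult_cscale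
      W0_factor_monodromy unfolding W0_factor_mv half_refl_mv
    by (simp only: matrix_vector_simps) (simp add: vec_eq_iff field_simps z0)
  show "U0 T1 T2 \<rho> *v v = W0_factor T1 T2 *v (\<i> *s (z *s v + (1/z) *s (monodromy T1 T2 *v v)))"
    unfolding U0_def s c matrix_vector_right_distrib matrix_vector_mult_cscale
      W0_factor_monodromy unfolding W0_factor_mv half_refl_mv
    by (simp only: matrix_vector_simps) (simp add: vec_eq_iff field_simps z0)
qed

lemma det_W0_factor: "det (W0_factor T1 T2) \<noteq> 0"
proof -
  have *: "(perp T2 + \<i> *m T2) *v ((perp T2 - \<i> *m T2) *v v) = v" for v
    by (simp only: matrix_vector_simps orth_proj_idem[OF T2]) (simp add: vec_eq_iff algebra_simps)
  have "(2 *m (half_refl T1 ** (perp T2 + \<i> *m T2))) ** W0_factor T1 T2 = mat 1"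
  proof (subst matrix_eq, rule allI)
    fix v
    have "((2 *m (half_refl T1 ** (perp T2 + \<i> *m T2))) ** W0_factor T1 T2) *v v =
        2 *s (half_refl T1 *v ((perp T2 + \<i> *m T2) *v (W0_factor T1 T2 *v v)))"
      by (simp only: mscale_vector_mult matrix_vector_mul_assoc[symmetric])
    also have "\<dots> = v"
      unfolding W0_factor_mv matrix_vector_mult_cscale * half_refl_inverse[OF T1] by simp
    finally show "((2 *m (half_refl T1 ** (perp T2 + \<i> *m T2))) ** W0_factor T1 T2) *v v = mat 1 *v v"
      by simp
  qed
  then have "invertible (W0_factor T1 T2)" by (metis invertible_left_inverse)
  then show ?thesis by (simp add: invertible_det_nz)
qed

text \<open>At \<open>\<rho> = 0\<close> a fixed vector lies in the kernel of \<open>W0\<close>, and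
  applying \<open>T2\<close> separates the two terms of that equation. So \<open>v\<close> splits
  into \<open>T1 *v v\<close>, fixed by both projections, and \<open>v - T1 *v v\<close>,
  annihilated by both.\<close>

lemma monodromy_fixed:
  assumes "monodromy T1 T2 *v v = v"
  shows "T2 *v (v - T1 *v v) = 0" "T2 *v (T1 *v v) = T1 *v v"
proof -
  have "W0 T1 T2 0 *v v = 0" using W0_U0_mv(1)[of 1 0 v] by (simp add: assms)
  then have 1: "T1 *v v - T2 *v (T1 *v v) - T2 *v (v - T1 *v v) = 0"
    by (simp add: W0_def matrix_vector_simps vec_eq_iff)
  have "T2 *v (T1 *v v - T2 *v (T1 *v v) - T2 *v (v - T1 *v v)) = - (T2 *v (v - T1 *v v))"
    by (simp add: matrix_vector_simps orth_proj_idem T2)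
  then show "T2 *v (v - T1 *v v) = 0" using 1 by simp
  then show "T2 *v (T1 *v v) = T1 *v v" using 1 by simp
qed

end

section \<open>Zeros and residues\<close>

text \<open>Up to a nonvanishing constant and the invertible \<open>W0_factor\<close>, the scalar by
  which \<open>W0\<close> acts on an eigenvector of the monodromy with eigenvalue
  \<open>phase \<theta>\<close>.\<close>

definition shifted_sin :: "real \<Rightarrow> complex \<Rightarrow> complex"
  where "shifted_sin \<theta> w = sin (of_real pi * (w - of_real \<theta>))"

definition shifted_cos :: "real \<Rightarrow> complex \<Rightarrow> complex"
  where "shifted_cos \<theta> w = cos (of_real pi * (w - of_real \<theta>))"

lemma shifted_sin_holomorphic [holomorphic_intros]: "shifted_sin \<theta> holomorphic_on S"
  and shifted_cos_holomorphic [holomorphic_intros]: "shifted_cos \<theta> holomorphic_on S"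
  unfolding shifted_sin_def shifted_cos_def by (intro holomorphic_intros)+

lemma shifted_sin_analytic: "shifted_sin \<theta> analytic_on S"
  unfolding shifted_sin_def by (intro analytic_intros)

lemma shifted_sin_eq_0:
  assumes "0 \<le> \<theta>" "\<theta> < 1" "0 \<le> x" "x < 1"
  shows "shifted_sin \<theta> (of_real x) = 0 \<longleftrightarrow> x = \<theta>"
proof
  assume "shifted_sin \<theta> (of_real x) = 0"
  then have "complex_of_real (sin (pi * (x - \<theta>))) = 0"
    unfolding sin_of_real[symmetric] by (simp add: shifted_sin_def)
  then obtain n :: int where "pi * (x - \<theta>) = of_int n * pi" by (auto simp: sin_zero_iff_int2)
  then have "x - \<theta> = of_int n" by simp
  moreover from this have "n = 0" using assms by linarith
  ultimately show "x = \<theta>" by simp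
qed (simp add: shifted_sin_def)

text \<open>The zeros of an entire function that is not identically zero are isolated; at
  \<open>\<theta> + 1/2\<close> the value is 1.\<close>

lemma eventually_shifted_sin_nonzero: "\<forall>\<^sub>F w in at z. shifted_sin \<theta> w \<noteq> 0"
proof -
  have "complex_of_real pi * (of_real (\<theta> + 1/2) - of_real \<theta>) = of_real (pi / 2)" by simp
  then have "shifted_sin \<theta> (of_real (\<theta> + 1/2)) = of_real (sin (pi / 2))"
    unfolding shifted_sin_def sin_of_real[symmetric] by simp
  then have "shifted_sin \<theta> (of_real (\<theta> + 1/2)) \<noteq> 0" by simp
  then have "\<forall>\<^sub>F w in at z. shifted_sin \<theta> w \<noteq> 0 \<and> w \<in> UNIV"
    by (intro non_zero_neighbour_alt shifted_sin_holomorphic) auto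
  then show ?thesis by simp
qed

lemma shifted_sin_deriv: "(shifted_sin \<theta> has_field_derivative of_real pi * shifted_cos \<theta> w) (at w)"
  unfolding shifted_sin_def shifted_cos_def by (auto intro!: derivative_eq_intros)

lemma zorder_shifted_sin:
  assumes "0 \<le> \<theta>" "\<theta> < 1" "0 \<le> x" "x < 1"
  shows "zorder (shifted_sin \<theta>) (of_real x) = (if x = \<theta> then 1 else 0)"
proof (cases "x = \<theta>")
  case True
  have "zorder (shifted_sin \<theta>) (of_real \<theta>) = 1"
  proof (rule zorder_zero_eqI[of _ UNIV])
    show "(deriv ^^ nat 1) (shifted_sin \<theta>) (complex_of_real \<theta>) \<noteq> 0"
      using DERIV_imp_deriv[OF shifted_sin_deriv, of \<theta> "of_real \<theta>"] by (simp add: shifted_cos_def)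
  qed (auto simp: shifted_sin_holomorphic shifted_sin_def)
  then show ?thesis using True by simp
next
  case False
  then show ?thesis
    using shifted_sin_eq_0[OF assms]
    by (auto intro!: zorder_eq_0I shifted_sin_analytic)
qed

text \<open>The cotangent has simple poles with residue \<open>1 / pi\<close>, which the factor pi
  in \<open>resA\<close> cancels. Points that are not zeros of the sine are included, so that sums
  of such terms can be treated at once.\<close>

lemma tendsto_shifted_cot:
  "((\<lambda>w. shifted_cos \<theta> w / shifted_sin \<theta> w * (w - of_real x)) \<longlongrightarrow>
     (if shifted_sin \<theta> (of_real x) = 0 then 1 / of_real pi else 0)) (at (of_real x))"
proof -
  have c: "(f \<longlongrightarrow> f (of_real x)) (at (of_real x))" if "f holomorphic_on UNIV" for f :: "complex \<Rightarrow> complex"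
    using holomorphic_on_imp_continuous_on[OF that] by (simp add: continuous_on_def)
  note cs = c[OF shifted_cos_holomorphic, of \<theta>] c[OF shifted_sin_holomorphic, of \<theta>]
  show ?thesis
  proof (cases "shifted_sin \<theta> (of_real x) = 0")
    case True
    have cnz: "shifted_cos \<theta> (of_real x) \<noteq> 0"
    proof
      assume "shifted_cos \<theta> (of_real x) = 0"
      then have "(sin (of_real pi * (complex_of_real x - of_real \<theta>)))\<^sup>2
          + (cos (of_real pi * (complex_of_real x - of_real \<theta>)))\<^sup>2 = 0"
        using True unfolding shifted_sin_def shifted_cos_def by (simp only:) simp
      then show False by simp
    qed
    have "((\<lambda>w. (shifted_sin \<theta> w - shifted_sin \<theta> (of_real x)) / (w - of_real x)) \<longlongrightarrow>
        of_real pi * shifted_cos \<theta> (of_real x)) (at (of_real x))"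
      using shifted_sin_deriv by (simp add: has_field_derivative_iff)
    then have "((\<lambda>w. shifted_cos \<theta> w / (shifted_sin \<theta> w / (w - of_real x))) \<longlongrightarrow>
        shifted_cos \<theta> (of_real x) / (of_real pi * shifted_cos \<theta> (of_real x))) (at (of_real x))"
      using True cnz by (intro tendsto_divide cs) auto
    then show ?thesis using True cnz by simp
  next
    case False
    have "((\<lambda>w. shifted_cos \<theta> w / shifted_sin \<theta> w * (w - of_real x)) \<longlongrightarrow>
      shifted_cos \<theta> (of_real x) / shifted_sin \<theta> (of_real x) * (of_real x - of_real x)) (at (of_real x))"
      by (intro tendsto_intros cs False)
    then show ?thesis using False by simp
  qed
qed

lemma matrix_inv_left: "invertible A \<Longrightarrow> matrix_inv A ** A = mat 1"
  unfolding invertible_def matrix_inv_def by (rule someI2_ex) auto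

lemma matrix_vector_mult_axis: "(A *v axis j 1) $ i = A $ i $ j" for A :: "complex^'n^'m"
  by (simp add: matrix_vector_mult_def axis_def if_distrib[of "\<lambda>x. _ * x"] cong: if_cong)

section \<open>Zeros and residues in an orthonormal eigenbasis of the monodromy\<close>

context
  fixes T1 T2 :: "complex^'m^'m" and q :: "nat \<Rightarrow> complex^'m" and \<theta> :: "nat \<Rightarrow> real"
  assumes T1: "orth_proj T1" and T2: "orth_proj T2"
    and on: "\<And>i j. i < CARD('m) \<Longrightarrow> j < CARD('m) \<Longrightarrow> cinner (q i) (q j) = (if i = j then 1 else 0)"
    and eig: "\<And>i. i < CARD('m) \<Longrightarrow> monodromy T1 T2 *v q i = phase (\<theta> i) *s q i"
    and \<theta>: "\<And>i. i < CARD('m) \<Longrightarrow> 0 \<le> \<theta> i" "\<And>i. i < CARD('m) \<Longrightarrow> \<theta> i < 1"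
begin

lemma eigenbasis_expansion: "v = (\<Sum>i<CARD('m). cinner (q i) v *s q i)"
  by (rule orthonormal_expansion) (auto simp: on)

text \<open>With \<open>y = exp (\<i> * pi * \<theta> i)\<close> the eigenvalue is
  \<open>y * y\<close>, and \<open>z - y * y / z\<close> is \<open>y\<close> times the difference of
  \<open>z / y\<close> and its inverse, that is, a sine; the sum gives the cosine.\<close>

lemma W0_eigenvector:
  assumes i: "i < CARD('m)"
  shows "W0 T1 T2 \<rho> *v q i =
      W0_factor T1 T2 *v ((2 * \<i> * exp (\<i> * of_real pi * of_real (\<theta> i)) * shifted_sin (\<theta> i) \<rho>) *s q i)"
    and "U0 T1 T2 \<rho> *v q i =
      W0_factor T1 T2 *v ((2 * \<i> * exp (\<i> * of_real pi * of_real (\<theta> i)) * shifted_cos (\<theta> i) \<rho>) *s q i)"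
proof -
  define t where "t = \<i> * of_real pi * of_real (\<theta> i)"
  define z where "z = exp (\<i> * of_real pi * \<rho>)"
  define y where "y = exp t"
  have y0: "y \<noteq> 0" "z \<noteq> 0" by (simp_all add: y_def z_def)
  have l: "phase (\<theta> i) = y * y"
    unfolding y_def t_def exp_add[symmetric] by (simp add: algebra_simps)
  have e: "exp (\<i> * (of_real pi * (\<rho> - of_real (\<theta> i)))) = z / y"
    unfolding z_def y_def t_def exp_diff[symmetric] by (simp add: algebra_simps)
  have e': "exp (- (\<i> * (of_real pi * (\<rho> - of_real (\<theta> i))))) = y / z"
    unfolding exp_minus e by simp
  have s: "2 * \<i> * y * shifted_sin (\<theta> i) \<rho> = z - y * y / z" "2 * y * shifted_cos (\<theta> i) \<rho> = z + y * y / z"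
    unfolding shifted_sin_def shifted_cos_def sin_exp_eq cos_exp_eq e e'
    using y0 by (simp_all add: field_simps)
  show "W0 T1 T2 \<rho> *v q i =
      W0_factor T1 T2 *v ((2 * \<i> * exp (\<i> * of_real pi * of_real (\<theta> i)) * shifted_sin (\<theta> i) \<rho>) *s q i)"
    unfolding W0_U0_mv(1)[OF T1 T2 z_def] eig[OF i] l t_def[symmetric] y_def[symmetric] s
    by (simp add: vec.scale_left_diff_distrib)
  have "\<i> *s (z *s q i + (1/z) *s ((y * y) *s q i)) = (\<i> * (z + y * y / z)) *s q i"
    by (simp add: vec_eq_iff algebra_simps)
  then show "U0 T1 T2 \<rho> *v q i =
      W0_factor T1 T2 *v ((2 * \<i> * exp (\<i> * of_real pi * of_real (\<theta> i)) * shifted_cos (\<theta> i) \<rho>) *s q i)"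
    unfolding W0_U0_mv(2)[OF T1 T2 z_def] eig[OF i] l t_def[symmetric] y_def[symmetric] s(2)[symmetric]
    by (simp add: mult_ac)
qed

text \<open>In the eigenbasis \<open>Q\<close> the factorisation becomes
  \<open>W0 T1 T2 \<rho> ** Q = W0_factor T1 T2 ** Q ** D \<rho>\<close> with diagonal
  \<open>D\<close>, and determinants multiply.\<close>

lemma det_W0: "\<exists>C. C \<noteq> 0 \<and> (\<forall>\<rho>. det (W0 T1 T2 \<rho>) = C * (\<Prod>i<CARD('m). shifted_sin (\<theta> i) \<rho>))"
proof -
  \<comment> \<open>Eigenvectors are numbered by naturals, the columns of a matrix by the type
    \<open>'m\<close>; \<open>\<beta>\<close> translates.\<close>
  obtain \<beta> where \<beta>: "bij_betw \<beta> (UNIV :: 'm set) {..<CARD('m)}"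
    using ex_bij_betw_finite_nat[of "UNIV :: 'm set"] by (auto simp: atLeast0LessThan)
  have \<beta>lt: "\<beta> j < CARD('m)" for j using bij_betwE[OF \<beta>] by auto
  define Q :: "complex^'m^'m" where "Q = (\<chi> i j. q (\<beta> j) $ i)"
  have Qcol: "Q *v axis j 1 = q (\<beta> j)" for j
    by (simp add: matrix_vector_mult_axis Q_def vec_eq_iff)
  have "ctransp Q ** Q = mat 1"
    using on[OF \<beta>lt \<beta>lt] bij_betw_imp_inj_on[OF \<beta>]
    by (simp add: vec_eq_iff matrix_matrix_mult_def ctransp_def Q_def mat_def inj_on_eq_iff flip: cinner_def)
  then have "invertible Q" by (metis invertible_left_inverse)
  then have Q0: "det Q \<noteq> 0" by (simp add: invertible_det_nz)
  define c where "c j = 2 * \<i> * exp (\<i> * of_real pi * of_real (\<theta> (\<beta> j)))" for j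
  define D :: "complex \<Rightarrow> complex^'m^'m"
    where "D \<rho> = (\<chi> i j. if i = j then c j * shifted_sin (\<theta> (\<beta> j)) \<rho> else 0)" for \<rho>
  have "W0 T1 T2 \<rho> ** Q = W0_factor T1 T2 ** Q ** D \<rho>" for \<rho>
  proof -
    have Dcol: "D \<rho> *v axis j 1 = (c j * shifted_sin (\<theta> (\<beta> j)) \<rho>) *s axis j 1" for j
      by (simp add: matrix_vector_mult_axis D_def vec_eq_iff) (auto simp: axis_def)
    have "(W0 T1 T2 \<rho> ** Q) *v axis j 1 = (W0_factor T1 T2 ** Q ** D \<rho>) *v axis j 1" for j
      by (simp only: matrix_vector_mul_assoc[symmetric] Qcol Dcol matrix_vector_mult_cscale
          W0_eigenvector(1)[OF \<beta>lt] c_def)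
    then show ?thesis
      by (metis matrix_vector_mult_axis vec_eq_iff)
  qed
  then have "det (W0 T1 T2 \<rho>) * det Q = det (W0_factor T1 T2) * det Q * det (D \<rho>)" for \<rho>
    by (metis det_mul)
  then have 1: "det (W0 T1 T2 \<rho>) = det (W0_factor T1 T2) * det (D \<rho>)" for \<rho>
    using Q0 by (simp add: mult.commute mult.left_commute)
  have "det (W0 T1 T2 \<rho>) =
      (det (W0_factor T1 T2) * (\<Prod>j\<in>UNIV. c j)) * (\<Prod>i<CARD('m). shifted_sin (\<theta> i) \<rho>)" for \<rho>
  proof -
    have "det (D \<rho>) = (\<Prod>j\<in>UNIV. c j * shifted_sin (\<theta> (\<beta> j)) \<rho>)"
      by (subst det_diagonal) (auto simp: D_def)
    also have "\<dots> = (\<Prod>j\<in>UNIV. c j) * (\<Prod>i<CARD('m). shifted_sin (\<theta> i) \<rho>)"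
      using prod.reindex_bij_betw[OF \<beta>, of "\<lambda>i. shifted_sin (\<theta> i) \<rho>"] by (simp add: prod.distrib)
    finally show ?thesis by (simp add: 1)
  qed
  moreover have "det (W0_factor T1 T2) * (\<Prod>j\<in>UNIV. c j) \<noteq> 0"
    using det_W0_factor[OF T1 T2] by (simp add: c_def)
  ultimately show ?thesis by blast
qed

text \<open>Orders of zeros add over products, and every factor has only simple zeros, so the
  multiplicity of \<open>x\<close> counts the \<open>i\<close> with
  \<open>\<theta> i = x\<close>.\<close>

lemma zeros_mset_eq: "zeros_mset T1 T2 = image_mset \<theta> (mset_set {..<CARD('m)})"
proof (rule multiset_eqI)
  fix x
  obtain C where C: "C \<noteq> 0" "\<And>\<rho>. det (W0 T1 T2 \<rho>) = C * (\<Prod>i<CARD('m). shifted_sin (\<theta> i) \<rho>)"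
    using det_W0 by blast
  have X: "{x. 0 \<le> x \<and> x < 1 \<and> det (W0 T1 T2 (of_real x)) = 0} = \<theta> ` {..<CARD('m)}"
    using \<theta> by (auto simp: C shifted_sin_eq_0)
  have z: "nat (zorder (\<lambda>\<rho>. det (W0 T1 T2 \<rho>)) (of_real x)) = card {i. i < CARD('m) \<and> \<theta> i = x}"
    if x: "x \<in> \<theta> ` {..<CARD('m)}" for x
  proof -
    have x01: "0 \<le> x" "x < 1" using x \<theta> by auto
    have "zorder (\<lambda>\<rho>. det (W0 T1 T2 \<rho>)) (of_real x) = zorder (\<lambda>\<rho>. \<Prod>i<CARD('m). shifted_sin (\<theta> i) \<rho>) (of_real x)"
      unfolding C(2) by (rule zorder_cmult[OF C(1)])
    also have "\<dots> = (\<Sum>i<CARD('m). zorder (shifted_sin (\<theta> i)) (of_real x))"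
    proof (rule zorder_prod_analytic)
      show "shifted_sin (\<theta> i) analytic_on {complex_of_real x}" for i
        by (rule shifted_sin_analytic)
      have "\<forall>\<^sub>F w in at (complex_of_real x). \<forall>i\<in>{..<CARD('m)}. shifted_sin (\<theta> i) w \<noteq> 0"
        by (intro eventually_ball_finite ballI eventually_shifted_sin_nonzero) auto
      then show "\<forall>\<^sub>F w in at (complex_of_real x). (\<Prod>i<CARD('m). shifted_sin (\<theta> i) w) \<noteq> 0"
        by eventually_elim auto
    qed
    also have "\<dots> = (\<Sum>i<CARD('m). if \<theta> i = x then 1 else 0)"
      by (intro sum.cong refl) (use \<theta> x01 in \<open>auto simp: zorder_shifted_sin\<close>)
    also have "\<dots> = int (card {i. i < CARD('m) \<and> \<theta> i = x})"
      by (simp add: sum.If_cases Int_def lessThan_def)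
    finally show ?thesis by simp
  qed
  have "count (zeros_mset T1 T2) x =
      (\<Sum>y\<in>\<theta> ` {..<CARD('m)}. if x = y then card {i. i < CARD('m) \<and> \<theta> i = y} else 0)"
    unfolding zeros_mset_def X count_sum by (intro sum.cong refl) (auto simp: z)
  also have "\<dots> = (if x \<in> \<theta> ` {..<CARD('m)} then card {i. i < CARD('m) \<and> \<theta> i = x} else 0)" by simp
  also have "\<dots> = card {i. i < CARD('m) \<and> \<theta> i = x}" by (auto intro: card_eq_0_iff[THEN iffD2, symmetric])
  also have "\<dots> = count (image_mset \<theta> (mset_set {..<CARD('m)})) x"
    by (simp add: count_image_mset_eq_card_vimage)
  finally show "count (zeros_mset T1 T2) x = count (image_mset \<theta> (mset_set {..<CARD('m)})) x" .
qed

lemma E0_entry: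
  assumes nz: "\<forall>a<CARD('m). shifted_sin (\<theta> a) \<rho> \<noteq> 0"
  shows "E0 T1 T2 \<rho> $ i $ j = (\<Sum>a<CARD('m). shifted_cos (\<theta> a) \<rho> / shifted_sin (\<theta> a) \<rho> * (q a $ i * cnj (q a $ j)))"
proof -
  define X where "X v = (\<Sum>a<CARD('m). (shifted_cos (\<theta> a) \<rho> / shifted_sin (\<theta> a) \<rho> * cinner (q a) v) *s q a)" for v
  have "W0 T1 T2 \<rho> *v X v = U0 T1 T2 \<rho> *v v" for v
  proof -
    have "U0 T1 T2 \<rho> *v v = (\<Sum>a<CARD('m). cinner (q a) v *s (U0 T1 T2 \<rho> *v q a))"
      by (subst eigenbasis_expansion[of v]) (simp only: matrix_vector_mult_sum matrix_vector_mult_cscale)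
    also have "\<dots> = (\<Sum>a<CARD('m). (shifted_cos (\<theta> a) \<rho> / shifted_sin (\<theta> a) \<rho> * cinner (q a) v) *s (W0 T1 T2 \<rho> *v q a))"
      by (intro sum.cong refl)
        (use nz in \<open>simp add: W0_eigenvector matrix_vector_mult_cscale\<close>)
    also have "\<dots> = W0 T1 T2 \<rho> *v X v"
      by (simp only: X_def matrix_vector_mult_sum matrix_vector_mult_cscale)
    finally show ?thesis by simp
  qed
  moreover have "invertible (W0 T1 T2 \<rho>)"
    using det_W0 nz by (auto simp: invertible_det_nz)
  ultimately have E: "E0 T1 T2 \<rho> *v v = X v" for v
    by (metis E0_def matrix_inv_left matrix_vector_mul_assoc matrix_vector_mul_lid)
  have "E0 T1 T2 \<rho> $ i $ j = X (axis j 1) $ i"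
    unfolding E[symmetric] by (simp add: matrix_vector_mult_axis)
  also have "cinner u (axis j 1) = cnj (u $ j)" for u :: "complex^'m"
    by (simp add: cinner_def axis_def if_distrib[of "\<lambda>x. _ * x"] cong: if_cong)
  then have "X (axis j 1) $ i = (\<Sum>a<CARD('m). shifted_cos (\<theta> a) \<rho> / shifted_sin (\<theta> a) \<rho> * (q a $ i * cnj (q a $ j)))"
    by (simp add: X_def mult_ac)
  finally show ?thesis .
qed

text \<open>All poles are at most simple, so the residue is the limit after multiplication by
  \<open>w - x\<close>; if no \<open>\<theta> a\<close> equals \<open>x\<close>, the sum is empty
  and the residue 0.\<close>

lemma residue_E0:
  assumes x: "0 \<le> x" "x < 1"
  shows "residue (\<lambda>\<rho>. E0 T1 T2 \<rho> $ i $ j) (of_real x) =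
    (\<Sum>a | a < CARD('m) \<and> \<theta> a = x. q a $ i * cnj (q a $ j)) / of_real pi"
proof -
  let ?g = "\<lambda>w. \<Sum>a<CARD('m). shifted_cos (\<theta> a) w / shifted_sin (\<theta> a) w * (q a $ i * cnj (q a $ j))"
  have ev: "\<forall>\<^sub>F w in at (complex_of_real x). \<forall>a\<in>{..<CARD('m)}. shifted_sin (\<theta> a) w \<noteq> 0"
    by (intro eventually_ball_finite ballI eventually_shifted_sin_nonzero) auto
  have "residue (\<lambda>\<rho>. E0 T1 T2 \<rho> $ i $ j) (of_real x) = residue ?g (of_real x)"
    by (rule residue_cong[OF _ refl], use ev in eventually_elim) (rule E0_entry, blast)
  also have "\<dots> = (\<Sum>a | a < CARD('m) \<and> \<theta> a = x. q a $ i * cnj (q a $ j)) / of_real pi"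
  proof -
    obtain \<epsilon> where \<epsilon>: "\<epsilon> > 0" "\<And>w a. w \<noteq> of_real x \<Longrightarrow> dist w (of_real x) < \<epsilon> \<Longrightarrow> a < CARD('m) \<Longrightarrow> shifted_sin (\<theta> a) w \<noteq> 0"
      using ev unfolding eventually_at by auto
    show ?thesis
    proof (rule residue_simple'[of "ball (of_real x) \<epsilon>"])
      show "?g holomorphic_on ball (complex_of_real x) \<epsilon> - {complex_of_real x}"
        by (intro holomorphic_intros) (use \<epsilon>(2) in \<open>auto simp: dist_commute\<close>)
      have "((\<lambda>w. \<Sum>a<CARD('m). shifted_cos (\<theta> a) w / shifted_sin (\<theta> a) w * (w - of_real x) * (q a $ i * cnj (q a $ j)))
         \<longlongrightarrow> (\<Sum>a<CARD('m). (if shifted_sin (\<theta> a) (of_real x) = 0 then 1 / of_real pi else 0) * (q a $ i * cnj (q a $ j))))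
         (at (of_real x))"
        by (intro tendsto_sum tendsto_mult_right tendsto_shifted_cot)
      also have "(\<Sum>a<CARD('m). (if shifted_sin (\<theta> a) (of_real x) = 0 then 1 / of_real pi else 0) * (q a $ i * cnj (q a $ j)))
          = (\<Sum>a<CARD('m). if \<theta> a = x then (q a $ i * cnj (q a $ j)) / of_real pi else 0)"
        by (intro sum.cong refl) (use \<theta> x in \<open>auto simp: shifted_sin_eq_0\<close>)
      also have "\<dots> = (\<Sum>a | a < CARD('m) \<and> \<theta> a = x. q a $ i * cnj (q a $ j)) / of_real pi"
        by (simp add: sum.If_cases Int_def lessThan_def sum_divide_distrib)
      also have "(\<lambda>w. \<Sum>a<CARD('m). shifted_cos (\<theta> a) w / shifted_sin (\<theta> a) w * (w - of_real x) * (q a $ i * cnj (q a $ j)))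
          = (\<lambda>w. ?g w * (w - of_real x))"
        unfolding sum_distrib_right by (intro ext sum.cong refl) (simp add: mult_ac)
      finally show "((\<lambda>w. ?g w * (w - of_real x)) \<longlongrightarrow>
          (\<Sum>a | a < CARD('m) \<and> \<theta> a = x. q a $ i * cnj (q a $ j)) / of_real pi) (at (of_real x))" .
    qed (use \<epsilon>(1) in auto)
  qed
  finally show ?thesis .
qed

lemma zero_r_permutation:
  "\<exists>p. bij_betw p {1..CARD('m)} {..<CARD('m)} \<and> (\<forall>k\<in>{1..CARD('m)}. zero_r T1 T2 k = \<theta> (p k))"
proof -
  let ?L = "sorted_list_of_multiset (zeros_mset T1 T2)"
  have "mset ?L = mset (map \<theta> [0..<CARD('m)])"
    by (simp add: zeros_mset_eq flip: mset_set_upto_eq_mset_upto atLeast0LessThan)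
  then obtain \<pi> where \<pi>: "bij_betw \<pi> {..<length ?L} {..<CARD('m)}" "\<forall>i<length ?L. ?L ! i = map \<theta> [0..<CARD('m)] ! \<pi> i"
    using permutation_Ex_bij[of ?L "map \<theta> [0..<CARD('m)]"] by auto
  have len: "length ?L = CARD('m)" using bij_betw_same_card[OF \<pi>(1)] by simp
  \<comment> \<open>Zeros are counted from 1, list positions from 0.\<close>
  have b: "bij_betw (\<lambda>k. k - 1) {1..CARD('m)} {..<CARD('m)}"
    by (rule bij_betw_byWitness[of _ Suc]) auto
  show ?thesis
  proof (intro exI[of _ "\<lambda>k. \<pi> (k - 1)"] conjI ballI)
    show "bij_betw (\<lambda>k. \<pi> (k - 1)) {1..CARD('m)} {..<CARD('m)}"
      using bij_betw_trans[OF b \<pi>(1)[unfolded len]] by (simp add: o_def)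
    fix k assume k: "k \<in> {1..CARD('m)}"
    then have k': "k - 1 < length ?L" using len by auto
    then have "\<pi> (k - 1) < CARD('m)" using bij_betwE[OF \<pi>(1)] by auto
    then show "zero_r T1 T2 k = \<theta> (\<pi> (k - 1))"
      unfolding zero_r_def \<pi>(2)[rule_format, OF k'] by simp
  qed
qed

end

lemma zero_r_mono:
  assumes "1 \<le> k" "k \<le> l" "l \<le> size (zeros_mset T1 T2)"
  shows "zero_r T1 T2 k \<le> zero_r T1 T2 l"
proof -
  have "length (sorted_list_of_multiset (zeros_mset T1 T2)) = size (zeros_mset T1 T2)"
    by (metis mset_sorted_list_of_multiset size_mset)
  then show ?thesis
    unfolding zero_r_def
    by (intro sorted_nth_mono sorted_sorted_list_of_multiset) (use assms in auto)
qed

text \<open>The eigenbasis is renumbered along \<open>zero_r\<close>, so that the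
  \<open>k\<close>-th vector belongs to the \<open>k\<close>-th zero and \<open>resA\<close> becomes
  the orthogonal projection onto an eigenspace.\<close>

theorem spectral_data:
  fixes T1 T2 :: "complex^'m^'m"
  assumes T1: "orth_proj T1" and T2: "orth_proj T2"
  shows "\<exists>w. (\<forall>k\<in>{1..CARD('m)}. \<forall>l\<in>{1..CARD('m)}. cinner (w k) (w l) = (if k = l then 1 else 0)) \<and>
    (\<forall>k\<in>{1..CARD('m)}. 0 \<le> zero_r T1 T2 k \<and> zero_r T1 T2 k < 1 \<and>
      monodromy T1 T2 *v w k = phase (zero_r T1 T2 k) *s w k \<and>
      (\<forall>v. resA T1 T2 k *v v =
        (\<Sum>s | s \<in> {1..CARD('m)} \<and> zero_r T1 T2 s = zero_r T1 T2 k. cinner (w s) v *s w s)) \<and>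
      (\<forall>l\<in>{1..CARD('m)}. k \<le> l \<longrightarrow> zero_r T1 T2 k \<le> zero_r T1 T2 l))"
proof -
  obtain q l where on: "\<And>i j. i < CARD('m) \<Longrightarrow> j < CARD('m) \<Longrightarrow> cinner (q i) (q j) = (if i = (j::nat) then 1 else 0)"
    and ql: "\<And>i. i < CARD('m) \<Longrightarrow> monodromy T1 T2 *v q i = l i *s q i"
    using normal_matrix_spectral[OF monodromy_normal[OF T1 T2]] by blast
  \<comment> \<open>Eigenvalues of a unitary matrix have modulus 1; the argument in [0, 2 pi),
    divided by \<open>2 * pi\<close>, lands in [0, 1).\<close>
  have "\<exists>t. 0 \<le> t \<and> t < 1 \<and> l i = phase t" if i: "i < CARD('m)" for i
  proof -
    have "cnj (l i) * l i = 1"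
      using cinner_monodromy[OF T1 T2, of "q i" "q i"] on[OF i i]
      by (simp add: ql[OF i] cinner_scale_left cinner_scale_right mult.commute)
    then have "(cmod (l i))\<^sup>2 = 1"
      by (metis complex_mod_mult_cnj complex_norm_square mult.commute of_real_1 of_real_eq_iff)
    then have "cmod (l i) = 1" by (simp add: power2_eq_1_iff) (smt (verit) norm_ge_zero)
    then have "l i = exp (\<i> * of_real (Arg2pi (l i)))" using Arg2pi_eq[of "l i"] by auto
    then show ?thesis
      using Arg2pi[of "l i"] by (intro exI[of _ "Arg2pi (l i) / (2 * pi)"]) (auto simp: field_simps)
  qed
  then obtain \<theta> where \<theta>: "\<And>i. i < CARD('m) \<Longrightarrow> 0 \<le> \<theta> i" "\<And>i. i < CARD('m) \<Longrightarrow> \<theta> i < 1"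
    and l: "\<And>i. i < CARD('m) \<Longrightarrow> l i = phase (\<theta> i)" by metis
  have eig: "\<And>i. i < CARD('m) \<Longrightarrow> monodromy T1 T2 *v q i = phase (\<theta> i) *s q i"
    using ql l by simp
  note facts = T1 T2 on eig \<theta>
  obtain p where p: "bij_betw p {1..CARD('m)} {..<CARD('m)}" "\<And>k. k \<in> {1..CARD('m)} \<Longrightarrow> zero_r T1 T2 k = \<theta> (p k)"
    using zero_r_permutation[OF facts] by blast
  have plt: "k \<in> {1..CARD('m)} \<Longrightarrow> p k < CARD('m)" for k using bij_betwE[OF p(1)] by auto
  have size: "size (zeros_mset T1 T2) = CARD('m)" by (simp add: zeros_mset_eq[OF facts])
  have A: "resA T1 T2 k *v v = (\<Sum>s | s \<in> {1..CARD('m)} \<and> zero_r T1 T2 s = zero_r T1 T2 k. cinner (q (p s)) v *s q (p s))"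
    if k: "k \<in> {1..CARD('m)}" for k v
  proof -
    let ?I = "{a. a < CARD('m) \<and> \<theta> a = zero_r T1 T2 k}"
    have r: "0 \<le> zero_r T1 T2 k" "zero_r T1 T2 k < 1" using p(2)[OF k] \<theta>[OF plt[OF k]] by auto
    have "resA T1 T2 k $ i $ j = (\<Sum>a\<in>?I. q a $ i * cnj (q a $ j))" for i j
      by (simp add: resA_def mscale_def residue_E0[OF facts r])
    then have "resA T1 T2 k *v v = (\<Sum>a\<in>?I. cinner (q a) v *s q a)"
      unfolding matrix_vector_mult_def cinner_def
      by (auto simp: vec_eq_iff sum_distrib_left sum_distrib_right mult_ac intro: sum.swap)
    also have "\<dots> = (\<Sum>s | s \<in> {1..CARD('m)} \<and> zero_r T1 T2 s = zero_r T1 T2 k. cinner (q (p s)) v *s q (p s))"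
    proof (rule sum.reindex_bij_betw[symmetric])
      show "bij_betw p {s. s \<in> {1..CARD('m)} \<and> zero_r T1 T2 s = zero_r T1 T2 k} ?I"
      proof (rule bij_betw_subset[OF p(1)])
        show "p ` {s. s \<in> {1..CARD('m)} \<and> zero_r T1 T2 s = zero_r T1 T2 k} = ?I"
        proof (intro equalityI subsetI)
          fix a assume a: "a \<in> ?I"
          then have "a \<in> p ` {1..CARD('m)}" using bij_betw_imp_surj_on[OF p(1)] by auto
          then obtain s where "s \<in> {1..CARD('m)}" "a = p s" by blast
          then show "a \<in> p ` {s. s \<in> {1..CARD('m)} \<and> zero_r T1 T2 s = zero_r T1 T2 k}"
            using a p(2) by simp
        qed (use p(2) plt in auto)
      qed auto
    qed
    finally show ?thesis .
  qed
  show ?thesis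
  proof (intro exI[of _ "\<lambda>k. q (p k)"] conjI ballI allI impI)
    fix k l assume kl: "k \<in> {1..CARD('m)}" "l \<in> {1..CARD('m)}"
    then show "cinner (q (p k)) (q (p l)) = (if k = l then 1 else 0)"
      using on[OF plt plt] inj_on_eq_iff[OF bij_betw_imp_inj_on[OF p(1)]] by auto
    assume "k \<le> l" then show "zero_r T1 T2 k \<le> zero_r T1 T2 l"
      using kl by (intro zero_r_mono) (auto simp: size)
  next
    fix k assume k: "k \<in> {1..CARD('m)}"
    then show "0 \<le> zero_r T1 T2 k" "zero_r T1 T2 k < 1" using p(2) \<theta>[OF plt] by auto
    show "monodromy T1 T2 *v q (p k) = phase (zero_r T1 T2 k) *s q (p k)"
      using eig[OF plt[OF k]] p(2)[OF k] by simp
    show "resA T1 T2 k *v v =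
        (\<Sum>s | s \<in> {1..CARD('m)} \<and> zero_r T1 T2 s = zero_r T1 T2 k. cinner (q (p s)) v *s q (p s))" for v
      by (rule A[OF k])
  qed
qed

section \<open>Almost orthonormal vectors\<close>

lemma orthonormal_family_exists:
  fixes S :: "(complex^'m) set"
  assumes S: "vec.subspace S"
  shows "k \<le> vec.dim S \<Longrightarrow> \<exists>q. (\<forall>i<k. q i \<in> S) \<and>
    (\<forall>i<k. \<forall>j<k. cinner (q i) (q j) = (if i = (j::nat) then 1 else 0))"
proof (induction k)
  case 0
  show ?case by simp
next
  case (Suc k)
  then obtain q where qS: "\<And>i. i < k \<Longrightarrow> q i \<in> S"
    and on: "\<And>i j. i < k \<Longrightarrow> j < k \<Longrightarrow> cinner (q i) (q j) = (if i = (j::nat) then 1 else 0)" by auto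
  obtain x where x: "x \<in> S" "x \<notin> vec.span (q ` {..<k})"
  proof (rule ccontr)
    assume "\<not> thesis"
    then have "S \<subseteq> vec.span (q ` {..<k})" using that by blast
    then have "vec.dim S \<le> card (q ` {..<k})" by (rule vec.dim_le_card) simp
    also have "\<dots> \<le> k" using card_image_le[of "{..<k}" q] by simp
    finally show False using Suc.prems by simp
  qed
  define v where "v = x - (\<Sum>i<k. cinner (q i) x *s q i)"
  have v: "v \<noteq> 0" "\<And>j. j < k \<Longrightarrow> cinner (q j) v = 0"
    using orthogonal_complement_nonzero[OF on x(2)] by (auto simp: v_def)
  have vS: "v \<in> S" unfolding v_def
    by (intro vec.subspace_diff[OF S] vec.subspace_sum[OF S] vec.subspace_scale[OF S] x qS) auto
  define u where "u = complex_of_real (1 / norm v) *s v"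
  have nu: "norm u = 1" using v(1) by (simp add: u_def norm_vector_scalar_mult norm_divide)
  have u: "cinner u u = 1" "u \<in> S" "\<And>i. i < k \<Longrightarrow> cinner (q i) u = 0"
    using v nu vS by (auto simp: u_def cinner_scale_right cinner_self vec.subspace_scale[OF S])
  have u': "\<And>i. i < k \<Longrightarrow> cinner u (q i) = 0" using u(3) by (subst cinner_commute) simp
  show ?case
    by (rule exI[of _ "q(k := u)"]) (auto simp: less_Suc_eq on u u' qS)
qed

lemma norm_orthonormal: "cinner v v = 1 \<Longrightarrow> norm v = 1"
  by (simp add: norm_eq_1_iff_cinner)

text \<open>The constants depend on the number of vectors only. This uniformity is essential, as the
  lemma is applied to infinitely many blocks and the errors must stay square summable.\<close>

lemma quantitative_gram_schmidt:
  "\<exists>C>0. \<exists>\<delta>>0. \<forall>(I::nat set) (v :: nat \<Rightarrow> complex^'m) \<epsilon>. finite I \<longrightarrow> card I \<le> d \<longrightarrow> 0 \<le> \<epsilon> \<longrightarrow> \<epsilon> \<le> \<delta> \<longrightarrow>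
    (\<forall>i\<in>I. \<forall>j\<in>I. cmod (cinner (v i) (v j) - (if i = j then 1 else 0)) \<le> \<epsilon>) \<longrightarrow>
    (\<exists>e. (\<forall>i\<in>I. \<forall>j\<in>I. cinner (e i) (e j) = (if i = j then 1 else 0)) \<and>
      (\<forall>i\<in>I. e i \<in> vec.span (v ` I) \<and> norm (e i - v i) \<le> C * \<epsilon>))"
proof (induction d)
  case 0
  show ?case by (intro exI[of _ 1] conjI) auto
next
  case (Suc d)
  then obtain C \<delta> where C: "C > 0" "\<delta> > 0" and
    IH: "\<And>(I::nat set) (v :: nat \<Rightarrow> complex^'m) \<epsilon>. finite I \<Longrightarrow> card I \<le> d \<Longrightarrow> 0 \<le> \<epsilon> \<Longrightarrow> \<epsilon> \<le> \<delta> \<Longrightarrow>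
    (\<forall>i\<in>I. \<forall>j\<in>I. cmod (cinner (v i) (v j) - (if i = j then 1 else 0)) \<le> \<epsilon>) \<Longrightarrow>
    (\<exists>e. (\<forall>i\<in>I. \<forall>j\<in>I. cinner (e i) (e j) = (if i = j then 1 else 0)) \<and>
      (\<forall>i\<in>I. e i \<in> vec.span (v ` I) \<and> norm (e i - v i) \<le> C * \<epsilon>))"
    by metis
  \<comment> \<open>\<open>M * \<epsilon>\<close> bounds the distance of \<open>norm u\<close> from
    1: \<open>\<epsilon>\<close> for the length of \<open>v k\<close> and \<open>d\<close>
    projections of size at most \<open>(1 + 2 * C) * \<epsilon>\<close>. In the new constant one
    \<open>M\<close> pays for the projections and one for the normalisation.\<close>
  define M where "M = 1 + real d * (1 + 2 * C)"
  have M: "M \<ge> 1" using C by (simp add: M_def)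
  show ?case
  proof (rule exI[of _ "C + 2 * M"], rule conjI, goal_cases)
    case 1
    show ?case using C M by simp
  next
    case 2
    show ?case
    \<comment> \<open>The bound 1 gives \<open>norm (v k) \<le> 2\<close>; the bound
      \<open>1 / (2 * M)\<close> keeps \<open>norm u\<close> at least 1/2, so that \<open>u\<close>
      can be normalised.\<close>
    proof (rule exI[of _ "min \<delta> (min 1 (1 / (2 * M)))"], intro conjI allI impI)
      show "0 < min \<delta> (min 1 (1 / (2 * M)))" using C M by auto
      fix I :: "nat set" and v :: "nat \<Rightarrow> complex^'m" and \<epsilon>
      assume I0: "finite I" "card I \<le> Suc d" and \<epsilon>: "0 \<le> \<epsilon>" "\<epsilon> \<le> min \<delta> (min 1 (1 / (2 * M)))"
        and v: "\<forall>i\<in>I. \<forall>j\<in>I. cmod (cinner (v i) (v j) - (if i = j then 1 else 0)) \<le> \<epsilon>"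
      have \<epsilon>': "\<epsilon> \<le> \<delta>" "\<epsilon> \<le> 1" "M * \<epsilon> \<le> 1/2"
        using \<epsilon>(2) unfolding min.bounded_iff using M by (simp_all add: field_simps)
      show "\<exists>e. (\<forall>i\<in>I. \<forall>j\<in>I. cinner (e i) (e j) = (if i = j then 1 else 0)) \<and>
        (\<forall>i\<in>I. e i \<in> vec.span (v ` I) \<and> norm (e i - v i) \<le> (C + 2 * M) * \<epsilon>)"
      proof (cases "card I \<le> d")
        case True
        obtain e where e: "\<forall>i\<in>I. \<forall>j\<in>I. cinner (e i) (e j) = (if i = j then 1 else 0)"
          "\<And>i. i \<in> I \<Longrightarrow> e i \<in> vec.span (v ` I) \<and> norm (e i - v i) \<le> C * \<epsilon>"
          using IH[OF I0(1) True \<epsilon>(1) \<epsilon>'(1) v] by blast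
        have "C * \<epsilon> \<le> (C + 2 * M) * \<epsilon>" using M \<epsilon>(1) by (intro mult_right_mono) auto
        then have "norm (e i - v i) \<le> (C + 2 * M) * \<epsilon>" if "i \<in> I" for i
          using e(2)[OF that] by linarith
        then show ?thesis using e by (intro exI[of _ e]) simp
      next
        case False
        then have I: "finite I" "card I = Suc d" using I0 by auto
        obtain k I' where k: "I = insert k I'" "k \<notin> I'" "card I' = d" "finite I'"
          using I by (metis card_Suc_eq finite_insert)
        obtain e where on: "\<And>i j. i \<in> I' \<Longrightarrow> j \<in> I' \<Longrightarrow> cinner (e i) (e j) = (if i = j then 1 else 0)"
          and e: "\<And>i. i \<in> I' \<Longrightarrow> e i \<in> vec.span (v ` I')" "\<And>i. i \<in> I' \<Longrightarrow> norm (e i - v i) \<le> C * \<epsilon>"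
          using IH[of I' \<epsilon> v] k \<epsilon> \<epsilon>' v by auto
        have nv: "\<bar>norm (v k) - 1\<bar> \<le> \<epsilon>"
        proof -
          have "cmod (cinner (v k) (v k) - 1) \<le> \<epsilon>" using v k(1) by force
          also have "cinner (v k) (v k) - 1 = of_real ((norm (v k))\<^sup>2 - 1)" by (simp add: cinner_self)
          finally have "\<bar>(norm (v k))\<^sup>2 - 1\<bar> \<le> \<epsilon>" by (simp only: norm_of_real)
          also have "(norm (v k))\<^sup>2 - 1 = (norm (v k) - 1) * (norm (v k) + 1)" by (simp add: power2_eq_square algebra_simps)
          finally have "\<bar>norm (v k) - 1\<bar> * (norm (v k) + 1) \<le> \<epsilon>" by (simp add: abs_mult)
          moreover have "\<bar>norm (v k) - 1\<bar> * 1 \<le> \<bar>norm (v k) - 1\<bar> * (norm (v k) + 1)"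
            by (intro mult_left_mono) auto
          ultimately show ?thesis unfolding mult_1_right by (rule order_trans[rotated])
        qed
        define u where "u = v k - (\<Sum>i\<in>I'. cinner (e i) (v k) *s e i)"
        have c: "cmod (cinner (e i) (v k)) \<le> (1 + 2 * C) * \<epsilon>" if i: "i \<in> I'" for i
        proof -
          have "cinner (e i) (v k) = cinner (v i) (v k) + cinner (e i - v i) (v k)" by (simp add: cinner_diff_left)
          then have "cmod (cinner (e i) (v k)) \<le> cmod (cinner (v i) (v k)) + cmod (cinner (e i - v i) (v k))"
            by (simp add: norm_triangle_ineq)
          also have "\<dots> \<le> \<epsilon> + C * \<epsilon> * 2"
          proof (rule add_mono)
            have "i \<in> I" "k \<in> I" "i \<noteq> k" using i k(1,2) by auto
            then show "cmod (cinner (v i) (v k)) \<le> \<epsilon>" using v[rule_format, of i k] by simp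
            have "cmod (cinner (e i - v i) (v k)) \<le> norm (e i - v i) * norm (v k)" by (rule cmod_cinner_le)
            also have "\<dots> \<le> C * \<epsilon> * 2"
              using e(2)[OF i] nv \<epsilon>' \<epsilon>(1) C(1) by (intro mult_mono) auto
            finally show "cmod (cinner (e i - v i) (v k)) \<le> C * \<epsilon> * 2" .
          qed
          finally show ?thesis by (simp add: algebra_simps)
        qed
        have uv: "norm (u - v k) \<le> real d * (1 + 2 * C) * \<epsilon>"
        proof -
          have "norm (u - v k) = norm (\<Sum>i\<in>I'. cinner (e i) (v k) *s e i)" by (simp add: u_def)
          also have "\<dots> \<le> (\<Sum>i\<in>I'. (1 + 2 * C) * \<epsilon>)"
            by (intro sum_norm_le) (use c on in \<open>auto simp: norm_vector_scalar_mult norm_orthonormal\<close>)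
          finally show ?thesis by (simp add: k)
        qed
        have nu1: "\<bar>norm u - 1\<bar> \<le> M * \<epsilon>"
        proof -
          have "\<bar>norm u - norm (v k)\<bar> \<le> norm (u - v k)" by (rule norm_triangle_ineq3)
          then have "\<bar>norm u - 1\<bar> \<le> \<epsilon> + real d * (1 + 2 * C) * \<epsilon>" using uv nv by linarith
          then show ?thesis by (simp add: M_def algebra_simps)
        qed
        then have nu: "norm u > 0" using \<epsilon>'(3) by linarith
        have uo: "cinner (e j) u = 0" if j: "j \<in> I'" for j
        proof -
          have "(\<Sum>i\<in>I'. cinner (e i) (v k) * cinner (e j) (e i)) = (\<Sum>i\<in>I'. if i = j then cinner (e i) (v k) else 0)"
            by (intro sum.cong refl) (use on[OF j] in auto)
          then show ?thesis using j k(4)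
            by (simp add: u_def cinner_diff_right cinner_sum_right cinner_scale_right)
        qed
        have us: "u \<in> vec.span (v ` I)"
        proof -
          have "e i \<in> vec.span (v ` I)" if "i \<in> I'" for i
            using e(1)[OF that] vec.span_mono[of "v ` I'" "v ` I"] k(1) by blast
          moreover have "v k \<in> vec.span (v ` I)" by (intro vec.span_base) (simp add: k(1))
          ultimately show ?thesis unfolding u_def by (intro vec.span_diff vec.span_sum vec.span_scale)
        qed
        define f where "f = complex_of_real (1 / norm u) *s u"
        have nf: "norm f = 1" using nu by (simp add: f_def norm_vector_scalar_mult norm_divide)
        have fu: "norm (f - u) \<le> M * \<epsilon>"
        proof -
          have "f - u = complex_of_real (1 / norm u - 1) *s u"
            unfolding f_def of_real_diff vec.scale_left_diff_distrib by simp
          then have "norm (f - u) = \<bar>1 / norm u - 1\<bar> * norm u" by (simp only: norm_vector_scalar_mult norm_of_real)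
          also have "\<dots> = \<bar>(1 / norm u - 1) * norm u\<bar>" by (simp add: abs_mult)
          also have "(1 / norm u - 1) * norm u = 1 - norm u" using nu by (simp add: field_simps)
          finally show ?thesis using nu1 by linarith
        qed
        have ff: "cinner f f = 1" using nf by (simp add: cinner_self)
        have fo: "cinner (e j) f = 0" "cinner f (e j) = 0" if "j \<in> I'" for j
          using uo[OF that] cinner_commute[of u "e j"]
          by (simp_all add: f_def cinner_scale_right cinner_scale_left)
        show ?thesis
        proof (intro exI[of _ "e(k := f)"] conjI ballI)
          fix i j assume "i \<in> I" "j \<in> I"
          then show "cinner ((e(k := f)) i) ((e(k := f)) j) = (if i = j then 1 else 0)"
            using k(1,2) on fo ff by auto
        next
          fix i assume i: "i \<in> I"
          have "e i \<in> vec.span (v ` I)" if "i \<in> I'"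
            using e(1)[OF that] vec.span_mono[of "v ` I'" "v ` I"] k(1) by blast
          then show "(e(k := f)) i \<in> vec.span (v ` I)"
            using us i k(1) by (auto simp: f_def intro!: vec.span_scale)
          show "norm ((e(k := f)) i - v i) \<le> (C + 2 * M) * \<epsilon>"
          proof (cases "i = k")
            case True
            have "norm (f - v k) \<le> norm (f - u) + norm (u - v k)"
              using norm_triangle_ineq[of "f - u" "u - v k"] by simp
            also have "\<dots> \<le> M * \<epsilon> + M * \<epsilon>"
              using fu uv \<epsilon>(1) by (intro add_mono) (auto simp: M_def algebra_simps)
            also have "\<dots> \<le> (C + 2 * M) * \<epsilon>" using C(1) \<epsilon>(1) by (simp add: algebra_simps)
            finally show ?thesis using True by simp
          next
            case False
            then have "norm (e i - v i) \<le> C * \<epsilon>" using e(2) i k(1) by auto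
            also have "\<dots> \<le> (C + 2 * M) * \<epsilon>" using M \<epsilon>(1) by (intro mult_right_mono) auto
            finally show ?thesis using False by simp
          qed
        qed
      qed
    qed
  qed
qed

lemma independent_family_zero:
  fixes E :: "'i \<Rightarrow> complex^'m"
  assumes "finite I" "inj_on E I" "vec.independent (E ` I)" "(\<Sum>t\<in>I. c t *s E t) = 0" "t \<in> I"
  shows "c t = 0"
proof -
  have "(\<Sum>x\<in>E ` I. c (inv_into I E x) *s x) = 0"
    using assms(2,4) by (simp add: sum.reindex)
  then have "c (inv_into I E (E t)) = 0"
    using vec.independentD[OF assms(3), of "E ` I" "\<lambda>x. c (inv_into I E x)" "E t"] assms(1,5) by simp
  then show ?thesis using assms by simp
qed

text \<open>The matrices \<open>M \<gamma>\<close> are sums of the hermitian matrices over one group of equal values. Since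
  their ranges are in direct sum, the solution \<open>v s\<close> of \<open>(A + K) (v s) = E s\<close> is annihilated by
  \<open>M \<gamma>\<close> for all groups \<open>\<gamma>\<close> other than that of \<open>s\<close>, hence orthogonal to the vectors \<open>E t\<close> of these
  groups; this forces vectors of different groups to be almost orthogonal.\<close>

lemma block_almost_orthonormal:
  fixes E w :: "nat \<Rightarrow> complex^'m" and A K :: "complex^'m^'m" and B :: "nat \<Rightarrow> complex^'m^'m" and g :: "nat \<Rightarrow> 'g" and I :: "nat set"
  defines "M \<gamma> \<equiv> \<Sum>t | t \<in> I \<and> g t = \<gamma>. B t"
  assumes I: "finite I"
    and w: "\<And>s t. s \<in> I \<Longrightarrow> t \<in> I \<Longrightarrow> cinner (w s) (w t) = (if s = t then 1 else 0)"
    and A: "\<And>v. A *v v = (\<Sum>s\<in>I. cinner (w s) v *s w s)"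
    and E: "\<And>s t. s \<in> I \<Longrightarrow> t \<in> I \<Longrightarrow> g s = g t \<Longrightarrow> cinner (E s) (E t) = (if s = t then 1 else 0)"
    and herm: "\<And>\<gamma>. \<gamma> \<in> g ` I \<Longrightarrow> ctransp (M \<gamma>) = M \<gamma>"
    and ran: "\<And>\<gamma>. \<gamma> \<in> g ` I \<Longrightarrow> range ((*v) (M \<gamma>)) = vec.span (E ` {t \<in> I. g t = \<gamma>})"
    and sum: "(\<Sum>t\<in>I. B t) = A + K"
    and K: "\<And>v. norm (K *v v) \<le> k * norm v" and k: "0 \<le> k" "k \<le> 1/2"
  shows "\<exists>v. (\<forall>s\<in>I. v s \<in> vec.span (w ` I) \<and> norm (E s - v s) \<le> 2 * k) \<and>
    (\<forall>s\<in>I. \<forall>t\<in>I. cmod (cinner (v s) (v t) - (if s = t then 1 else 0)) \<le> 6 * k)"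
proof -
  let ?L = "A + K" and ?R = "vec.span (w ` I)" and ?X = "vec.span (E ` I)"
  have wsum: "?L = (\<Sum>\<gamma>\<in>g ` I. M \<gamma>)"
    unfolding sum[symmetric] M_def by (rule sum.image_gen[OF I])
  have msum: "(\<Sum>\<gamma>\<in>S. N \<gamma>) *v v = (\<Sum>\<gamma>\<in>S. N \<gamma> *v v)" for S and N :: "'g \<Rightarrow> complex^'m^'m" and v
    by (induction S rule: infinite_finite_induct) (simp_all add: matrix_vector_mult_add_rdistrib)
  have Lv: "?L *v v = (\<Sum>\<gamma>\<in>g ` I. M \<gamma> *v v)" for v by (simp add: wsum msum)
  have Mran: "M \<gamma> *v v \<in> vec.span (E ` {t \<in> I. g t = \<gamma>})" if "\<gamma> \<in> g ` I" for \<gamma> v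
    using ran[OF that] by blast
  have LX: "?L *v v \<in> ?X" for v
    unfolding Lv
  proof (rule vec.span_sum)
    fix \<gamma> assume "\<gamma> \<in> g ` I"
    then show "M \<gamma> *v v \<in> ?X" using Mran[of \<gamma> v] vec.span_mono[of "E ` {t \<in> I. g t = \<gamma>}" "E ` I"] by auto
  qed
  have LR: "norm (?L *v r - r) \<le> k * norm r" if "r \<in> ?R" for r
  proof -
    have "A *v r = r" unfolding A using orthonormal_expansion_span[OF I w that] by simp
    then show ?thesis using K[of r] by (simp add: matrix_vector_mult_add_rdistrib)
  qed
  \<comment> \<open>On the span of the \<open>w s\<close> the matrix \<open>A\<close> is the
    identity, so \<open>A + K\<close> moves a vector there by at most half its norm and cannot
    annihilate a nonzero one.\<close>
  have inj: "inj_on ((*v) ?L) ?R"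
  proof (rule inj_onI)
    fix x y assume xy: "x \<in> ?R" "y \<in> ?R" "?L *v x = ?L *v y"
    then have "norm (?L *v (x - y) - (x - y)) \<le> k * norm (x - y)" by (intro LR vec.span_diff)
    then have "norm (x - y) \<le> k * norm (x - y)" using xy(3) by (simp add: matrix_vector_mult_diff_distrib norm_minus_commute)
    also have "\<dots> \<le> 1/2 * norm (x - y)" using k by (intro mult_right_mono) auto
    finally show "x = y" by simp
  qed
  have lin: "Vector_Spaces.linear (*s) (*s) ((*v) ?L)" by (rule matrix_vector_mul_linear_gen)
  note wi = orthonormal_imp_independent[OF I w]
  have indL: "vec.independent ((*v) ?L ` w ` I)"
    by (rule vec.linear_independent_injective_image[OF lin wi(2) inj]) auto
  have cardL: "card ((*v) ?L ` w ` I) = card I"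
    using card_image[OF wi(1)] card_image[OF inj_on_subset[OF inj vec.span_superset]] by simp
  have dimX: "vec.dim ?X \<le> card (E ` I)" using I by (intro vec.dim_le_card) auto
  have cE: "card (E ` I) \<le> card I" by (rule card_image_le[OF I])
  \<comment> \<open>The image of the span of the \<open>w s\<close> under \<open>A + K\<close> has
    dimension \<open>card I\<close> and lies in the span of the \<open>E s\<close>, whose dimension
    is at most that. Equality makes the \<open>E s\<close> independent and gives each of them a
    preimage.\<close>
  have XL: "?X \<subseteq> vec.span ((*v) ?L ` w ` I)"
    by (rule vec.card_ge_dim_independent[OF _ indL]) (use LX cardL dimX cE in auto)
  have "card I \<le> vec.dim ?X"
    using vec.dim_subset[of "(*v) ?L ` w ` I" ?X] LX vec.dim_eq_card_independent[OF indL] cardL by auto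
  then have cardE: "card (E ` I) = card I" and dimX': "card (E ` I) \<le> vec.dim ?X" using dimX cE by auto
  have injE: "inj_on E I" using cardE I by (simp add: eq_card_imp_inj_on)
  have indE: "vec.independent (E ` I)"
    by (rule vec.card_le_dim_spanning[OF vec.span_superset order_refl _ dimX']) (use I in simp)
  have "\<exists>v. v \<in> ?R \<and> ?L *v v = E s" if s: "s \<in> I" for s
  proof -
    have "E s \<in> vec.span ((*v) ?L ` w ` I)" using XL s vec.span_base by blast
    also have "\<dots> = (*v) ?L ` ?R" by (rule vec.linear_span_image[OF lin])
    finally show ?thesis by auto
  qed
  then obtain v where vR: "\<And>s. s \<in> I \<Longrightarrow> v s \<in> ?R" and vE: "\<And>s. s \<in> I \<Longrightarrow> ?L *v v s = E s" by metis
  have nE: "norm (E s) = 1" if "s \<in> I" for s using E[of s s] that by (simp add: norm_orthonormal)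
  have Ev: "norm (E s - v s) \<le> 2 * k" and nv: "norm (v s) \<le> 2" if s: "s \<in> I" for s
  proof -
    have 1: "norm (E s - v s) \<le> k * norm (v s)" using LR[OF vR[OF s]] vE[OF s] by simp
    also have "\<dots> \<le> 1/2 * norm (v s)" using k by (intro mult_right_mono) auto
    finally have "norm (v s) \<le> norm (E s) + 1/2 * norm (v s)"
      using norm_triangle_ineq2[of "v s" "E s"] by (simp add: norm_minus_commute)
    then show 2: "norm (v s) \<le> 2" using nE[OF s] by simp
    have "k * norm (v s) \<le> k * 2" using 2 k by (intro mult_left_mono) auto
    then show "norm (E s - v s) \<le> 2 * k" using 1 by simp
  qed
  have M0: "M (g t) *v v s = 0" if s: "s \<in> I" and t: "t \<in> I" and st: "g s \<noteq> g t" for s t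
  proof -
    have "\<exists>a. M \<gamma> *v v s = (\<Sum>x | x \<in> I \<and> g x = \<gamma>. a x *s E x)" if \<gamma>: "\<gamma> \<in> g ` I" for \<gamma>
    proof -
      have "\<exists>u. M \<gamma> *v v s = (\<Sum>x\<in>E ` {t \<in> I. g t = \<gamma>}. u x *s x)"
        using Mran[OF \<gamma>, of "v s"] I by (auto simp: vec.span_finite)
      then obtain u where u: "M \<gamma> *v v s = (\<Sum>x\<in>E ` {t \<in> I. g t = \<gamma>}. u x *s x)" by blast
      have "inj_on E {t \<in> I. g t = \<gamma>}" by (rule inj_on_subset[OF injE]) auto
      then show ?thesis unfolding u by (subst sum.reindex) auto
    qed
    then obtain a where a: "\<And>\<gamma>. \<gamma> \<in> g ` I \<Longrightarrow> M \<gamma> *v v s = (\<Sum>x | x \<in> I \<and> g x = \<gamma>. a \<gamma> x *s E x)"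
      by metis
    have "E s = (\<Sum>\<gamma>\<in>g ` I. \<Sum>x | x \<in> I \<and> g x = \<gamma>. a \<gamma> x *s E x)"
      unfolding vE[OF s, symmetric] Lv by (intro sum.cong a refl)
    also have "\<dots> = (\<Sum>\<gamma>\<in>g ` I. \<Sum>x | x \<in> I \<and> g x = \<gamma>. a (g x) x *s E x)"
      by (intro sum.cong refl) auto
    also have "\<dots> = (\<Sum>x\<in>I. a (g x) x *s E x)" by (rule sum.image_gen[OF I, symmetric])
    finally have 1: "E s = (\<Sum>x\<in>I. a (g x) x *s E x)" .
    have "E s = (\<Sum>x\<in>I. if x = s then E x else 0)" using I s by simp
    also have "\<dots> = (\<Sum>x\<in>I. (if x = s then 1 else 0) *s E x)" by (intro sum.cong refl) auto
    finally have "(\<Sum>x\<in>I. (a (g x) x - (if x = s then 1 else 0)) *s E x) = 0"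
      using 1 by (simp add: vec.scale_left_diff_distrib sum_subtractf)
    from independent_family_zero[OF I injE indE this]
    have az: "a (g x) x = (if x = s then 1 else 0)" if "x \<in> I" for x using that by force
    have "M (g t) *v v s = (\<Sum>x | x \<in> I \<and> g x = g t. a (g x) x *s E x)"
      unfolding a[OF imageI[OF t]] by (intro sum.cong refl) auto
    also have "\<dots> = 0"
    proof (intro sum.neutral ballI)
      fix x assume x: "x \<in> {x. x \<in> I \<and> g x = g t}"
      then have "x \<noteq> s" using st by auto
      then show "a (g x) x *s E x = 0" using az[of x] x by simp
    qed
    finally show ?thesis .
  qed
  have orth: "cinner (v s) (E t) = 0" if s: "s \<in> I" and t: "t \<in> I" and st: "g s \<noteq> g t" for s t
  proof -
    have gt: "g t \<in> g ` I" using t by simp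
    have "E t \<in> vec.span (E ` {x \<in> I. g x = g t})" using t by (intro vec.span_base) auto
    then obtain y where y: "E t = M (g t) *v y" using ran[OF gt] by (metis imageE)
    have "cinner (v s) (E t) = cinner (ctransp (M (g t)) *v v s) y" unfolding y by (rule cinner_ctransp[symmetric])
    also have "\<dots> = 0" by (simp add: herm[OF gt] M0[OF s t st])
    finally show ?thesis .
  qed
  \<comment> \<open>Within a group, replacing \<open>v\<close> by \<open>E\<close> in both arguments
    costs \<open>2 * k * 2\<close> and \<open>2 * k\<close>, in total \<open>6 * k\<close>. Across
    groups the exact orthogonality \<open>orth\<close> leaves only \<open>4 * k\<close>.\<close>
  have "cmod (cinner (v s) (v t) - (if s = t then 1 else 0)) \<le> 6 * k" if s: "s \<in> I" and t: "t \<in> I" for s t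
  proof (cases "g s = g t")
    case True
    have "cinner (v s) (v t) - (if s = t then 1 else 0) = cinner (v s - E s) (v t) + cinner (E s) (v t - E t)"
      using E[OF s t True] by (simp add: cinner_diff_left cinner_diff_right)
    also have "cmod \<dots> \<le> norm (v s - E s) * norm (v t) + norm (E s) * norm (v t - E t)"
      by (intro order_trans[OF norm_triangle_ineq] add_mono cmod_cinner_le)
    also have "\<dots> \<le> (2 * k) * 2 + 1 * (2 * k)"
      using Ev[OF s] Ev[OF t] nv[OF t] nE[OF s] k by (intro add_mono mult_mono) (auto simp: norm_minus_commute)
    finally show ?thesis by simp
  next
    case False
    then have "cinner (v s) (v t) - (if s = t then 1 else 0) = cinner (v s) (v t - E t)"
      using orth[OF s t False] by (auto simp: cinner_diff_right)
    also have "cmod \<dots> \<le> norm (v s) * norm (v t - E t)" by (rule cmod_cinner_le)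
    also have "\<dots> \<le> 2 * (2 * k)"
      using Ev[OF t] nv[OF s] k by (intro mult_mono) (auto simp: norm_minus_commute)
    finally show ?thesis using k by simp
  qed
  then show ?thesis using vR Ev by (intro exI[of _ v]) auto
qed

section \<open>Trigonometric modes\<close>

text \<open>The formula of \<open>Yfun\<close> for nonzero values, kept at the value 0 as well,
  where it degenerates to the constant \<open>T *v e\<close>.\<close>

definition mode :: "complex ^ 'm ^ 'm \<Rightarrow> complex \<Rightarrow> complex ^ 'm \<Rightarrow> real \<Rightarrow> complex ^ 'm"
  where "mode T \<rho> e x = (cos (\<rho> * of_real x) *m T + sin (\<rho> * of_real x) *m perp T) *v e"

lemma mode_mv: "mode T \<rho> e x = cos (\<rho> * of_real x) *s (T *v e) + sin (\<rho> * of_real x) *s (e - T *v e)"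
  by (simp add: mode_def matrix_vector_mult_add_rdistrib mscale_vector_mult perp_vector_mult)

lemma Yfun_eq_mode: "\<rho> \<noteq> 0 \<Longrightarrow> Yfun T \<rho> e = mode T \<rho> e"
  by (simp add: Yfun_def mode_def fun_eq_iff)

lemma continuous_on_cscale:
  "continuous_on S f \<Longrightarrow> continuous_on S (\<lambda>x. f x *s v)" for v :: "complex^'n"
  unfolding vector_scalar_mult_def by (intro continuous_intros)

lemma mode_L2: "mode T \<rho> e \<in> L2"
  unfolding mode_mv[abs_def]
  by (intro L2_continuous continuous_intros continuous_on_cscale)

definition cos_integral :: "real \<Rightarrow> real"
  where "cos_integral c = (if c = 0 then pi else sin (c * pi) / c)"

lemma integrable_cos_Ipi: "integrable Ipi (\<lambda>x. cos (c * x))"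
proof -
  have "(\<lambda>x. cos (c * x)) absolutely_integrable_on {0..pi}"
    by (intro absolutely_integrable_continuous_real continuous_intros)
  then have "(\<lambda>x. cos (c * x)) absolutely_integrable_on {0<..<pi}"
    by (rule set_integrable_subset) auto
  then show ?thesis by (rule absolutely_integrable_imp_integrable) auto
qed

lemma integral_cos_Ipi: "(LINT x|Ipi. cos (c * x)) = cos_integral c"
proof -
  have "((\<lambda>x. cos (c * x)) has_integral cos_integral c) {0..pi}"
  proof (cases "c = 0")
    case True
    then show ?thesis using has_integral_const_real[of "1::real" 0 pi] by (simp add: cos_integral_def)
  next
    case False
    have "((\<lambda>x. cos (c * x)) has_integral (sin (c * pi) / c - sin (c * 0) / c)) {0..pi}"
      by (rule fundamental_theorem_of_calculus)
        (use False in \<open>auto intro!: derivative_eq_intros simp flip: has_real_derivative_iff_has_vector_derivative\<close>)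
    then show ?thesis using False by (simp add: cos_integral_def)
  qed
  then have "integral {0<..<pi} (\<lambda>x. cos (c * x)) = cos_integral c"
    by (simp add: integral_unique flip: integral_open_interval_real)
  then show ?thesis using lebesgue_integral_eq_integral[OF integrable_cos_Ipi, of c] by simp
qed

text \<open>The products of cosines go with \<open>T\<close> and those of sines with
  \<open>perp T\<close>. By the product formulas the frequency \<open>a - b\<close> collects the
  identity and \<open>a + b\<close> collects \<open>T - perp T\<close>, the reflection.\<close>

lemma L2_inner_mode:
  assumes T: "orth_proj T"
  shows "L2_inner (mode T (of_real a) v) (mode T (of_real b) w) =
    (of_real (cos_integral (a - b)) * cinner v w + of_real (cos_integral (a + b)) * cinner v (reflection T *v w)) / 2"
proof -
  have "cinner (mode T (of_real a) v x) (mode T (of_real b) w x) =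
      of_real (cos ((a - b) * x)) * (cinner v w / 2) + of_real (cos ((a + b) * x)) * (cinner v (reflection T *v w) / 2)" for x
  proof -
    have c: "cos (complex_of_real a * of_real x) = of_real (cos (a * x))" "sin (complex_of_real a * of_real x) = of_real (sin (a * x))" for a
      by (simp_all flip: of_real_mult cos_of_real sin_of_real)
    have "cinner (mode T (of_real a) v x) (mode T (of_real b) w x) =
       of_real (cos (a * x) * cos (b * x)) * cinner v (T *v w) +
       of_real (sin (a * x) * sin (b * x)) * (cinner v w - cinner v (T *v w))"
      unfolding mode_mv c
      by (simp add: cinner_simps orth_proj_cinner[OF T] orth_proj_idem[OF T] algebra_simps)
    also have "cos (a * x) * cos (b * x) = (cos ((a - b) * x) + cos ((a + b) * x)) / 2"
      by (simp add: cos_times_cos algebra_simps)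
    also have "sin (a * x) * sin (b * x) = (cos ((a - b) * x) - cos ((a + b) * x)) / 2"
      by (simp add: sin_times_sin algebra_simps)
    also have "of_real ((P + Q) / 2) * t + of_real ((P - Q) / 2) * (s - t) =
        of_real P * (s / 2) + of_real Q * ((2 * t - s) / 2)" for P Q :: real and s t :: complex
      by (simp add: field_simps)
    finally show ?thesis
      by (simp only: reflection_mv cinner_simps)
  qed
  then have "L2_inner (mode T (of_real a) v) (mode T (of_real b) w) =
    (LINT x|Ipi. of_real (cos ((a - b) * x)) * (cinner v w / 2) + of_real (cos ((a + b) * x)) * (cinner v (reflection T *v w) / 2))"
    by (simp add: L2_inner_def)
  also have "\<dots> = of_real (cos_integral (a - b)) * (cinner v w / 2) + of_real (cos_integral (a + b)) * (cinner v (reflection T *v w) / 2)"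
    by (subst Bochner_Integration.integral_add)
      (auto intro!: integrable_mult_left integrable_of_real integrable_cos_Ipi simp: integral_cos_Ipi)
  finally show ?thesis by (simp add: add_divide_distrib)
qed

lemma phase_eq_1_imp_sin:
  assumes "phase c = 1" shows "sin (c * pi) = 0"
proof -
  have "phase c = cis (2 * pi * c)" by (simp add: cis_conv_exp mult_ac)
  then have "cos (2 * (c * pi)) = 1" using assms by (simp add: cis.code complex_eq_iff mult_ac)
  then show ?thesis by (simp add: cos_double_sin)
qed

text \<open>Eigenvectors of a unitary matrix are orthogonal unless \<open>a - b\<close> is an
  integer, and then the sine vanishes. For the second claim \<open>reflection T1 *v w\<close> is an
  eigenvector for the phase of \<open>- b\<close>.\<close>

lemma eigenmodes_orthogonal:
  fixes T1 T2 :: "complex^'m^'m"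
  assumes T1: "orth_proj T1" and T2: "orth_proj T2"
    and v: "monodromy T1 T2 *v v = phase a *s v"
    and w: "monodromy T1 T2 *v w = phase b *s w"
  shows "of_real (sin ((a - b) * pi)) * cinner v w = 0"
    and "of_real (sin ((a + b) * pi)) * cinner v (reflection T1 *v w) = 0"
proof -
  define u where "u c = phase c" for c
  have cu: "cnj (u c) = u (- c)" for c by (simp add: u_def exp_cnj)
  have uu: "u c * u d = u (c + d)" for c d by (simp add: u_def algebra_simps flip: exp_add)
  have u0: "u 0 = 1" by (simp add: u_def)
  note vw = v[folded u_def] w[folded u_def]
  have "cinner v w = cinner (monodromy T1 T2 *v v) (monodromy T1 T2 *v w)"
    by (rule cinner_monodromy[OF T1 T2, symmetric])
  also have "\<dots> = u (b - a) * cinner v w"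
    unfolding vw cinner_scale_left cinner_scale_right cu mult.assoc[symmetric] uu by simp
  finally have 1: "cinner v w = 0 \<or> u (b - a) = 1" by simp
  show "of_real (sin ((a - b) * pi)) * cinner v w = 0"
    using 1 phase_eq_1_imp_sin[of "b - a"] sin_minus[of "(a - b) * pi"]
    by (auto simp: u_def algebra_simps)
  have "monodromy T1 T2 *v (reflection T1 *v w) = u (- b) *s (monodromy T1 T2 *v (reflection T1 *v (u b *s w)))"
    by (simp add: matrix_vector_mult_cscale uu u0)
  also have "\<dots> = u (- b) *s (reflection T1 *v w)"
    unfolding vw(2)[symmetric] monodromy_reflection_monodromy[OF T1 T2] by simp
  finally have r: "monodromy T1 T2 *v (reflection T1 *v w) = u (- b) *s (reflection T1 *v w)" .
  have "cinner v (reflection T1 *v w) = cinner (monodromy T1 T2 *v v) (monodromy T1 T2 *v (reflection T1 *v w))"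
    by (rule cinner_monodromy[OF T1 T2, symmetric])
  also have "\<dots> = u (- (a + b)) * cinner v (reflection T1 *v w)"
    unfolding vw(1) r cinner_scale_left cinner_scale_right cu mult.assoc[symmetric] uu by (simp add: add.commute)
  finally have 2: "cinner v (reflection T1 *v w) = 0 \<or> u (- (a + b)) = 1" by simp
  show "of_real (sin ((a + b) * pi)) * cinner v (reflection T1 *v w) = 0"
    using 2 phase_eq_1_imp_sin[of "- (a + b)"] sin_minus[of "(a + b) * pi"]
    by (auto simp: u_def algebra_simps)
qed

text \<open>For distinct values both terms of \<open>L2_inner_mode\<close> vanish; for equal nonzero
  values only the first survives and the squared norm is \<open>pi / 2\<close>. At the value 0 the
  reflection fixes \<open>W\<close>, both terms contribute and the squared norm is pi, whence the
  exceptional factor.\<close>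

theorem modes_orthonormal:
  fixes T1 T2 :: "complex^'m^'m" and a :: "'i \<Rightarrow> real" and W :: "'i \<Rightarrow> complex^'m"
  assumes T1: "orth_proj T1" and T2: "orth_proj T2"
    and a: "\<And>p. p \<in> J \<Longrightarrow> 0 \<le> a p"
    and eig: "\<And>p. p \<in> J \<Longrightarrow> monodromy T1 T2 *v W p = phase (a p) *s W p"
    and on: "\<And>p q. p \<in> J \<Longrightarrow> q \<in> J \<Longrightarrow> a p = a q \<Longrightarrow> cinner (W p) (W q) = (if p = q then 1 else 0)"
    and zero: "\<And>p. p \<in> J \<Longrightarrow> a p = 0 \<Longrightarrow> T1 *v W p = W p"
    and p: "p \<in> J" and q: "q \<in> J"
  defines "e r x \<equiv> of_real (sqrt ((if a r = 0 then 1 else 2) / pi)) *s mode T1 (of_real (a r)) (W r) x"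
  shows "L2_inner (e p) (e q) = (if p = q then 1 else 0)"
proof -
  let ?c = "\<lambda>r. sqrt ((if a r = 0 then 1 else 2) / pi)"
  have "L2_inner (e p) (e q) = (LINT x|Ipi. of_real (?c p * ?c q) *
      cinner (mode T1 (of_real (a p)) (W p) x) (mode T1 (of_real (a q)) (W q) x))"
    unfolding L2_inner_def e_def cinner_scale_left cinner_scale_right by (simp add: mult_ac)
  also have "\<dots> = of_real (?c p * ?c q) * L2_inner (mode T1 (of_real (a p)) (W p)) (mode T1 (of_real (a q)) (W q))"
    unfolding L2_inner_def by (rule integral_mult_right_zero)
  finally have e: "L2_inner (e p) (e q) = of_real (?c p * ?c q) *
      ((of_real (cos_integral (a p - a q)) * cinner (W p) (W q) +
        of_real (cos_integral (a p + a q)) * cinner (W p) (reflection T1 *v W q)) / 2)"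
    unfolding L2_inner_mode[OF T1] .
  note orth = eigenmodes_orthogonal[OF T1 T2 eig[OF p] eig[OF q]]
  have plus: "of_real (cos_integral (a p + a q)) * cinner (W p) (reflection T1 *v W q) = 0" if "a p + a q \<noteq> 0"
    using orth(2) that by (auto simp: cos_integral_def)
  show ?thesis
  proof (cases "a p = a q")
    case False
    then have "a p + a q \<noteq> 0" using a[OF p] a[OF q] by auto
    moreover have "of_real (cos_integral (a p - a q)) * cinner (W p) (W q) = 0"
      using orth(1) False by (auto simp: cos_integral_def)
    ultimately show ?thesis unfolding e using False plus by auto
  next
    case True
    have ci: "cos_integral (a p - a q) = pi" using True by (simp add: cos_integral_def)
    have cc: "?c p * ?c q = (if a p = 0 then 1 else 2) / pi" using True by (simp add: True)
    show ?thesis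
    proof (cases "a p = 0")
      case z: True
      then have "reflection T1 *v W q = W q" using zero[OF q] True by (simp add: reflection_mv vec_eq_iff)
      then show ?thesis using e cc True z on[OF p q] by (simp add: cos_integral_def)
    next
      case False
      then have "a p + a q \<noteq> 0" using True by simp
      show ?thesis unfolding e plus[OF \<open>a p + a q \<noteq> 0\<close>] cc ci on[OF p q True] using False by simp
    qed
  qed
qed

section \<open>Perturbation estimates for modes\<close>

lemma norm_orth_proj_le: "orth_proj T \<Longrightarrow> norm (T *v v) \<le> norm v"
proof -
  assume T: "orth_proj T"
  have "cinner (T *v v) (T *v v) = cinner v (T *v v)" by (simp add: orth_proj_cinner[OF T] orth_proj_idem[OF T])
  then have "(norm (T *v v))\<^sup>2 = cmod (cinner v (T *v v))"
    by (metis cinner_self norm_of_real abs_of_nonneg zero_le_power2)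
  also have "\<dots> \<le> norm v * norm (T *v v)" by (rule cmod_cinner_le)
  finally show ?thesis by (cases "norm (T *v v) = 0") (auto simp: power2_eq_square)
qed

text \<open>Both arguments lie in the convex strip where the imaginary part is at most pi in
  modulus. There the derivatives are bounded by \<open>exp pi\<close>, and the mean value inequality
  applies.\<close>

lemma cos_sin_perturbation:
  fixes \<kappa> :: complex and a x :: real
  assumes x: "0 \<le> x" "x \<le> pi" and \<kappa>: "norm \<kappa> \<le> 1"
  shows "cmod (cos ((of_real a + \<kappa>) * of_real x) - cos (of_real a * of_real x)) \<le> exp pi * pi * norm \<kappa>"
    and "cmod (sin ((of_real a + \<kappa>) * of_real x) - sin (of_real a * of_real x)) \<le> exp pi * pi * norm \<kappa>"
proof -
  define S where "S = {z. Im z \<ge> - pi} \<inter> {z. Im z \<le> pi}"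
  have cv: "convex S" unfolding S_def by (intro convex_Int convex_halfspace_Im_ge convex_halfspace_Im_le)
  have b: "cmod (sin z) \<le> exp pi" "cmod (- sin z) \<le> exp pi" "cmod (cos z) \<le> exp pi" if "z \<in> S" for z
    using cmod_sin_le_exp[of 1 z] cmod_cos_le_exp[of 1 z] that by (auto simp: S_def intro: order_trans)
  have "\<bar>Im \<kappa>\<bar> * x \<le> 1 * pi"
    using x \<kappa> abs_Im_le_cmod[of \<kappa>] by (intro mult_mono) auto
  then have "\<bar>Im \<kappa> * x\<bar> \<le> pi" using x by (simp add: abs_mult)
  then have S: "(of_real a + \<kappa>) * of_real x \<in> S" "of_real a * of_real x \<in> S"
    by (auto simp: S_def abs_le_iff)
  have d: "norm ((of_real a + \<kappa>) * of_real x - of_real a * of_real x) \<le> pi * norm \<kappa>"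
    using x by (simp add: algebra_simps norm_mult mult_right_mono)
  have "cmod (cos ((of_real a + \<kappa>) * of_real x) - cos (of_real a * of_real x))
      \<le> exp pi * norm ((of_real a + \<kappa>) * of_real x - of_real a * of_real x)"
    by (rule field_differentiable_bound[OF cv _ b(2) S]) (auto intro!: derivative_eq_intros)
  also have "\<dots> \<le> exp pi * (pi * norm \<kappa>)" by (intro mult_left_mono d) simp
  finally show "cmod (cos ((of_real a + \<kappa>) * of_real x) - cos (of_real a * of_real x)) \<le> exp pi * pi * norm \<kappa>"
    by (simp add: mult.assoc)
  have "cmod (sin ((of_real a + \<kappa>) * of_real x) - sin (of_real a * of_real x))
      \<le> exp pi * norm ((of_real a + \<kappa>) * of_real x - of_real a * of_real x)"
    by (rule field_differentiable_bound[OF cv _ b(3) S]) (auto intro!: derivative_eq_intros)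
  also have "\<dots> \<le> exp pi * (pi * norm \<kappa>)" by (intro mult_left_mono d) simp
  finally show "cmod (sin ((of_real a + \<kappa>) * of_real x) - sin (of_real a * of_real x)) \<le> exp pi * pi * norm \<kappa>"
    by (simp add: mult.assoc)
qed

lemma mode_perturbation:
  assumes T: "orth_proj T" and x: "0 \<le> x" "x \<le> pi" and \<kappa>: "norm \<kappa> \<le> 1" and E: "norm E = 1"
  shows "norm (mode T (of_real a + \<kappa>) E x - mode T (of_real a) W x) \<le>
    3 * exp pi * pi * norm \<kappa> + 3 * norm (E - W)"
proof -
  \<comment> \<open>The factor 3 is 1 + 2, from the bounds \<open>norm v\<close> for
    \<open>T *v v\<close> and \<open>2 * norm v\<close> for \<open>v - T *v v\<close>.\<close>
  have cs: "norm (c *s (T *v v) + s *s (v - T *v v)) \<le> C * (3 * norm v)"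
    if "cmod c \<le> C" "cmod s \<le> C" for c s C and v
  proof -
    have nT: "norm (T *v v) \<le> norm v" by (rule norm_orth_proj_le[OF T])
    have nP: "norm (v - T *v v) \<le> 2 * norm v"
      using norm_triangle_ineq4[of v "T *v v"] nT by linarith
    have "norm (c *s (T *v v) + s *s (v - T *v v)) \<le> cmod c * norm (T *v v) + cmod s * norm (v - T *v v)"
      by (rule order_trans[OF norm_triangle_ineq]) (simp only: norm_vector_scalar_mult order_refl)
    also have "\<dots> \<le> C * norm v + C * (2 * norm v)"
      using that nT nP by (intro add_mono mult_mono) (auto intro: order_trans[OF norm_ge_zero])
    finally show ?thesis by (simp add: algebra_simps)
  qed
  have "mode T (of_real a + \<kappa>) E x - mode T (of_real a) W x =
    ((cos ((of_real a + \<kappa>) * of_real x) - cos (of_real a * of_real x)) *s (T *v E) +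
     (sin ((of_real a + \<kappa>) * of_real x) - sin (of_real a * of_real x)) *s (E - T *v E)) +
    (cos (of_real a * of_real x) *s (T *v (E - W)) + sin (of_real a * of_real x) *s ((E - W) - T *v (E - W)))"
    unfolding mode_mv by (simp add: matrix_vector_mult_diff_distrib vec_eq_iff algebra_simps)
  also have "norm \<dots> \<le> (exp pi * pi * norm \<kappa>) * (3 * norm E) + 1 * (3 * norm (E - W))"
  proof (rule order_trans[OF norm_triangle_ineq add_mono])
    have c: "cos (complex_of_real a * of_real x) = of_real (cos (a * x))" "sin (complex_of_real a * of_real x) = of_real (sin (a * x))"
      by (simp_all flip: of_real_mult cos_of_real sin_of_real)
    show "norm (cos (complex_of_real a * of_real x) *s (T *v (E - W)) + sin (complex_of_real a * of_real x) *s ((E - W) - T *v (E - W)))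
      \<le> 1 * (3 * norm (E - W))"
      by (rule cs) (simp_all add: c)
  qed (intro cs cos_sin_perturbation x \<kappa>)
  finally show ?thesis using E by (simp add: algebra_simps)
qed

lemma L2_nrm_le_sup:
  assumes f: "f \<in> L2" and b: "\<And>x. 0 \<le> x \<Longrightarrow> x \<le> pi \<Longrightarrow> norm (f x) \<le> b"
  shows "(L2_nrm f)\<^sup>2 \<le> pi * b\<^sup>2"
proof -
  have "(LINT x|Ipi. (norm (f x))\<^sup>2) \<le> (LINT x|Ipi. b\<^sup>2)"
  proof (rule integral_mono_AE)
    show "integrable Ipi (\<lambda>x. (norm (f x))\<^sup>2)" by (rule L2_integrable[OF f])
    have "emeasure Ipi (space Ipi) \<noteq> \<infinity>" by (simp add: emeasure_restrict_space)
    then interpret finite_measure Ipi by (rule finite_measureI)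
    show "integrable Ipi (\<lambda>x. b\<^sup>2)" by simp
    show "AE x in Ipi. (norm (f x))\<^sup>2 \<le> b\<^sup>2"
      by (intro AE_I2) (auto intro!: power_mono b)
  qed
  also have "\<dots> = pi * b\<^sup>2" by (simp add: measure_restrict_space)
  finally show ?thesis by (simp add: L2_nrm_def integral_nonneg)
qed

section \<open>Closeness to eigenvectors\<close>

lemma finite_superlevel_summable:
  fixes f :: "'a \<Rightarrow> real"
  assumes sm: "f summable_on A" and f: "\<And>x. x \<in> A \<Longrightarrow> 0 \<le> f x" and \<epsilon>: "0 < \<epsilon>"
  shows "finite {x \<in> A. \<epsilon> \<le> f x}"
proof (rule ccontr)
  assume inf: "infinite {x \<in> A. \<epsilon> \<le> f x}"
  obtain n :: nat where n: "infsum f A < real n * \<epsilon>" using reals_Archimedean3[OF \<epsilon>] by blast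
  obtain F where F: "F \<subseteq> {x \<in> A. \<epsilon> \<le> f x}" "finite F" "card F = n"
    using infinite_arbitrarily_large[OF inf, of n] by blast
  have "real n * \<epsilon> = (\<Sum>x\<in>F. \<epsilon>)" using F by simp
  also have "\<dots> \<le> (\<Sum>x\<in>F. f x)" by (intro sum_mono) (use F in auto)
  also have "\<dots> \<le> infsum f A" by (rule finite_sum_le_infsum[OF sm]) (use F f in auto)
  finally show False using n by simp
qed

lemma J_set_iff: "1 \<le> n \<Longrightarrow> (n, k) \<in> J_set T1 T2 \<longleftrightarrow> k \<in> {1..CARD('m)}"
  for T1 T2 :: "complex^'m^'m"
  by (auto simp: J_set_def)

lemma J_set_snd: "(n, k) \<in> J_set T1 T2 \<Longrightarrow> k \<in> {1..CARD('m)}"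
  for T1 T2 :: "complex^'m^'m"
  by (auto simp: J_set_def)

text \<open>At the value 0 a mode keeps only its \<open>T1\<close> component, so it needs vectors
  fixed by \<open>T1\<close> instead of arbitrary eigenvectors. By \<open>monodromy_fixed\<close>
  the eigenspace for 1 lies in \<open>KK + RR\<close>, so discounting the dimension of
  \<open>KK\<close> leaves at most the dimension of \<open>RR\<close>, which can be served from
  \<open>RR\<close>.\<close>

lemma zero_modes:
  fixes T1 T2 :: "complex^'m^'m" and w :: "nat \<Rightarrow> complex^'m"
  assumes T1: "orth_proj T1" and T2: "orth_proj T2"
    and w: "\<And>k l. k \<in> {1..CARD('m)} \<Longrightarrow> l \<in> {1..CARD('m)} \<Longrightarrow> cinner (w k) (w l) = (if k = l then 1 else 0)"
    and r0: "\<And>k. k \<in> {1..CARD('m)} \<Longrightarrow> 0 \<le> zero_r T1 T2 k"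
    and eig: "\<And>k. k \<in> {1..CARD('m)} \<Longrightarrow> monodromy T1 T2 *v w k = phase (zero_r T1 T2 k) *s w k"
    and mono: "\<And>k l. k \<in> {1..CARD('m)} \<Longrightarrow> l \<in> {1..CARD('m)} \<Longrightarrow> k \<le> l \<Longrightarrow> zero_r T1 T2 k \<le> zero_r T1 T2 l"
  shows "\<exists>b. (\<forall>k l. (0, k) \<in> J_set T1 T2 \<longrightarrow> zero_r T1 T2 k = 0 \<longrightarrow> (0, l) \<in> J_set T1 T2 \<longrightarrow> zero_r T1 T2 l = 0 \<longrightarrow>
      cinner (b k) (b l) = (if k = l then 1 else 0)) \<and>
    (\<forall>k. (0, k) \<in> J_set T1 T2 \<longrightarrow> zero_r T1 T2 k = 0 \<longrightarrow> T1 *v b k = b k \<and> monodromy T1 T2 *v b k = b k)"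
proof -
  let ?m = "CARD('m)" and ?r = "zero_r T1 T2"
  define KK where "KK = {v. T1 *v v = 0} \<inter> {v. T2 *v v = 0}"
  define RR where "RR = {v. T1 *v v = v \<and> T2 *v v = v}"
  define Z where "Z = {k \<in> {1..?m}. ?r k = 0}"
  have subRR: "vec.subspace RR"
    by (auto simp: RR_def vec.subspace_def matrix_vector_right_distrib matrix_vector_mult_cscale)
  have p: "p_perp T1 T2 = vec.dim KK" by (simp add: p_perp_def KK_def)
  have finZ: "finite Z" by (simp add: Z_def)
  have cardZ: "card Z \<le> vec.dim KK + vec.dim RR"
  proof -
    obtain BK where BK: "BK \<subseteq> KK" "vec.independent BK" "KK \<subseteq> vec.span BK" "card BK = vec.dim KK"
      by (rule vec.basis_exists)
    obtain BR where BR: "BR \<subseteq> RR" "vec.independent BR" "RR \<subseteq> vec.span BR" "card BR = vec.dim RR"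
      by (rule vec.basis_exists)
    have fin: "finite BK" "finite BR" using BK(2) BR(2) by (auto intro: vec.finiteI_independent)
    have wZ: "cinner (w k) (w l) = (if k = l then 1 else 0)" if "k \<in> Z" "l \<in> Z" for k l
      using that by (intro w) (auto simp: Z_def)
    note wi = orthonormal_imp_independent[OF finZ wZ]
    have "w ` Z \<subseteq> vec.span (BK \<union> BR)"
    proof
      fix v assume "v \<in> w ` Z"
      then obtain k where k: "k \<in> {1..?m}" "?r k = 0" "v = w k" by (auto simp: Z_def)
      then have "monodromy T1 T2 *v v = v" using eig[OF k(1)] by simp
      note mf = monodromy_fixed[OF T1 T2 this]
      have "T1 *v v \<in> RR" using mf(2) by (simp add: RR_def orth_proj_idem[OF T1])
      then have 1: "T1 *v v \<in> vec.span (BK \<union> BR)" using BR(3) vec.span_mono[of BR "BK \<union> BR"] by auto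
      have "v - T1 *v v \<in> KK"
        using mf(1) by (simp add: KK_def matrix_vector_mult_diff_distrib orth_proj_idem[OF T1])
      then have 2: "v - T1 *v v \<in> vec.span (BK \<union> BR)" using BK(3) vec.span_mono[of BK "BK \<union> BR"] by auto
      show "v \<in> vec.span (BK \<union> BR)" using vec.span_add[OF 1 2] by simp
    qed
    then have "card (w ` Z) \<le> card (BK \<union> BR)"
      using vec.independent_span_bound[of "BK \<union> BR" "w ` Z"] wi(2) fin by auto
    also have "\<dots> \<le> card BK + card BR" by (rule card_Un_le)
    finally show ?thesis using card_image[OF wi(1)] BK(4) BR(4) by simp
  qed
  obtain q where qR: "\<And>i. i < vec.dim RR \<Longrightarrow> q i \<in> RR"
    and q: "\<And>i j. i < vec.dim RR \<Longrightarrow> j < vec.dim RR \<Longrightarrow> cinner (q i) (q j) = (if i = (j::nat) then 1 else 0)"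
    using orthonormal_family_exists[OF subRR order_refl] by blast
  \<comment> \<open>The zeros are listed in increasing order, so every index up to \<open>k\<close>
    also has the value 0 and \<open>k \<le> card Z\<close>. After dropping the first
    \<open>p_perp\<close> indices at most \<open>vec.dim RR\<close> remain; \<open>q\<close> counts
    them from 0.\<close>
  have idx: "p_perp T1 T2 + 1 \<le> k \<and> k - (p_perp T1 T2 + 1) < vec.dim RR"
    if k: "(0, k) \<in> J_set T1 T2" "?r k = 0" for k
  proof -
    have k1: "p_perp T1 T2 + 1 \<le> k" "k \<le> ?m" using k(1) by (auto simp: J_set_def)
    have "{1..k} \<subseteq> Z"
    proof
      fix l assume l: "l \<in> {1..k}"
      then have "l \<in> {1..?m}" "k \<in> {1..?m}" using k1 by auto
      then show "l \<in> Z" using mono[of l k] r0[of l] k(2) l by (auto simp: Z_def)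
    qed
    from card_mono[OF finZ this] have "k \<le> card Z" by simp
    then show ?thesis using cardZ k1 p by linarith
  qed
  have mR: "monodromy T1 T2 *v v = v" if "v \<in> RR" for v
  proof -
    have h: "half_refl T1 *v v = v" using that by (simp add: RR_def half_refl_mv)
    have "reflection T2 *v v = 2 *s v - v" using that by (simp add: RR_def reflection_mv)
    also have "\<dots> = v" by (simp add: vec_eq_iff)
    finally show ?thesis by (simp add: monodromy_mv h)
  qed
  show ?thesis
  proof (intro exI[of _ "\<lambda>k. q (k - (p_perp T1 T2 + 1))"] conjI allI impI)
    fix k l assume kl: "(0, k) \<in> J_set T1 T2" "?r k = 0" "(0, l) \<in> J_set T1 T2" "?r l = 0"
    have "k - (p_perp T1 T2 + 1) = l - (p_perp T1 T2 + 1) \<longleftrightarrow> k = l"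
      using idx[OF kl(1,2)] idx[OF kl(3,4)] by linarith
    then show "cinner (q (k - (p_perp T1 T2 + 1))) (q (l - (p_perp T1 T2 + 1))) = (if k = l then 1 else 0)"
      using q idx[OF kl(1,2)] idx[OF kl(3,4)] by auto
  next
    fix k assume k: "(0, k) \<in> J_set T1 T2" "?r k = 0"
    have "q (k - (p_perp T1 T2 + 1)) \<in> RR" using qR idx[OF k] by auto
    then show "T1 *v q (k - (p_perp T1 T2 + 1)) = q (k - (p_perp T1 T2 + 1))"
      "monodromy T1 T2 *v q (k - (p_perp T1 T2 + 1)) = q (k - (p_perp T1 T2 + 1))"
      using mR by (auto simp: RR_def)
  qed
qed

lemma shifted_values_gap:
  fixes r :: "nat \<Rightarrow> real"
  assumes r: "\<And>k. k \<in> {1..m} \<Longrightarrow> 0 \<le> r k \<and> r k < 1"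
  shows "\<exists>g>0. \<forall>n n'. \<forall>k\<in>{1..m}. \<forall>l\<in>{1..m}. \<bar>(real n + r k) - (real n' + r l)\<bar> < g \<longrightarrow> n = n' \<and> r k = r l"
proof -
  \<comment> \<open>Differences below 1 in modulus occur only for \<open>j\<close> between -2 and 2,
    so finitely many nonzero distances decide the gap. The element 1 enforces this range and keeps
    \<open>D\<close> nonempty.\<close>
  define D where "D = insert 1 ((\<lambda>(j, k, l). \<bar>of_int j + (r k - r l)\<bar>) ` ({-2..2::int} \<times> {1..m} \<times> {1..m}) - {0})"
  have fin: "finite D" by (simp add: D_def)
  have pos: "0 < x" if "x \<in> D" for x using that by (auto simp: D_def)
  have "Min D > 0" using fin pos by (subst Min_gr_iff) (auto simp: D_def)
  moreover have "n = n' \<and> r k = r l"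
    if kl: "k \<in> {1..m}" "l \<in> {1..m}" and lt: "\<bar>(real n + r k) - (real n' + r l)\<bar> < Min D" for n n' k l
  proof -
    define j where "j = int n - int n'"
    have e: "(real n + r k) - (real n' + r l) = of_int j + (r k - r l)" by (simp add: j_def)
    have "Min D \<le> 1" using fin by (intro Min_le) (auto simp: D_def)
    then have lt1: "\<bar>of_int j + (r k - r l)\<bar> < 1" using lt e by simp
    have rr: "\<bar>r k - r l\<bar> < 1" using r[OF kl(1)] r[OF kl(2)] by linarith
    have "\<bar>real_of_int j\<bar> < 2" using lt1 rr by linarith
    then have "j \<in> {-2..2}" by auto
    then have "\<bar>of_int j + (r k - r l)\<bar> \<in> (\<lambda>(j, k, l). \<bar>of_int j + (r k - r l)\<bar>) ` ({-2..2::int} \<times> {1..m} \<times> {1..m})"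
      using kl by (intro image_eqI[of _ _ "(j, k, l)"]) auto
    then have "\<bar>of_int j + (r k - r l)\<bar> \<in> D \<or> \<bar>of_int j + (r k - r l)\<bar> = 0" by (auto simp: D_def)
    moreover have "\<bar>of_int j + (r k - r l)\<bar> \<notin> D"
      using lt e Min_le[OF fin] by force
    ultimately have z: "of_int j + (r k - r l) = 0" by simp
    then have "\<bar>real_of_int j\<bar> < 1" using rr by linarith
    then have "j = 0" by linarith
    then show ?thesis using z by (simp add: j_def)
  qed
  ultimately show ?thesis by blast
qed

text \<open>For large \<open>n\<close> a group of equal values stays inside one block, that is, has
  one \<open>n\<close> and one value of \<open>r\<close>, so \<open>block_almost_orthonormal\<close>
  applies blockwise. Gram-Schmidt stays in the span of its vectors, hence in the eigenspace, and
  makes them exactly orthonormal.\<close>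

lemma eventually_close_eigenvectors:
  fixes T1 T2 :: "complex ^ 'm ^ 'm"
    and \<rho> \<kappa> :: "nat \<times> nat \<Rightarrow> complex"
    and B K :: "nat \<times> nat \<Rightarrow> complex ^ 'm ^ 'm"
    and \<E> :: "nat \<times> nat \<Rightarrow> complex ^ 'm"
    and w :: "nat \<Rightarrow> complex^'m"
  defines "J \<equiv> J_set T1 T2" and "r \<equiv> zero_r T1 T2"
  assumes \<rho>: "\<forall>(n, k) \<in> J. \<rho> (n, k) = of_nat n + of_real (r k) + \<kappa> (n, k)"
    and \<kappa>: "(\<lambda>p. (norm (\<kappa> p))\<^sup>2) summable_on J"
    and psd: "\<forall>p \<in> J. psd (B p)"
    and Beq: "\<forall>p \<in> J. \<forall>q \<in> val_group J \<rho> p. B q = B p"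
    and Bsum: "\<forall>(n, k) \<in> J. B_sum T1 T2 \<rho> B n k = resA T1 T2 k + K (n, k)"
    and K: "(\<lambda>p. (mnorm (K p))\<^sup>2) summable_on J"
    and \<E>: "\<forall>p \<in> J. orthonormal_basis_fam (val_group J \<rho> p) \<E> (range (\<lambda>v. B p *v v))"
    and w: "\<And>k l. k \<in> {1..CARD('m)} \<Longrightarrow> l \<in> {1..CARD('m)} \<Longrightarrow> cinner (w k) (w l) = (if k = l then 1 else 0)"
    and r01: "\<And>k. k \<in> {1..CARD('m)} \<Longrightarrow> 0 \<le> r k \<and> r k < 1"
    and eig: "\<And>k. k \<in> {1..CARD('m)} \<Longrightarrow> monodromy T1 T2 *v w k = phase (r k) *s w k"
    and resA: "\<And>k v. k \<in> {1..CARD('m)} \<Longrightarrow> resA T1 T2 k *v v = (\<Sum>s | s \<in> {1..CARD('m)} \<and> r s = r k. cinner (w s) v *s w s)"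
  shows "\<exists>N C W. 1 \<le> N \<and> 0 \<le> C \<and> (\<forall>n\<ge>N. \<forall>k\<in>{1..CARD('m)}.
    norm (\<kappa> (n, k)) \<le> 1 \<and> \<rho> (n, k) \<noteq> 0 \<and> norm (\<E> (n, k)) = 1 \<and>
    norm (\<E> (n, k) - W n k) \<le> C * mnorm (K (n, k)) \<and>
    monodromy T1 T2 *v W n k = phase (r k) *s W n k \<and>
    (\<forall>l\<in>{1..CARD('m)}. r l = r k \<longrightarrow> cinner (W n k) (W n l) = (if k = l then 1 else 0)))"
proof -
  let ?m = "CARD('m)"
  have Jn: "(n, k) \<in> J \<longleftrightarrow> k \<in> {1..?m}" if "1 \<le> n" for n k
    using J_set_iff[OF that, of k T1 T2] by (simp add: J_def)
  have Bsum': "B_sum T1 T2 \<rho> B n k = resA T1 T2 k + K (n, k)" if "(n, k) \<in> J" for n k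
    using Bsum that by blast
  have Js: "(n, k) \<in> J \<Longrightarrow> k \<in> {1..?m}" for n k using J_set_snd[of n k T1 T2] by (simp add: J_def)
  obtain C \<delta> where C: "C > 0" and \<delta>: "\<delta> > 0" and GS:
    "\<And>(I::nat set) (v :: nat \<Rightarrow> complex^'m) \<epsilon>. finite I \<Longrightarrow> card I \<le> ?m \<Longrightarrow> 0 \<le> \<epsilon> \<Longrightarrow> \<epsilon> \<le> \<delta> \<Longrightarrow>
    (\<forall>i\<in>I. \<forall>j\<in>I. cmod (cinner (v i) (v j) - (if i = j then 1 else 0)) \<le> \<epsilon>) \<Longrightarrow>
    (\<exists>e. (\<forall>i\<in>I. \<forall>j\<in>I. cinner (e i) (e j) = (if i = j then 1 else 0)) \<and>
      (\<forall>i\<in>I. e i \<in> vec.span (v ` I) \<and> norm (e i - v i) \<le> C * \<epsilon>))"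
    using quantitative_gram_schmidt[of ?m, where 'm = 'm] by metis
  obtain g where g: "g > 0" and gap: "\<And>n n' k l. k \<in> {1..?m} \<Longrightarrow> l \<in> {1..?m} \<Longrightarrow>
      \<bar>(real n + r k) - (real n' + r l)\<bar> < g \<Longrightarrow> n = n' \<and> r k = r l"
    using shifted_values_gap[of ?m r, OF r01] by blast
  \<comment> \<open>Two values with shifts below half the gap can coincide only if the unperturbed
    values do.\<close>
  define \<eta> where "\<eta> = min (g/2) 1"
  \<comment> \<open>1/2 is the bound on the perturbation in \<open>block_almost_orthonormal\<close>;
    its defect of six times the norm must stay within the tolerance \<open>\<delta>\<close> of
    Gram-Schmidt.\<close>
  define \<delta>' where "\<delta>' = min (1/2) (\<delta> / 6)"
  have \<eta>: "\<eta> > 0" "\<eta> \<le> 1" "2 * \<eta> \<le> g" and \<delta>': "\<delta>' > 0" "\<delta>' \<le> 1/2" "6 * \<delta>' \<le> \<delta>"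
    using g \<delta> by (auto simp: \<eta>_def \<delta>'_def min_def)
  define Bad where "Bad = {p \<in> J. \<eta>\<^sup>2 \<le> (norm (\<kappa> p))\<^sup>2}"
  define BadK where "BadK = {p \<in> J. \<delta>'\<^sup>2 \<le> (mnorm (K p))\<^sup>2}"
  have fin: "finite Bad" "finite BadK"
    unfolding Bad_def BadK_def
    by (rule finite_superlevel_summable[OF \<kappa> zero_le_power2 zero_less_power[OF \<eta>(1)]],
        rule finite_superlevel_summable[OF K zero_le_power2 zero_less_power[OF \<delta>'(1)]])
  \<comment> \<open>Values with a large shift may lie anywhere, but they are finitely many and
    bounded by \<open>R\<close>.\<close>
  define R where "R = (\<Sum>p\<in>Bad. norm (\<rho> p))"
  have R: "norm (\<rho> p) \<le> R" if "p \<in> Bad" for p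
    unfolding R_def by (rule member_le_sum[OF that]) (use fin in auto)
  have "finite (fst ` (Bad \<union> BadK))" using fin by simp
  then obtain N0 where N0: "\<And>p. p \<in> Bad \<union> BadK \<Longrightarrow> fst p < N0"
    by (auto simp: finite_nat_set_iff_bounded)
  \<comment> \<open>For \<open>n \<ge> N\<close> one has \<open>n > R + 1\<close>, so with a shift
    below 1 the value has modulus above \<open>R\<close> and cannot meet an exceptional one.\<close>
  define N where "N = max N0 (nat \<lceil>R\<rceil> + 2)"
  have N1: "1 \<le> N" by (simp add: N_def)
  have NR: "R + 1 < real n" if "N \<le> n" for n
  proof -
    have "R \<le> real (nat \<lceil>R\<rceil>)" by (rule real_nat_ceiling_ge)
    moreover have "nat \<lceil>R\<rceil> + 2 \<le> n" using that by (simp add: N_def)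
    ultimately show ?thesis by linarith
  qed
  have R0: "0 \<le> R" by (simp add: R_def sum_nonneg)
  have good: "(n, k) \<in> J" "norm (\<kappa> (n, k)) < \<eta>" "mnorm (K (n, k)) < \<delta>'"
    if n: "N \<le> n" and k: "k \<in> {1..?m}" for n k
  proof -
    show Jnk: "(n, k) \<in> J" using Jn[of n k] N1 n k by auto
    have nb: "(n, k) \<notin> Bad \<union> BadK" using N0[of "(n, k)"] n by (auto simp: N_def)
    then have "(norm (\<kappa> (n, k)))\<^sup>2 < \<eta>\<^sup>2" "(mnorm (K (n, k)))\<^sup>2 < \<delta>'\<^sup>2"
      using Jnk by (auto simp: Bad_def BadK_def)
    then show "norm (\<kappa> (n, k)) < \<eta>" "mnorm (K (n, k)) < \<delta>'"
      using \<eta>(1) \<delta>'(1) power2_less_imp_less less_imp_le by blast+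
  qed
  have \<rho>R: "R < norm (\<rho> (n, k))" if n: "N \<le> n" and k: "k \<in> {1..?m}" for n k
  proof -
    have "\<rho> (n, k) = of_real (real n + r k) + \<kappa> (n, k)" using \<rho> good(1)[OF n k] by auto
    then have "norm (\<rho> (n, k)) \<ge> norm (complex_of_real (real n + r k)) - norm (\<kappa> (n, k))"
      using norm_diff_ineq[of "complex_of_real (real n + r k)" "\<kappa> (n, k)"] by simp
    then have "norm (\<rho> (n, k)) \<ge> \<bar>real n + r k\<bar> - norm (\<kappa> (n, k))" by (simp only: norm_of_real)
    then show ?thesis using NR[OF n] good(2)[OF n k] \<eta>(2) r01[OF k] by linarith
  qed
  have group: "n' = n \<and> r l = r k"
    if n: "N \<le> n" and k: "k \<in> {1..?m}" and q: "(n', l) \<in> J" and eq: "\<rho> (n', l) = \<rho> (n, k)" for n n' k l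
  proof -
    have "(n', l) \<notin> Bad" using R[of "(n', l)"] \<rho>R[OF n k] eq by auto
    then have "(norm (\<kappa> (n', l)))\<^sup>2 < \<eta>\<^sup>2" using q by (auto simp: Bad_def)
    then have k': "norm (\<kappa> (n', l)) < \<eta>" by (rule power2_less_imp_less) (use \<eta> in simp)
    have "\<rho> (n', l) = of_real (real n' + r l) + \<kappa> (n', l)" "\<rho> (n, k) = of_real (real n + r k) + \<kappa> (n, k)"
      using \<rho> q good(1)[OF n k] by auto
    then have "complex_of_real ((real n' + r l) - (real n + r k)) = \<kappa> (n, k) - \<kappa> (n', l)"
      using eq by (simp add: algebra_simps)
    then have "\<bar>(real n' + r l) - (real n + r k)\<bar> = norm (\<kappa> (n, k) - \<kappa> (n', l))"
      by (metis norm_of_real)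
    also have "\<dots> \<le> norm (\<kappa> (n, k)) + norm (\<kappa> (n', l))" by (rule norm_triangle_ineq4)
    also have "\<dots> < g" using k' good(2)[OF n k] \<eta>(3) by linarith
    finally show ?thesis using gap[OF Js[OF q] k] by blast
  qed
  have vg: "val_group J \<rho> (n, k) = Pair n ` {t \<in> {1..?m}. r t = r k \<and> \<rho> (n, t) = \<rho> (n, k)}"
    if n: "N \<le> n" and k: "k \<in> {1..?m}" for n k
  proof (intro equalityI subsetI)
    fix q assume "q \<in> val_group J \<rho> (n, k)"
    then obtain n' l where q: "q = (n', l)" "(n', l) \<in> J" "\<rho> (n', l) = \<rho> (n, k)"
      by (cases q) (auto simp: val_group_def)
    from group[OF n k q(2,3)] show "q \<in> Pair n ` {t \<in> {1..?m}. r t = r k \<and> \<rho> (n, t) = \<rho> (n, k)}"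
      using q Js[OF q(2)] by auto
  qed (use good(1)[OF n] in \<open>auto simp: val_group_def\<close>)
  have block: "\<exists>e. (\<forall>s\<in>{1..?m}. r s = \<gamma> \<longrightarrow> norm (\<E> (n, s) - e s) \<le> (6 * C + 2) * mnorm (K (n, s)) \<and>
      monodromy T1 T2 *v e s = phase \<gamma> *s e s \<and>
      (\<forall>t\<in>{1..?m}. r t = \<gamma> \<longrightarrow> cinner (e s) (e t) = (if s = t then 1 else 0)))"
    if n: "N \<le> n" and \<gamma>: "\<gamma> \<in> r ` {1..?m}" for n \<gamma>
  proof -
    obtain k where k: "k \<in> {1..?m}" "\<gamma> = r k" using \<gamma> by auto
    define I where "I = {s \<in> {1..?m}. r s = r k}"
    have fI: "finite I" and Im: "\<And>s. s \<in> I \<Longrightarrow> s \<in> {1..?m}" and Ir: "\<And>s. s \<in> I \<Longrightarrow> r s = r k"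
      by (auto simp: I_def)
    have cI: "card I \<le> ?m" using card_mono[OF finite_atLeastAtMost subsetI[OF Im]] by simp
    have vgI: "val_group J \<rho> (n, s) = Pair n ` {t \<in> I. \<rho> (n, t) = \<rho> (n, s)}" if "s \<in> I" for s
      unfolding vg[OF n Im[OF that]] using Ir[OF that] by (auto simp: I_def)
    \<comment> \<open>\<open>B_sum\<close> and \<open>resA\<close> depend on the index
      \<open>s\<close> only through \<open>r s\<close>, so the remainder is common to the block and
      one norm serves all its vectors.\<close>
    have KI: "K (n, s) = K (n, k)" if s: "s \<in> I" for s
    proof -
      have "resA T1 T2 s + K (n, s) = resA T1 T2 k + K (n, k)"
      proof -
        have "B_sum T1 T2 \<rho> B n s = B_sum T1 T2 \<rho> B n k" using Ir[OF s] by (simp add: B_sum_def r_def)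
        then show ?thesis using Bsum' good(1)[OF n Im[OF s]] good(1)[OF n k(1)] by simp
      qed
      moreover have "resA T1 T2 s = resA T1 T2 k" using Ir[OF s] by (simp add: resA_def r_def)
      ultimately show ?thesis by simp
    qed
    define Bf where "Bf t = B_first J \<rho> B (n, t)" for t
    \<comment> \<open>Only the first member of a group keeps its matrix, so the sum over the group
      returns the matrix common to its members.\<close>
    have Msum: "(\<Sum>t | t \<in> I \<and> \<rho> (n, t) = \<rho> (n, s). Bf t) = B (n, s)" if s: "s \<in> I" for s
    proof -
      let ?G = "{t. t \<in> I \<and> \<rho> (n, t) = \<rho> (n, s)}"
      have fG: "finite ?G" "?G \<noteq> {}" using fI s by auto
      define t0 where "t0 = Min ?G"
      have t0: "t0 \<in> ?G" "\<And>t. t \<in> ?G \<Longrightarrow> t0 \<le> t" unfolding t0_def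
        by (rule Min_in[OF fG], rule Min_le[OF fG(1)])
      have "Bf t = (if t = t0 then B (n, s) else 0)" if t: "t \<in> ?G" for t
      proof -
        have tI: "t \<in> I" using t by simp
        have vgt: "val_group J \<rho> (n, t) = Pair n ` ?G" unfolding vgI[OF tI] using t by auto
        have "(n, s) \<in> val_group J \<rho> (n, t)" unfolding vgt using s by auto
        then have Bs: "B (n, s) = B (n, t)" using Beq good(1)[OF n Im[OF tI]] by blast
        have "(\<forall>q \<in> val_group J \<rho> (n, t). (q, (n, t)) \<notin> less_than <*lex*> less_than) \<longleftrightarrow> t = t0"
          unfolding vgt using t0 t by force
        then show ?thesis by (simp add: Bf_def B_first_def Bs)
      qed
      then have "(\<Sum>t\<in>?G. Bf t) = (\<Sum>t\<in>?G. if t = t0 then B (n, s) else 0)" by (intro sum.cong) auto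
      also have "\<dots> = B (n, s)" using fG(1) t0(1) by simp
      finally show ?thesis .
    qed
    have fam: "orthonormal_basis_fam (Pair n ` {t \<in> I. \<rho> (n, t) = \<rho> (n, s)}) \<E> (range (\<lambda>v. B (n, s) *v v))"
      if "s \<in> I" for s
      using \<E> good(1)[OF n Im[OF that]] vgI[OF that] by auto
    define kk where "kk = mnorm (K (n, k))"
    have kk: "0 \<le> kk" "kk \<le> 1/2" "6 * kk \<le> \<delta>"
      using norm_matrix_vector_le_mnorm(2)[of "K (n, k)"] good(3)[OF n k(1)] \<delta>' by (auto simp: kk_def)
    have "\<exists>v. (\<forall>s\<in>I. v s \<in> vec.span (w ` I) \<and> norm (\<E> (n, s) - v s) \<le> 2 * kk) \<and>
      (\<forall>s\<in>I. \<forall>t\<in>I. cmod (cinner (v s) (v t) - (if s = t then 1 else 0)) \<le> 6 * kk)"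
    proof (rule block_almost_orthonormal[where A = "resA T1 T2 k" and K = "K (n, k)" and B = Bf and g = "\<lambda>t. \<rho> (n, t)"])
      show "resA T1 T2 k *v v = (\<Sum>s\<in>I. cinner (w s) v *s w s)" for v
        unfolding resA[OF k(1)] by (simp add: I_def)
      show "cinner (\<E> (n, s)) (\<E> (n, t)) = (if s = t then 1 else 0)"
        if "s \<in> I" "t \<in> I" "\<rho> (n, s) = \<rho> (n, t)" for s t
      proof -
        have "(n, s) \<in> Pair n ` {t \<in> I. \<rho> (n, t) = \<rho> (n, s)}" "(n, t) \<in> Pair n ` {t \<in> I. \<rho> (n, t) = \<rho> (n, s)}"
          using that by auto
        then have "cinner (\<E> (n, s)) (\<E> (n, t)) = (if (n, s) = (n, t) then 1 else 0)"
          using fam[OF that(1)] unfolding orthonormal_basis_fam_def by blast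
        then show ?thesis by simp
      qed
      show "ctransp (\<Sum>t | t \<in> I \<and> \<rho> (n, t) = c. Bf t) = (\<Sum>t | t \<in> I \<and> \<rho> (n, t) = c. Bf t)"
        if c: "c \<in> (\<lambda>t. \<rho> (n, t)) ` I" for c
      proof -
        obtain s where s: "s \<in> I" "c = \<rho> (n, s)" using c by auto
        have "psd (B (n, s))" using psd good(1)[OF n Im[OF s(1)]] by blast
        then have "B (n, s) = ctransp (B (n, s))" by (simp only: psd_def)
        then show ?thesis unfolding s(2) Msum[OF s(1)] by (rule sym)
      qed
      show "range ((*v) (\<Sum>t | t \<in> I \<and> \<rho> (n, t) = c. Bf t)) = vec.span ((\<lambda>s. \<E> (n, s)) ` {t \<in> I. \<rho> (n, t) = c})"
        if c: "c \<in> (\<lambda>t. \<rho> (n, t)) ` I" for c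
      proof -
        obtain s where s: "s \<in> I" "c = \<rho> (n, s)" using c by auto
        have "vec.span (\<E> ` Pair n ` {t \<in> I. \<rho> (n, t) = \<rho> (n, s)}) = range (\<lambda>v. B (n, s) *v v)"
          using fam[OF s(1)] by (simp add: orthonormal_basis_fam_def)
        then show ?thesis unfolding s(2) Msum[OF s(1)] by (simp add: image_image)
      qed
      show "(\<Sum>t\<in>I. Bf t) = resA T1 T2 k + K (n, k)"
      proof -
        have "{s \<in> {1..?m}. (n, s) \<in> J_set T1 T2 \<and> zero_r T1 T2 s = zero_r T1 T2 k} = I"
          using good(1)[OF n] by (auto simp: I_def J_def r_def)
        then have "B_sum T1 T2 \<rho> B n k = (\<Sum>t\<in>I. Bf t)" by (simp add: B_sum_def Bf_def J_def)
        then show ?thesis using Bsum'[OF good(1)[OF n k(1)]] by simp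
      qed
      show "norm (K (n, k) *v v) \<le> kk * norm v" for v
        unfolding kk_def by (rule norm_matrix_vector_le_mnorm(1))
    qed (use fI kk w Im in auto)
    then obtain v where v: "\<And>s. s \<in> I \<Longrightarrow> v s \<in> vec.span (w ` I)" "\<And>s. s \<in> I \<Longrightarrow> norm (\<E> (n, s) - v s) \<le> 2 * kk"
      and vv: "\<forall>s\<in>I. \<forall>t\<in>I. cmod (cinner (v s) (v t) - (if s = t then 1 else 0)) \<le> 6 * kk" by blast
    obtain e where e: "\<And>i j. i \<in> I \<Longrightarrow> j \<in> I \<Longrightarrow> cinner (e i) (e j) = (if i = j then 1 else 0)"
      and es: "\<And>i. i \<in> I \<Longrightarrow> e i \<in> vec.span (v ` I)" and ev: "\<And>i. i \<in> I \<Longrightarrow> norm (e i - v i) \<le> C * (6 * kk)"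
      using GS[OF fI cI _ kk(3) vv] kk(1) by auto
    \<comment> \<open>Eigenspaces are subspaces, and \<open>e s\<close> lies in the span of the
      \<open>v t\<close>, which lie in the span of the \<open>w t\<close>.\<close>
    have eg: "monodromy T1 T2 *v e s = phase \<gamma> *s e s" if s: "s \<in> I" for s
    proof -
      let ?S = "{x. monodromy T1 T2 *v x = phase \<gamma> *s x}"
      have sub: "vec.subspace ?S"
        by (auto simp: vec.subspace_def matrix_vector_right_distrib matrix_vector_mult_cscale
            vec.scale_right_distrib mult.commute)
      have "w ` I \<subseteq> ?S" using eig Im Ir k(2) by auto
      then have "vec.span (w ` I) \<subseteq> ?S" by (rule vec.span_minimal[OF _ sub])
      then have "v ` I \<subseteq> ?S" using v(1) by auto
      then have "vec.span (v ` I) \<subseteq> ?S" by (rule vec.span_minimal[OF _ sub])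
      then show ?thesis using es[OF s] by auto
    qed
    have close: "norm (\<E> (n, s) - e s) \<le> (6 * C + 2) * mnorm (K (n, s))" if s: "s \<in> I" for s
    proof -
      have "norm (\<E> (n, s) - e s) \<le> norm (\<E> (n, s) - v s) + norm (v s - e s)"
        using norm_triangle_ineq[of "\<E> (n, s) - v s" "v s - e s"] by simp
      also have "\<dots> \<le> 2 * kk + C * (6 * kk)"
        using v(2)[OF s] ev[OF s] by (simp add: norm_minus_commute)
      finally show ?thesis by (simp add: KI[OF s] kk_def algebra_simps)
    qed
    show ?thesis
    proof (intro exI[of _ e] ballI impI conjI)
      fix s assume "s \<in> {1..?m}" "r s = \<gamma>"
      then have s: "s \<in> I" using k by (simp add: I_def)
      show "norm (\<E> (n, s) - e s) \<le> (6 * C + 2) * mnorm (K (n, s))" by (rule close[OF s])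
      show "monodromy T1 T2 *v e s = phase \<gamma> *s e s" by (rule eg[OF s])
      fix t assume "t \<in> {1..?m}" "r t = \<gamma>"
      then have t: "t \<in> I" using k by (simp add: I_def)
      show "cinner (e s) (e t) = (if s = t then 1 else 0)" by (rule e[OF s t])
    qed
  qed
  then obtain W where W: "\<And>n \<gamma> s. N \<le> n \<Longrightarrow> \<gamma> \<in> r ` {1..?m} \<Longrightarrow> s \<in> {1..?m} \<Longrightarrow> r s = \<gamma> \<Longrightarrow>
      norm (\<E> (n, s) - W n \<gamma> s) \<le> (6 * C + 2) * mnorm (K (n, s)) \<and>
      monodromy T1 T2 *v W n \<gamma> s = phase \<gamma> *s W n \<gamma> s \<and>
      (\<forall>t\<in>{1..?m}. r t = \<gamma> \<longrightarrow> cinner (W n \<gamma> s) (W n \<gamma> t) = (if s = t then 1 else 0))"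
    by metis
  show ?thesis
  proof (intro exI[of _ N] exI[of _ "6 * C + 2"] exI[of _ "\<lambda>n k. W n (r k) k"] conjI allI ballI impI)
    show "1 \<le> N" by (rule N1)
    show "0 \<le> 6 * C + 2" using C by simp
    fix n k assume n: "N \<le> n" and k: "k \<in> {1..?m}"
    note Wk = W[OF n imageI[OF k] k refl]
    show "norm (\<kappa> (n, k)) \<le> 1" using good(2)[OF n k] \<eta>(2) by simp
    show "\<rho> (n, k) \<noteq> 0" using \<rho>R[OF n k] R0 by auto
    have "(n, k) \<in> val_group J \<rho> (n, k)" using good(1)[OF n k] by (simp add: val_group_def)
    then have "cinner (\<E> (n, k)) (\<E> (n, k)) = 1"
      using \<E> good(1)[OF n k] unfolding orthonormal_basis_fam_def by auto
    then show "norm (\<E> (n, k)) = 1" by (rule norm_orthonormal)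
    show "norm (\<E> (n, k) - W n (r k) k) \<le> (6 * C + 2) * mnorm (K (n, k))"
      "monodromy T1 T2 *v W n (r k) k = phase (r k) *s W n (r k) k"
      using Wk by auto
    fix l assume "l \<in> {1..?m}" "r l = r k"
    then show "cinner (W n (r k) k) (W n (r l) l) = (if k = l then 1 else 0)" using Wk by auto
  qed
qed

section \<open>The Riesz basis property\<close>

theorem theorem5p2:
  fixes T1 T2 :: "complex ^ 'm ^ 'm"
    and \<rho> \<kappa> :: "nat \<times> nat \<Rightarrow> complex"
    and B K :: "nat \<times> nat \<Rightarrow> complex ^ 'm ^ 'm"
    and \<E> :: "nat \<times> nat \<Rightarrow> complex ^ 'm"
  assumes "orth_proj T1" and "orth_proj T2"
    and "\<forall>(n, k) \<in> J_set T1 T2. \<rho> (n, k) = of_nat n + of_real (zero_r T1 T2 k) + \<kappa> (n, k)"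
    and "(\<lambda>p. (norm (\<kappa> p))\<^sup>2) summable_on J_set T1 T2"
    and "\<forall>p \<in> J_set T1 T2. psd (B p)"
    and "\<forall>p \<in> J_set T1 T2. \<forall>q \<in> val_group (J_set T1 T2) \<rho> p. B q = B p"
    and "\<forall>p \<in> J_set T1 T2. rank (B p) = card (val_group (J_set T1 T2) \<rho> p)"
    and "\<forall>(n, k) \<in> J_set T1 T2. B_sum T1 T2 \<rho> B n k = resA T1 T2 k + K (n, k)"
    and "(\<lambda>p. (mnorm (K p))\<^sup>2) summable_on J_set T1 T2"
    and "\<forall>p \<in> J_set T1 T2.
           orthonormal_basis_fam (val_group (J_set T1 T2) \<rho> p) \<E> (range (\<lambda>v. B p *v v))"
    and "L2_complete (J_set T1 T2) (\<lambda>p. Yfun T1 (\<rho> p) (\<E> p))"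
  shows "L2_riesz_basis (J_set T1 T2) (\<lambda>p. Yfun T1 (\<rho> p) (\<E> p))"
proof -
  let ?m = "CARD('m)" and ?J = "J_set T1 T2" and ?r = "zero_r T1 T2"
  note T = assms(1,2)
  obtain w where w: "\<And>k l. k \<in> {1..?m} \<Longrightarrow> l \<in> {1..?m} \<Longrightarrow> cinner (w k) (w l) = (if k = l then 1 else 0)"
    and r01: "\<And>k. k \<in> {1..?m} \<Longrightarrow> 0 \<le> ?r k \<and> ?r k < 1"
    and eigw: "\<And>k. k \<in> {1..?m} \<Longrightarrow> monodromy T1 T2 *v w k = phase (?r k) *s w k"
    and resA: "\<And>k v. k \<in> {1..?m} \<Longrightarrow> resA T1 T2 k *v v = (\<Sum>s | s \<in> {1..?m} \<and> ?r s = ?r k. cinner (w s) v *s w s)"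
    and mono: "\<And>k l. k \<in> {1..?m} \<Longrightarrow> l \<in> {1..?m} \<Longrightarrow> k \<le> l \<Longrightarrow> ?r k \<le> ?r l"
    using spectral_data[OF T] by blast
  have r0: "0 \<le> ?r k" if "k \<in> {1..?m}" for k using r01[OF that] by simp
  obtain b where b: "\<And>k l. (0, k) \<in> ?J \<Longrightarrow> ?r k = 0 \<Longrightarrow> (0, l) \<in> ?J \<Longrightarrow> ?r l = 0 \<Longrightarrow>
      cinner (b k) (b l) = (if k = l then 1 else 0)"
    "\<And>k. (0, k) \<in> ?J \<Longrightarrow> ?r k = 0 \<Longrightarrow> T1 *v b k = b k \<and> monodromy T1 T2 *v b k = b k"
    using zero_modes[OF T w r0 eigw mono] by blast
  obtain N C V where N: "1 \<le> N" and C: "0 \<le> C" and V: "\<And>n k. N \<le> n \<Longrightarrow> k \<in> {1..?m} \<Longrightarrow>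
      norm (\<kappa> (n, k)) \<le> 1 \<and> \<rho> (n, k) \<noteq> 0 \<and> norm (\<E> (n, k)) = 1 \<and>
      norm (\<E> (n, k) - V n k) \<le> C * mnorm (K (n, k)) \<and>
      monodromy T1 T2 *v V n k = phase (?r k) *s V n k \<and>
      (\<forall>l\<in>{1..?m}. ?r l = ?r k \<longrightarrow> cinner (V n k) (V n l) = (if k = l then 1 else 0))"
    using eventually_close_eigenvectors[OF assms(3,4,5,6,8,9,10) w r01 eigw resA] by blast
  define a where "a = (\<lambda>(n, k). real n + ?r k)"
  \<comment> \<open>For large \<open>n\<close> these are the eigenvectors close to
    \<open>\<E>\<close>; at the value 0 they are vectors fixed by \<open>T1\<close>; for the
    finitely many other indices any orthonormal eigenvectors do. As \<open>N\<close> is at least 1,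
    the first two cases do not meet.\<close>
  define W where "W = (\<lambda>(n, k). if N \<le> n then V n k else if n = 0 \<and> ?r k = 0 then b k else w k)"
  define e where "e p x = complex_of_real (sqrt ((if a p = 0 then 1 else 2) / pi)) *s mode T1 (of_real (a p)) (W p) x"
    for p x
  have snd: "k \<in> {1..?m}" if "(n, k) \<in> ?J" for n k using that by (rule J_set_snd)
  \<comment> \<open>Since \<open>?r k\<close> lies in [0, 1), both \<open>n\<close> and
    \<open>?r k\<close> can be read off their sum; equal values therefore fall under the same case
    of \<open>W\<close>.\<close>
  have a_eq: "n = n' \<and> ?r k = ?r l" if "(n, k) \<in> ?J" "(n', l) \<in> ?J" "a (n, k) = a (n', l)" for n k n' l
  proof -
    have eq: "real n + ?r k = real n' + ?r l" using that(3) by (simp add: a_def)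
    then have "real n < real (Suc n')" "real n' < real (Suc n)"
      using r01[OF snd[OF that(1)]] r01[OF snd[OF that(2)]] by auto
    then have "n = n'" unfolding of_nat_less_iff by linarith
    then show ?thesis using eq by simp
  qed
  have a0: "n = 0 \<and> ?r k = 0" if "(n, k) \<in> ?J" "a (n, k) = 0" for n k
    using that(2) r01[OF snd[OF that(1)]] by (simp add: a_def)
  have eig: "monodromy T1 T2 *v W p = phase (a p) *s W p" if p: "p \<in> ?J" for p
  proof -
    obtain n k where nk: "p = (n, k)" by (cases p)
    have k: "k \<in> {1..?m}" using p unfolding nk by (rule snd)
    have "phase (a p) =
        exp (2 * of_real pi * \<i> * of_real (?r k) + \<i> * (of_int (int n) * (of_real pi * 2)))"
      by (simp add: nk a_def algebra_simps)
    also have "\<dots> = phase (?r k)"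
      by (simp only: exp_plus_2pin)
    finally have *: "phase (a p) = phase (?r k)" .
    show ?thesis
      unfolding * using V[of n k] b(2)[of k] eigw[OF k] k p by (auto simp: W_def nk)
  qed
  have on: "cinner (W p) (W q) = (if p = q then 1 else 0)" if p: "p \<in> ?J" and q: "q \<in> ?J" and pq: "a p = a q" for p q
  proof -
    obtain n k n' l where nk: "p = (n, k)" "q = (n', l)" by (cases p, cases q)
    have k: "k \<in> {1..?m}" "l \<in> {1..?m}" using p q unfolding nk by (auto dest: snd)
    have nn: "n = n'" "?r k = ?r l" using a_eq[of n k n' l] p q pq by (auto simp: nk)
    consider "N \<le> n" | "n < N" "n = 0" "?r k = 0" | "n < N" "\<not> (n = 0 \<and> ?r k = 0)" by linarith
    then show ?thesis
    proof cases
      case 1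
      then show ?thesis using V[OF 1 k(1)] k nn by (auto simp: W_def nk)
    next
      case 2
      then show ?thesis using b(1)[of k l] p q nn by (auto simp: W_def nk)
    next
      case 3
      then show ?thesis using w[OF k] nn by (auto simp: W_def nk)
    qed
  qed
  have zero: "T1 *v W p = W p" if p: "p \<in> ?J" and ap: "a p = 0" for p
  proof -
    obtain n k where nk: "p = (n, k)" by (cases p)
    have "n = 0" "?r k = 0" using a0[of n k] p ap by (auto simp: nk)
    then show ?thesis using b(2)[of k] p N by (auto simp: W_def nk)
  qed
  have a_nonneg: "0 \<le> a p" if "p \<in> ?J" for p
    using that r0[OF snd] by (cases p) (auto simp: a_def intro: add_nonneg_nonneg)
  have eL2: "e p \<in> L2" for p
    unfolding e_def by (intro L2_cscale mode_L2)
  have orth: "L2_inner (e p) (e q) = (if p = q then 1 else 0)" if "p \<in> ?J" "q \<in> ?J" for p q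
    unfolding e_def by (rule modes_orthonormal[OF T a_nonneg eig on zero that])
  \<comment> \<open>The normalising factor of the modes with nonzero value, to which all indices
    with \<open>n \<ge> N\<close> belong.\<close>
  define c where "c = sqrt (2 / pi)"
  have c: "0 < c" by (simp add: c_def)
  define A where "A = 3 * exp pi * pi"
  \<comment> \<open>The squared bound of \<open>mode_perturbation\<close>, split by
    \<open>(u + v)\<^sup>2 \<le> 2 * u\<^sup>2 + 2 * v\<^sup>2\<close> into two summable families;
    pi is the length of the interval.\<close>
  define h where "h p = 2 * pi * c\<^sup>2 * A\<^sup>2 * (norm (\<kappa> p))\<^sup>2 + 2 * pi * c\<^sup>2 * (3 * C)\<^sup>2 * (mnorm (K p))\<^sup>2" for p
  let ?Y = "\<lambda>p. Yfun T1 (\<rho> p) (\<E> p)"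
  let ?F = "{p \<in> ?J. fst p < N}"
  have bound: "(L2_nrm (\<lambda>x. c *\<^sub>R ?Y p x - e p x))\<^sup>2 \<le> h p" if p: "p \<in> ?J - ?F" for p
  proof -
    obtain n k where nk: "p = (n, k)" by (cases p)
    have k: "k \<in> {1..?m}" and n: "N \<le> n" using p snd by (auto simp: nk)
    note Vk = V[OF n k]
    have Wp: "W p = V n k" using n by (simp add: W_def nk)
    have "0 < a p" using n N r0[OF k] by (simp add: a_def nk)
    then have ep: "e p x = c *\<^sub>R mode T1 (of_real (a p)) (W p) x" for x
      by (simp add: e_def c_def of_real_vector_scalar_mult)
    have \<rho>p: "\<rho> p = of_real (a p) + \<kappa> p" using assms(3) p by (auto simp: nk a_def)
    have Yp: "?Y p = mode T1 (of_real (a p) + \<kappa> p) (\<E> p)"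
      using Yfun_eq_mode[of "\<rho> p" T1 "\<E> p"] Vk by (simp add: nk \<rho>p[unfolded nk])
    have "norm (c *\<^sub>R ?Y p x - e p x) \<le> c * (A * norm (\<kappa> p) + 3 * (C * mnorm (K p)))"
      if x: "0 \<le> x" "x \<le> pi" for x
    proof -
      have "norm (c *\<^sub>R ?Y p x - e p x) = c * norm (mode T1 (of_real (a p) + \<kappa> p) (\<E> p) x - mode T1 (of_real (a p)) (W p) x)"
        using c by (simp add: ep Yp flip: scaleR_diff_right)
      also have "\<dots> \<le> c * (A * norm (\<kappa> p) + 3 * norm (\<E> p - W p))"
        unfolding A_def using c Vk by (intro mult_left_mono mode_perturbation[OF T(1) x]) (auto simp: nk)
      also have "\<dots> \<le> c * (A * norm (\<kappa> p) + 3 * (C * mnorm (K p)))"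
        using c Vk unfolding Wp by (intro mult_left_mono add_left_mono) (auto simp: nk)
      finally show ?thesis .
    qed
    moreover have "(\<lambda>x. c *\<^sub>R ?Y p x - e p x) \<in> L2"
      unfolding Yp by (intro L2_diff L2_scaleR mode_L2 eL2)
    ultimately have "(L2_nrm (\<lambda>x. c *\<^sub>R ?Y p x - e p x))\<^sup>2 \<le> pi * (c * (A * norm (\<kappa> p) + 3 * (C * mnorm (K p))))\<^sup>2"
      by (intro L2_nrm_le_sup)
    also have "\<dots> = pi * c\<^sup>2 * (A * norm (\<kappa> p) + 3 * (C * mnorm (K p)))\<^sup>2" by (simp add: power_mult_distrib)
    also have "\<dots> \<le> pi * c\<^sup>2 * (2 * (A * norm (\<kappa> p))\<^sup>2 + 2 * (3 * (C * mnorm (K p)))\<^sup>2)"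
    proof (intro mult_left_mono)
      have "(u + v)\<^sup>2 \<le> 2 * u\<^sup>2 + 2 * v\<^sup>2" for u v :: real
        using zero_le_power2[of "u - v"] by (simp add: power2_eq_square algebra_simps)
      then show "(A * norm (\<kappa> p) + 3 * (C * mnorm (K p)))\<^sup>2 \<le> 2 * (A * norm (\<kappa> p))\<^sup>2 + 2 * (3 * (C * mnorm (K p)))\<^sup>2" .
    qed simp
    also have "\<dots> = h p" by (simp add: h_def power_mult_distrib algebra_simps)
    finally show ?thesis .
  qed
  have smh: "h summable_on ?J"
    unfolding h_def by (intro summable_on_add summable_on_cmult_right assms(4,9))
  have "(\<lambda>p. (L2_nrm (\<lambda>x. c *\<^sub>R ?Y p x - e p x))\<^sup>2) summable_on (?J - ?F)"
    by (rule summable_on_comparison_test[OF summable_on_subset_banach[OF smh]]) (auto intro: bound)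
  \<comment> \<open>Finitely many terms do not affect summability; they absorb the indices at which
    \<open>W\<close> was chosen without regard to \<open>\<E>\<close>.\<close>
  moreover have "finite ?F"
    by (rule finite_subset[of _ "{..<N} \<times> {1..?m}"]) (use snd in force)+
  then have "(\<lambda>p. (L2_nrm (\<lambda>x. c *\<^sub>R ?Y p x - e p x))\<^sup>2) summable_on ?F" by (rule summable_on_finite)
  ultimately have "(\<lambda>p. (L2_nrm (\<lambda>x. c *\<^sub>R ?Y p x - e p x))\<^sup>2) summable_on ((?J - ?F) \<union> ?F)"
    by (rule summable_on_Un_disjoint) auto
  also have "(?J - ?F) \<union> ?F = ?J" by auto
  finally have sm: "(\<lambda>p. (L2_nrm (\<lambda>x. c *\<^sub>R ?Y p x - e p x))\<^sup>2) summable_on ?J" .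
  show ?thesis by (rule riesz_basis_of_quadratically_close[OF eL2 orth c sm assms(11)])
qed

end
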